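(* Let $\Omega\subset\mathbb{C}^2$ be a smoothly bounded, pseudoconvex domain. Suppose $p_0\in b\Omega$ is such that $c_{p_0}=4$. If $\Omega$ admits a smooth local defining function near $p_0$ which is plurisubharmonic on $b\Omega$ near $p_0$, then $\Omega$ admits a smooth local defining function near $p_0$ which is plurisubharmonic.
   Context: "Smooth" means $\mathcal{C}^\infty$; "smoothly bounded" means that $b\Omega$ is smooth. A smooth function $r\colon U\to\mathbb{R}$ is a local defining function for $\Omega$ near $p_0\in b\Omega$ if $U$ is an open neighborhood of $p_0$, $\Omega\cap U=\{r<0\}$, and $dr\ne0$ on $b\Omega\cap U$. A "holomorphic vector field" means a smooth vector field of type $(1,0)$; it is tangential if $Lr=0$ on $b\Omega$. For $(1,0)$ vector fields, $H_f(A,B)=\sum_{j,k}\frac{\partial^2f}{\partial z^j\partial\bar z^k}A^j\overline{B^k}$. $\Omega$ is pseudoconvex if $H_r(L,L)\ge0$ on $b\Omega$ for all local defining functions $r$ and all holomorphic tangential $L$. A smooth function $r\colon U\to\mathbb{R}$ is plurisubharmonic if $H_r(V,V)\ge0$ on $U$ for all $(1,0)$ vector fields $V$ on $U$. It is plurisubharmonic on $b\Omega$ near $p_0$ if, for some open neighborhood $U'$ of $p_0$, $H_r(V,V)\ge0$ at every point of $b\Omega\cap U'$ for all $(1,0)$ vector fields $V$ (all directions, only at boundary points). Type: let $L$ be a nonvanishing holomorphic tangential vector field near $p\in b\Omega$ and $\lambda:=H_r(L,L)|_{b\Omega}$. $b\Omega$ is of type $c_p=k$ at $p$ if $k\ge2$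 is the smallest integer for which there exist $L_1,\dots,L_{k-2}\in\{L,\bar L\}$ with $(L_{k-2}\cdots L_1\lambda)(p)\ne0$ (for $k=2$: $\lambda(p)\ne0$). This is independent of the choices of $r$ and $L$. *)

theory Defs
  imports "HOL-Analysis.Analysis"
begin

type_synonym C2 = "complex ^ 2"

text \<open>
  On an open set, \<open>Ck_on k\<close> is the class $C^k$ in the real sense: all iterated directional
  derivatives up to order \<open>k\<close> exist and are continuous.
\<close>

primrec Ck_on ::
  "nat \<Rightarrow> 'a::real_normed_vector set \<Rightarrow> ('a \<Rightarrow> 'b::real_normed_vector) \<Rightarrow> bool" where
  "Ck_on 0 S f \<longleftrightarrow> continuous_on S f"
| "Ck_on (Suc k) S f \<longleftrightarrow>
     (\<forall>x\<in>S. f differentiable (at x)) \<and>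
     (\<forall>v. Ck_on k S (\<lambda>x. frechet_derivative f (at x) v))"

definition smooth_on ::
  "'a::real_normed_vector set \<Rightarrow> ('a \<Rightarrow> 'b::real_normed_vector) \<Rightarrow> bool" where
  "smooth_on S f \<longleftrightarrow> (\<forall>k. Ck_on k S f)"

text \<open>
  Wirtinger derivatives. With $z^j = x^j + i y^j$, the real coordinate directions $x^j$ and
  $y^j$ are \<open>axis j 1\<close> and \<open>axis j \<i>\<close>.
\<close>

definition dz :: "2 \<Rightarrow> (C2 \<Rightarrow> complex) \<Rightarrow> C2 \<Rightarrow> complex" where
  "dz j f z = (frechet_derivative f (at z) (axis j 1)
             - \<i> * frechet_derivative f (at z) (axis j \<i>)) / 2"

definition dzbar :: "2 \<Rightarrow> (C2 \<Rightarrow> complex) \<Rightarrow> C2 \<Rightarrow> complex" where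
  "dzbar j f z = (frechet_derivative f (at z) (axis j 1)
                + \<i> * frechet_derivative f (at z) (axis j \<i>)) / 2"

text \<open>
  A $(1,0)$ vector field $L = \sum_j L^j\, \partial/\partial z^j$ is given by its coefficient
  function \<open>L :: C2 \<Rightarrow> C2\<close>. Its action on functions is \<open>act10 L\<close>, that of its conjugate
  $\bar L$ is \<open>act01 L\<close>.
\<close>

definition act10 :: "(C2 \<Rightarrow> C2) \<Rightarrow> (C2 \<Rightarrow> complex) \<Rightarrow> C2 \<Rightarrow> complex" where
  "act10 L f z = (\<Sum>j\<in>UNIV. L z $ j * dz j f z)"

definition act01 :: "(C2 \<Rightarrow> C2) \<Rightarrow> (C2 \<Rightarrow> complex) \<Rightarrow> C2 \<Rightarrow> complex" where
  "act01 L f z = (\<Sum>j\<in>UNIV. cnj (L z $ j) * dzbar j f z)"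

definition complex_hessian ::
  "(C2 \<Rightarrow> real) \<Rightarrow> (C2 \<Rightarrow> C2) \<Rightarrow> (C2 \<Rightarrow> C2) \<Rightarrow> C2 \<Rightarrow> complex" where
  "complex_hessian f A B z =
     (\<Sum>j\<in>UNIV. \<Sum>k\<in>UNIV.
        dz j (dzbar k (\<lambda>w. complex_of_real (f w))) z * A z $ j * cnj (B z $ k))"

definition local_defining_function :: "C2 set \<Rightarrow> C2 \<Rightarrow> C2 set \<Rightarrow> (C2 \<Rightarrow> real) \<Rightarrow> bool" where
  "local_defining_function \<Omega> p U r \<longleftrightarrow>
     open U \<and> p \<in> U \<and> smooth_on U r \<and> \<Omega> \<inter> U = {z \<in> U. r z < 0} \<and>
     (\<forall>z \<in> frontier \<Omega> \<inter> U. frechet_derivative r (at z) \<noteq> (\<lambda>v. 0))"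

text \<open>Smoothness of the boundary only; no boundedness of \<open>\<Omega>\<close> is implied.\<close>

definition smoothly_bounded :: "C2 set \<Rightarrow> bool" where
  "smoothly_bounded \<Omega> \<longleftrightarrow> (\<forall>p \<in> frontier \<Omega>. \<exists>U r. local_defining_function \<Omega> p U r)"

definition tangential :: "C2 set \<Rightarrow> C2 set \<Rightarrow> (C2 \<Rightarrow> real) \<Rightarrow> (C2 \<Rightarrow> C2) \<Rightarrow> bool" where
  "tangential \<Omega> U r L \<longleftrightarrow>
     (\<forall>z \<in> frontier \<Omega> \<inter> U. act10 L (\<lambda>w. complex_of_real (r w)) z = 0)"

text \<open>
  For real-valued smooth \<open>r\<close> the number \<open>complex_hessian r V V z\<close> is real, so its
  nonnegativity is that of its real part.
\<close>

definition pseudoconvex :: "C2 set \<Rightarrow> bool" where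
  "pseudoconvex \<Omega> \<longleftrightarrow>
     (\<forall>p \<in> frontier \<Omega>. \<forall>U r L.
        local_defining_function \<Omega> p U r \<and> smooth_on U L \<and> tangential \<Omega> U r L \<longrightarrow>
        (\<forall>z \<in> frontier \<Omega> \<inter> U. 0 \<le> Re (complex_hessian r L L z)))"

definition plurisubharmonic_on :: "C2 set \<Rightarrow> (C2 \<Rightarrow> real) \<Rightarrow> bool" where
  "plurisubharmonic_on U r \<longleftrightarrow>
     (\<forall>V. smooth_on U V \<longrightarrow> (\<forall>z\<in>U. 0 \<le> Re (complex_hessian r V V z)))"

definition plurisubharmonic_on_boundary_near ::
  "C2 set \<Rightarrow> C2 \<Rightarrow> C2 set \<Rightarrow> (C2 \<Rightarrow> real) \<Rightarrow> bool" where
  "plurisubharmonic_on_boundary_near \<Omega> p U r \<longleftrightarrow>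
     (\<exists>U'. open U' \<and> p \<in> U' \<and> U' \<subseteq> U \<and>
        (\<forall>V. smooth_on U' V \<longrightarrow>
           (\<forall>z \<in> frontier \<Omega> \<inter> U'. 0 \<le> Re (complex_hessian r V V z))))"

text \<open>
  \<open>nonzero_word L lam p m\<close>: some $L_m \cdots L_1$ \<open>lam\<close> with $L_i \in \{L, \bar L\}$ is nonzero
  at \<open>p\<close>; \<open>fold\<close> applies the head $L_1$ of the list first. In \<open>boundary_type\<close>, \<open>lam\<close> is the
  function $H_r(L,L)$ on a whole neighborhood of \<open>p\<close> rather than its restriction to the boundary.
  Since $L$ and $\bar L$ are tangential, their action on a function on the boundary is
  the restriction of their action on any smooth extension, so the values at \<open>p\<close> agree.
\<close>

definition nonzero_word :: "(C2 \<Rightarrow> C2) \<Rightarrow> (C2 \<Rightarrow> complex) \<Rightarrow> C2 \<Rightarrow> nat \<Rightarrow> bool" where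
  "nonzero_word L lam p m \<longleftrightarrow>
     (\<exists>Ls. length Ls = m \<and> set Ls \<subseteq> {act10 L, act01 L} \<and> fold (\<lambda>X f. X f) Ls lam p \<noteq> 0)"

text \<open>
  The type does not depend on the choice of \<open>r\<close> and \<open>L\<close>, so asking for some choice
  is the same as asking for every choice.
\<close>

definition boundary_type :: "C2 set \<Rightarrow> C2 \<Rightarrow> nat \<Rightarrow> bool" where
  "boundary_type \<Omega> p k \<longleftrightarrow>
     p \<in> frontier \<Omega> \<and>
     (\<exists>U r L. local_defining_function \<Omega> p U r \<and>
        smooth_on U L \<and> (\<forall>z\<in>U. L z \<noteq> 0) \<and> tangential \<Omega> U r L \<and>
        2 \<le> k \<and> nonzero_word L (complex_hessian r L L) p (k - 2) \<and>
        (\<forall>m. 2 \<le> m \<and> m < k \<longrightarrow> \<not> nonzero_word L (complex_hessian r L L) p (m - 2)))"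

end

theory Submission
  imports Defs
begin

text \<open>
  Everything is done in real directional derivatives: \<open>dir v f\<close> is the derivative of \<open>f\<close> in
  direction \<open>v\<close>, and \<open>levi f u v\<close> is four times the real part of the complex Hessian.

  Let $L$ be complex tangential to all level sets of $r$, let $N$ be a constant transversal
  direction, $\lambda = H_r(L,L)$, and let $a$ be the normal derivative of $\lambda$ with respect
  to $r$. Off the boundary, $\Lambda = \lambda - r a + C_0 r^2$ dominates both $r^2$ and the value
  of $\lambda$ at the projection along $N$. The only obstruction to plurisubharmonicity of
  $r + K r^2$ off the boundary, up to $O(r^2)$, is the term $r a$. A real function $X$ with
  $X^2 \le C \lambda$ on the boundary and $L X \ne 0$ at the point removes it: for
  $\phi = c X^2$ with suitable $c$ one has $H_\phi(L,L) = - a + O(X)$ and $L\phi = O(X)$, so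
  multiplying $r$ by $1 + \phi$ replaces $r a$ by $O(r X)$, which $\Lambda$ absorbs. The new
  defining function is $r (1 + \phi + r (K + M |z - p|^2))$, where $K$ (chosen first) makes the
  normal direction positive and $M$ absorbs the remaining $O(r^2)$ in the tangential one.

  Type $4$ provides $X$: it is, up to a factor, the real or imaginary part of the derivative along $L$ of
  the Levi form $\lambda_1 \ge 0$ from the definition of the type; $L X \ne 0$ is the nonvanishing
  second derivative, and $X^2 \le C \lambda_1$ is the gradient bound for nonnegative functions
  along the boundary. The Levi forms of two defining functions are proportional on the boundary.
\<close>

subsection \<open>Smooth functions\<close>

text \<open>Positivity is tested in the complex frame \<open>L z\<close>, \<open>N\<close>: the
  diagonal entries must be nonnegative and the squared mixed entry at most their product. The
  tangential entry is bounded below only by a multiple of \<Lambda>, so the mixed entry must be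
  O(sqrt \<Lambda>). This is where nonnegativity on the boundary in all directions enters: by
  Cauchy-Schwarz the squared mixed entry of r is there at most a multiple of \<lambda>, and
  \<Lambda> carries this bound off the boundary.

  The term K r^2 yields nothing of size r^2 in the direction L, since L r = 0 on all level sets; the
  weight |z - p|^2 has a positive Hessian and yields 4 M r^2 |L|^2. In the normal and mixed entries
  M occurs only next to r, |z - p|^2 or its gradient, all small near p. So a bound B for quantities
  free of K and M comes first, then K, then M, and the neighbourhood last.

  The type condition and the plurisubharmonicity come with different defining functions. Comparing
  these at boundary points only avoids proving that their quotient is smooth.\<close>

abbreviation dir :: "'a::real_normed_vector \<Rightarrow> ('a \<Rightarrow> 'b::real_normed_vector) \<Rightarrow> 'a \<Rightarrow> 'b" where
  "dir v f \<equiv> (\<lambda>z. frechet_derivative f (at z) v)"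

lemma dir_eqI: "(f has_derivative f') (at z) \<Longrightarrow> dir v f z = f' v"
  by (metis frechet_derivative_at)

lemma dir_cong:
  assumes "open S" "\<And>x. x \<in> S \<Longrightarrow> f x = g x" "z \<in> S"
  shows "dir v f z = dir v g z"
proof -
  have "(f has_derivative D) (at z) \<longleftrightarrow> (g has_derivative D) (at z)" for D
    using has_derivative_transform_within_open[OF _ assms(1,3)] assms(2) by metis
  then show ?thesis unfolding frechet_derivative_def by simp
qed

lemma differentiableI: "(f has_derivative D) F \<Longrightarrow> f differentiable F"
  by (auto simp: differentiable_def)

lemma differentiable_cong_open:
  assumes "open S" "\<And>x. x \<in> S \<Longrightarrow> f x = g x" "z \<in> S"
  shows "f differentiable (at z) \<longleftrightarrow> g differentiable (at z)"
proof -
  have "(f has_derivative D) (at z) \<longleftrightarrow> (g has_derivative D) (at z)" for D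
    using has_derivative_transform_within_open[OF _ assms(1,3)] assms(2) by metis
  then show ?thesis unfolding differentiable_def by simp
qed

lemma Ck_on_cong:
  assumes "open S" "\<And>x. x \<in> S \<Longrightarrow> f x = g x"
  shows "Ck_on k S f \<longleftrightarrow> Ck_on k S g"
  using assms(2)
proof (induction k arbitrary: f g)
  case 0
  then show ?case by (simp cong: continuous_on_cong)
next
  case (Suc k)
  have "Ck_on k S (dir v f) \<longleftrightarrow> Ck_on k S (dir v g)" for v
    using Suc.IH[of "dir v f" "dir v g"] dir_cong[where f=f and g=g, OF assms(1) Suc.prems] by blast
  then show ?case using differentiable_cong_open[OF assms(1) Suc.prems] by simp
qed

lemma Ck_on_Suc_imp: "Ck_on (Suc k) S f \<Longrightarrow> Ck_on k S f"
proof (induction k arbitrary: f)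
  case 0
  then show ?case
    by (auto intro!: continuous_at_imp_continuous_on differentiable_imp_continuous_within)
next
  case (Suc k)
  show ?case unfolding Ck_on.simps(2)[of k]
    using Suc.prems Suc.IH unfolding Ck_on.simps(2)[of "Suc k"] by blast
qed

lemma Ck_on_subset: "Ck_on k S f \<Longrightarrow> T \<subseteq> S \<Longrightarrow> Ck_on k T f"
  by (induction k arbitrary: f) (auto intro: continuous_on_subset)

lemma Ck_on_const: "Ck_on k S (\<lambda>x. c)"
  by (induction k arbitrary: c) auto

lemma Ck_on_bounded_linear_comp:
  assumes "open S" "bounded_linear h" "Ck_on k S f"
  shows "Ck_on k S (\<lambda>x. h (f x))"
  using assms(3)
proof (induction k arbitrary: f)
  case 0
  then show ?case
    using assms(2) by (auto intro: continuous_on_compose2[OF linear_continuous_on])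
next
  case (Suc k)
  have D: "((\<lambda>x. h (f x)) has_derivative (\<lambda>v. h (dir v f x))) (at x)" if "x \<in> S" for x
    using Suc.prems that
    by (intro bounded_linear.has_derivative[OF assms(2)]) (simp add: frechet_derivative_works[symmetric])
  have "Ck_on k S (dir v (\<lambda>x. h (f x))) \<longleftrightarrow> Ck_on k S (\<lambda>x. h (dir v f x))" for v
    by (rule Ck_on_cong[OF assms(1)]) (rule dir_eqI[OF D])
  then show ?case using Suc differentiableI[OF D] by simp
qed

lemma Ck_on_add:
  assumes "open S" "Ck_on k S f" "Ck_on k S g"
  shows "Ck_on k S (\<lambda>x. f x + g x)"
  using assms(2,3)
proof (induction k arbitrary: f g)
  case 0
  then show ?case by (simp add: continuous_on_add)
next
  case (Suc k)
  have D: "((\<lambda>x. f x + g x) has_derivative (\<lambda>v. dir v f x + dir v g x)) (at x)" if "x \<in> S" for x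
    using Suc.prems that by (intro has_derivative_add) (simp_all add: frechet_derivative_works[symmetric])
  have "Ck_on k S (dir v (\<lambda>x. f x + g x)) \<longleftrightarrow> Ck_on k S (\<lambda>x. dir v f x + dir v g x)" for v
    by (rule Ck_on_cong[OF assms(1)]) (rule dir_eqI[OF D])
  then show ?case using Suc differentiableI[OF D] by simp
qed

text \<open>The Leibniz rule for an arbitrary bounded bilinear map, so that products, scalings and
  inner products share one induction. At order \<open>Suc k\<close> the undifferentiated factors are
  needed at order \<open>k\<close> as well, which \<open>Ck_on_Suc_imp\<close> supplies.\<close>

lemma Ck_on_bilinear:
  assumes "open S" "bounded_bilinear p" "Ck_on k S f" "Ck_on k S g"
  shows "Ck_on k S (\<lambda>x. p (f x) (g x))"
  using assms(3,4)
proof (induction k arbitrary: f g)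
  case 0
  then show ?case using bounded_bilinear.continuous_on[OF assms(2)] by auto
next
  case (Suc k)
  have D: "((\<lambda>x. p (f x) (g x)) has_derivative (\<lambda>v. p (f x) (dir v g x) + p (dir v f x) (g x))) (at x)"
    if "x \<in> S" for x
    using Suc.prems that
    by (intro bounded_bilinear.FDERIV[OF assms(2)]) (simp_all add: frechet_derivative_works[symmetric])
  have "Ck_on k S (dir v (\<lambda>x. p (f x) (g x))) \<longleftrightarrow>
      Ck_on k S (\<lambda>x. p (f x) (dir v g x) + p (dir v f x) (g x))" for v
    by (rule Ck_on_cong[OF assms(1)]) (rule dir_eqI[OF D])
  moreover have "Ck_on k S (\<lambda>x. p (f x) (dir v g x) + p (dir v f x) (g x))" for v
    using Suc.prems Suc.IH Ck_on_Suc_imp[OF Suc.prems(1)] Ck_on_Suc_imp[OF Suc.prems(2)]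
    by (intro Ck_on_add[OF assms(1)]) auto
  ultimately show ?case using Suc differentiableI[OF D] by simp
qed

text \<open>The derivative of 1/f is a product of a derivative of f with copies of 1/f, which are
  needed only at one order lower, so the induction closes.\<close>

lemma Ck_on_inverse:
  fixes f :: "'a::real_normed_vector \<Rightarrow> real"
  assumes "open S" "Ck_on k S f" "\<And>x. x \<in> S \<Longrightarrow> f x \<noteq> 0"
  shows "Ck_on k S (\<lambda>x. inverse (f x))"
  using assms(2)
proof (induction k)
  case 0
  then show ?case using assms(3) by (simp add: continuous_on_inverse)
next
  case (Suc k)
  have D: "((\<lambda>x. inverse (f x)) has_derivative
      (\<lambda>v. - (inverse (f x) * dir v f x * inverse (f x)))) (at x)" if "x \<in> S" for x
    using Suc.prems that assms(3)[OF that]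
    by (intro Deriv.has_derivative_inverse) (simp_all add: frechet_derivative_works[symmetric])
  have eq: "Ck_on k S (dir v (\<lambda>x. inverse (f x))) \<longleftrightarrow>
      Ck_on k S (\<lambda>x. - (inverse (f x) * dir v f x * inverse (f x)))" for v
    by (rule Ck_on_cong[OF assms(1)]) (rule dir_eqI[OF D])
  note m = Ck_on_bilinear[OF assms(1) bounded_bilinear_mult]
  have i: "Ck_on k S (\<lambda>x. inverse (f x))" using Suc.IH Ck_on_Suc_imp[OF Suc.prems] by blast
  have "Ck_on k S (\<lambda>x. - (inverse (f x) * dir v f x * inverse (f x)))" for v
    by (intro Ck_on_bounded_linear_comp[OF assms(1), of uminus] m i)
      (use Suc.prems in \<open>auto intro: bounded_linear_minus bounded_linear_ident\<close>)
  then show ?case using eq differentiableI[OF D] by simp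
qed

section \<open>Closure properties of \<open>smooth_on\<close>\<close>

lemma smooth_on_cong:
  "open S \<Longrightarrow> (\<And>x. x \<in> S \<Longrightarrow> f x = g x) \<Longrightarrow> smooth_on S f \<longleftrightarrow> smooth_on S g"
  unfolding smooth_on_def using Ck_on_cong by metis

lemma smooth_on_subset: "smooth_on S f \<Longrightarrow> T \<subseteq> S \<Longrightarrow> smooth_on T f"
  unfolding smooth_on_def using Ck_on_subset by blast

lemma smooth_on_const: "smooth_on S (\<lambda>x. c)"
  unfolding smooth_on_def using Ck_on_const by blast

lemma smooth_on_bounded_linear_comp:
  "open S \<Longrightarrow> bounded_linear h \<Longrightarrow> smooth_on S f \<Longrightarrow> smooth_on S (\<lambda>x. h (f x))"
  unfolding smooth_on_def using Ck_on_bounded_linear_comp by blast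

lemma smooth_on_ident: "smooth_on S (\<lambda>x. x)"
  unfolding smooth_on_def
proof
  fix k show "Ck_on k S (\<lambda>x. x)" by (cases k) (auto simp: Ck_on_const)
qed

lemma smooth_on_add: "open S \<Longrightarrow> smooth_on S f \<Longrightarrow> smooth_on S g \<Longrightarrow> smooth_on S (\<lambda>x. f x + g x)"
  unfolding smooth_on_def using Ck_on_add by blast

lemma smooth_on_bilinear:
  "open S \<Longrightarrow> bounded_bilinear p \<Longrightarrow> smooth_on S f \<Longrightarrow> smooth_on S g \<Longrightarrow> smooth_on S (\<lambda>x. p (f x) (g x))"
  unfolding smooth_on_def using Ck_on_bilinear by blast

lemmas smooth_on_mult = smooth_on_bilinear[OF _ bounded_bilinear_mult]
lemmas smooth_on_scaleR = smooth_on_bilinear[OF _ bounded_bilinear_scaleR]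
lemmas smooth_on_inner = smooth_on_bilinear[OF _ bounded_bilinear_inner]

lemma smooth_on_minus: "open S \<Longrightarrow> smooth_on S f \<Longrightarrow> smooth_on S (\<lambda>x. - f x)"
  using smooth_on_bounded_linear_comp[OF _ bounded_linear_minus[OF bounded_linear_ident]] by blast

lemma smooth_on_diff: "open S \<Longrightarrow> smooth_on S f \<Longrightarrow> smooth_on S g \<Longrightarrow> smooth_on S (\<lambda>x. f x - g x)"
  using smooth_on_add[of S f "\<lambda>x. - g x"] smooth_on_minus by auto

lemma smooth_on_power2:
  fixes f :: "'a::real_normed_vector \<Rightarrow> real"
  shows "open S \<Longrightarrow> smooth_on S f \<Longrightarrow> smooth_on S (\<lambda>x. (f x)\<^sup>2)"
  using smooth_on_mult by (simp add: power2_eq_square)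

lemma smooth_on_divide:
  fixes f g :: "'a::real_normed_vector \<Rightarrow> real"
  assumes "open S" "smooth_on S f" "smooth_on S g" "\<And>x. x \<in> S \<Longrightarrow> g x \<noteq> 0"
  shows "smooth_on S (\<lambda>x. f x / g x)"
proof -
  have "smooth_on S (\<lambda>x. inverse (g x))"
    using Ck_on_inverse[where f=g, OF assms(1) _ assms(4)] assms(3) unfolding smooth_on_def by blast
  then show ?thesis using smooth_on_mult[OF assms(1,2)] by (simp add: divide_inverse)
qed

lemma smooth_on_sum:
  assumes "open S" "\<And>i. i \<in> I \<Longrightarrow> smooth_on S (f i)"
  shows "smooth_on S (\<lambda>x. \<Sum>i\<in>I. f i x)"
  using assms(2)
  by (induction I rule: infinite_finite_induct) (auto intro: smooth_on_const smooth_on_add assms(1))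

lemma smooth_on_dir: "smooth_on S f \<Longrightarrow> smooth_on S (dir v f)"
  unfolding smooth_on_def using Ck_on.simps(2) by blast

lemma smooth_on_imp_differentiable: "smooth_on S f \<Longrightarrow> z \<in> S \<Longrightarrow> f differentiable (at z)"
  unfolding smooth_on_def using Ck_on.simps(2)[of 0 S f] by blast

lemma smooth_on_has_derivative: "smooth_on S f \<Longrightarrow> z \<in> S \<Longrightarrow> (f has_derivative (\<lambda>v. dir v f z)) (at z)"
  using smooth_on_imp_differentiable frechet_derivative_works by blast

lemma smooth_on_imp_continuous_on: "smooth_on S f \<Longrightarrow> continuous_on S f"
  unfolding smooth_on_def using Ck_on.simps(1)[of S f] by blast

lemma linear_dir: "smooth_on S f \<Longrightarrow> z \<in> S \<Longrightarrow> linear (\<lambda>v. dir v f z)"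
  using linear_frechet_derivative smooth_on_imp_differentiable by blast

lemma dir_euclidean_expand:
  fixes f :: "'a::euclidean_space \<Rightarrow> 'b::real_normed_vector"
  assumes "smooth_on S f" "z \<in> S"
  shows "dir v f z = (\<Sum>b\<in>Basis. (v \<bullet> b) *\<^sub>R dir b f z)"
proof -
  interpret linear "\<lambda>v. dir v f z" by (rule linear_dir[OF assms])
  have "dir v f z = dir (\<Sum>b\<in>Basis. (v \<bullet> b) *\<^sub>R b) f z" by (simp only: euclidean_representation)
  then show ?thesis by (simp only: sum scale)
qed

text \<open>\<open>Ck_on\<close> differentiates in fixed directions only; expanding
  \<open>V z\<close> in the basis turns a moving direction into smooth coefficients times
  fixed-direction derivatives.\<close>

lemma smooth_on_dir_field:
  fixes f :: "'a::euclidean_space \<Rightarrow> 'b::real_normed_vector"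
  assumes "open S" "smooth_on S f" "smooth_on S V"
  shows "smooth_on S (\<lambda>z. dir (V z) f z)"
proof -
  have "smooth_on S (\<lambda>z. dir (V z) f z) \<longleftrightarrow> smooth_on S (\<lambda>z. \<Sum>b\<in>Basis. (V z \<bullet> b) *\<^sub>R dir b f z)"
    by (rule smooth_on_cong[OF assms(1)]) (rule dir_euclidean_expand[OF assms(2)])
  moreover have "smooth_on S (\<lambda>z. \<Sum>b\<in>Basis. (V z \<bullet> b) *\<^sub>R dir b f z)"
    by (intro smooth_on_sum smooth_on_scaleR smooth_on_inner smooth_on_const smooth_on_dir assms)
  ultimately show ?thesis by blast
qed

lemma dir_add:
  assumes "smooth_on S f" "smooth_on S g" "z \<in> S"
  shows "dir v (\<lambda>x. f x + g x) z = dir v f z + dir v g z"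
  by (rule dir_eqI[OF has_derivative_add]) (use smooth_on_has_derivative assms in blast)+

lemma dir_diff:
  assumes "smooth_on S f" "smooth_on S g" "z \<in> S"
  shows "dir v (\<lambda>x. f x - g x) z = dir v f z - dir v g z"
  by (rule dir_eqI[OF has_derivative_diff]) (use smooth_on_has_derivative assms in blast)+

lemma dir_mult:
  fixes f g :: "'a::real_normed_vector \<Rightarrow> real"
  assumes "smooth_on S f" "smooth_on S g" "z \<in> S"
  shows "dir v (\<lambda>x. f x * g x) z = f z * dir v g z + dir v f z * g z"
  by (rule dir_eqI[OF has_derivative_mult]) (use smooth_on_has_derivative assms in blast)+

lemma dir_bounded_linear_comp:
  assumes "bounded_linear h" "smooth_on S f" "z \<in> S"
  shows "dir v (\<lambda>x. h (f x)) z = h (dir v f z)"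
  by (rule dir_eqI[OF bounded_linear.has_derivative[OF assms(1)]])
    (use smooth_on_has_derivative assms in blast)

lemma dir_scaleR_vec: "smooth_on S f \<Longrightarrow> z \<in> S \<Longrightarrow> dir (c *\<^sub>R v) f z = c *\<^sub>R dir v f z"
  using linear_dir[of S f z] by (simp add: linear_cmul)

lemma dir_add_vec: "smooth_on S f \<Longrightarrow> z \<in> S \<Longrightarrow> dir (u + v) f z = dir u f z + dir v f z"
  using linear_dir[of S f z] by (simp add: linear_add)

subsection \<open>Second-order estimates\<close>

lemma smooth_on_line_derivative:
  fixes f :: "'a::real_normed_vector \<Rightarrow> real"
  assumes "smooth_on S f" "z + t *\<^sub>R v \<in> S"
  shows "((\<lambda>t. f (z + t *\<^sub>R v)) has_real_derivative dir v f (z + t *\<^sub>R v)) (at t)"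
proof -
  have "((\<lambda>t. z + t *\<^sub>R v) has_derivative (\<lambda>h. h *\<^sub>R v)) (at t)"
    by (auto intro!: derivative_eq_intros)
  from has_derivative_compose[OF this smooth_on_has_derivative[OF assms]]
  have "((\<lambda>t. f (z + t *\<^sub>R v)) has_derivative (\<lambda>h. dir (h *\<^sub>R v) f (z + t *\<^sub>R v))) (at t)" .
  moreover have "(\<lambda>h. dir (h *\<^sub>R v) f (z + t *\<^sub>R v)) = (*) (dir v f (z + t *\<^sub>R v))"
    by (rule ext) (simp only: dir_scaleR_vec[OF assms] real_scaleR_def mult.commute)
  ultimately show ?thesis unfolding has_field_derivative_def by simp
qed

text \<open>The mean value theorem is applied twice, first along \<open>u\<close> to the increment
  of \<open>f\<close> across \<open>v\<close>, then along \<open>v\<close>. The second difference is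
  symmetric in \<open>u\<close> and \<open>v\<close>, which is what \<open>dir_commute\<close>
  exploits.\<close>

lemma mixed_second_difference:
  fixes f :: "'a::real_normed_vector \<Rightarrow> real"
  assumes "smooth_on S f" "0 < s"
    and S: "\<And>x y. 0 \<le> x \<Longrightarrow> x \<le> s \<Longrightarrow> 0 \<le> y \<Longrightarrow> y \<le> s \<Longrightarrow> z + x *\<^sub>R u + y *\<^sub>R v \<in> S"
  shows "\<exists>x y. 0 < x \<and> x < s \<and> 0 < y \<and> y < s \<and>
    f (z + s *\<^sub>R u + s *\<^sub>R v) - f (z + s *\<^sub>R u) - f (z + s *\<^sub>R v) + f z
      = s\<^sup>2 * dir v (dir u f) (z + x *\<^sub>R u + y *\<^sub>R v)"
proof -
  define \<phi> where "\<phi> x = f ((z + s *\<^sub>R v) + x *\<^sub>R u) - f (z + x *\<^sub>R u)" for x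
  have "(\<phi> has_real_derivative dir u f ((z + s *\<^sub>R v) + x *\<^sub>R u) - dir u f (z + x *\<^sub>R u)) (at x)"
    if "0 \<le> x" "x \<le> s" for x
    unfolding \<phi>_def
    by (intro DERIV_diff smooth_on_line_derivative[OF assms(1)])
      (use S[of x s] S[of x 0] that assms(2) in \<open>auto simp: algebra_simps\<close>)
  from MVT2[OF assms(2) this] obtain x where x: "0 < x" "x < s"
    "\<phi> s - \<phi> 0 = (s - 0) * (dir u f ((z + s *\<^sub>R v) + x *\<^sub>R u) - dir u f (z + x *\<^sub>R u))" by blast
  have "((\<lambda>y. dir u f ((z + x *\<^sub>R u) + y *\<^sub>R v)) has_real_derivative
      dir v (dir u f) ((z + x *\<^sub>R u) + y *\<^sub>R v)) (at y)" if "0 \<le> y" "y \<le> s" for y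
    by (intro smooth_on_line_derivative[OF smooth_on_dir[OF assms(1)]])
      (use S[of x y] that x in auto)
  from MVT2[OF assms(2) this] obtain y where y: "0 < y" "y < s"
    "dir u f ((z + x *\<^sub>R u) + s *\<^sub>R v) - dir u f ((z + x *\<^sub>R u) + 0 *\<^sub>R v)
      = (s - 0) * dir v (dir u f) ((z + x *\<^sub>R u) + y *\<^sub>R v)" by blast
  have "dir u f ((z + s *\<^sub>R v) + x *\<^sub>R u) - dir u f (z + x *\<^sub>R u)
      = s * dir v (dir u f) (z + x *\<^sub>R u + y *\<^sub>R v)"
    using y(3) by (simp add: algebra_simps)
  with x(3) have "\<phi> s - \<phi> 0 = s\<^sup>2 * dir v (dir u f) (z + x *\<^sub>R u + y *\<^sub>R v)"
    by (simp add: power2_eq_square)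
  then show ?thesis using x(1,2) y(1,2) unfolding \<phi>_def
    by (intro exI[of _ x] exI[of _ y]) (simp add: algebra_simps)
qed

lemma continuous_at_eventually_nhds:
  fixes F :: "'a::metric_space \<Rightarrow> 'b::metric_space"
  assumes "continuous (at z) F" "e > 0"
  shows "\<forall>\<^sub>F x in nhds z. dist (F x) (F z) < e"
  using assms unfolding continuous_at_eps_delta eventually_nhds_metric by metis

lemma dir_commute:
  fixes f :: "'a::real_normed_vector \<Rightarrow> real"
  assumes "open S" "smooth_on S f" "z \<in> S"
  shows "dir u (dir v f) z = dir v (dir u f) z"
proof (rule ccontr)
  define F where "F = dir v (dir u f)"
  define G where "G = dir u (dir v f)"
  assume "dir u (dir v f) z \<noteq> dir v (dir u f) z"
  then have e: "\<bar>G z - F z\<bar> / 2 > 0" (is "?e > 0") by (simp add: F_def G_def)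
  have "continuous (at z) F" "continuous (at z) G"
    using assms smooth_on_imp_continuous_on[OF smooth_on_dir[OF smooth_on_dir[OF assms(2)]]]
    unfolding F_def G_def by (auto simp: continuous_on_eq_continuous_at)
  then have "\<forall>\<^sub>F x in nhds z. dist (F x) (F z) < ?e" "\<forall>\<^sub>F x in nhds z. dist (G x) (G z) < ?e"
    using e by (blast intro: continuous_at_eventually_nhds)+
  moreover have "\<forall>\<^sub>F x in nhds z. x \<in> S" using assms eventually_nhds by blast
  ultimately have "\<forall>\<^sub>F x in nhds z. dist (F x) (F z) < ?e \<and> dist (G x) (G z) < ?e \<and> x \<in> S"
    by eventually_elim auto
  then obtain d where d: "d > 0"
    "\<And>x. dist x z < d \<Longrightarrow> dist (F x) (F z) < ?e \<and> dist (G x) (G z) < ?e \<and> x \<in> S"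
    unfolding eventually_nhds_metric by blast
  \<comment> \<open>The parallelogram with sides \<open>s *\<^sub>R u\<close> and
    \<open>s *\<^sub>R v\<close> has to stay in the ball of radius \<open>d\<close>; the summand 1
    covers the case of two zero vectors.\<close>
  define s where "s = d / (2 * (norm u + norm v + 1))"
  have n: "norm u + norm v + 1 > 0" using norm_ge_zero[of u] norm_ge_zero[of v] by linarith
  have s: "s > 0" using d(1) n by (simp add: s_def)
  have sd: "s * (norm u + norm v) < d"
  proof -
    have "s * (norm u + norm v) \<le> s * (norm u + norm v + 1)" using s by simp
    also have "\<dots> = d / 2" using n by (simp add: s_def field_simps)
    also have "\<dots> < d" using d(1) by simp
    finally show ?thesis .
  qed
  have near: "dist (z + x *\<^sub>R u + y *\<^sub>R v) z < d" if "0 \<le> x" "x \<le> s" "0 \<le> y" "y \<le> s" for x y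
  proof -
    have "dist (z + x *\<^sub>R u + y *\<^sub>R v) z = norm (x *\<^sub>R u + y *\<^sub>R v)" by (simp add: dist_norm)
    also have "\<dots> \<le> norm (x *\<^sub>R u) + norm (y *\<^sub>R v)" by (rule norm_triangle_ineq)
    also have "\<dots> = x * norm u + y * norm v" using that by simp
    also have "\<dots> \<le> s * norm u + s * norm v" using that by (intro add_mono mult_right_mono) auto
    finally show ?thesis using sd by (simp add: algebra_simps)
  qed
  obtain x y where xy: "0 < x" "x < s" "0 < y" "y < s"
    "f (z + s *\<^sub>R u + s *\<^sub>R v) - f (z + s *\<^sub>R u) - f (z + s *\<^sub>R v) + f z = s\<^sup>2 * F (z + x *\<^sub>R u + y *\<^sub>R v)"
    using mixed_second_difference[OF assms(2) s, of z u v] d(2) near unfolding F_def by blast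
  have near': "dist (z + x *\<^sub>R v + y *\<^sub>R u) z < d" if "0 \<le> x" "x \<le> s" "0 \<le> y" "y \<le> s" for x y
    using near[OF that(3,4,1,2)] by (simp add: algebra_simps)
  obtain x' y' where xy': "0 < x'" "x' < s" "0 < y'" "y' < s"
    "f (z + s *\<^sub>R v + s *\<^sub>R u) - f (z + s *\<^sub>R v) - f (z + s *\<^sub>R u) + f z = s\<^sup>2 * G (z + x' *\<^sub>R v + y' *\<^sub>R u)"
    using mixed_second_difference[OF assms(2) s, of z v u] d(2) near' unfolding G_def by blast
  \<comment> \<open>The second difference does not depend on the order of \<open>u\<close> and
    \<open>v\<close>, so the two mixed derivatives agree at nearby points, where each is within half
    the assumed gap of its value at \<open>z\<close>.\<close>
  have "s\<^sup>2 * F (z + x *\<^sub>R u + y *\<^sub>R v) = s\<^sup>2 * G (z + x' *\<^sub>R v + y' *\<^sub>R u)"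
    using xy(5) xy'(5) by (simp add: algebra_simps)
  then have "F (z + x *\<^sub>R u + y *\<^sub>R v) = G (z + x' *\<^sub>R v + y' *\<^sub>R u)" using s by simp
  moreover have "dist (F (z + x *\<^sub>R u + y *\<^sub>R v)) (F z) < ?e" "dist (G (z + x' *\<^sub>R v + y' *\<^sub>R u)) (G z) < ?e"
    using d(2) near[of x y] near'[of x' y'] xy xy' by auto
  ultimately show False unfolding dist_real_def by (smt (verit) field_sum_of_halves)
qed

section \<open>Uniform first-order and second-order bounds on a ball\<close>

lemma smooth_on_local_lipschitz:
  fixes f :: "'a::euclidean_space \<Rightarrow> real"
  assumes "open S" "p \<in> S" "smooth_on S f"
  shows "\<exists>\<delta>>0. \<exists>C>0. ball p \<delta> \<subseteq> S \<and> (\<forall>x\<in>ball p \<delta>. \<forall>v. \<bar>dir v f x\<bar> \<le> C * norm v) \<and>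
    (\<forall>x\<in>ball p \<delta>. \<forall>y\<in>ball p \<delta>. \<bar>f y - f x\<bar> \<le> C * norm (y - x))"
proof -
  have "\<forall>\<^sub>F x in nhds p. \<bar>dir b f x\<bar> \<le> \<bar>dir b f p\<bar> + 1" for b
  proof -
    have "continuous (at p) (dir b f)"
      using assms smooth_on_imp_continuous_on[OF smooth_on_dir[OF assms(3)]]
      by (auto simp: continuous_on_eq_continuous_at)
    then have "\<forall>\<^sub>F x in nhds p. dist (dir b f x) (dir b f p) < 1"
      by (rule continuous_at_eventually_nhds) simp
    then show ?thesis by eventually_elim (auto simp: dist_real_def)
  qed
  then have "\<forall>\<^sub>F x in nhds p. \<forall>b\<in>Basis. \<bar>dir b f x\<bar> \<le> \<bar>dir b f p\<bar> + 1"
    by (intro eventually_ball_finite) auto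
  moreover have "\<forall>\<^sub>F x in nhds p. x \<in> S" using assms eventually_nhds by blast
  ultimately have "\<forall>\<^sub>F x in nhds p. (\<forall>b\<in>Basis. \<bar>dir b f x\<bar> \<le> \<bar>dir b f p\<bar> + 1) \<and> x \<in> S"
    by eventually_elim auto
  then obtain d where d: "d > 0"
    "\<And>x b. dist x p < d \<Longrightarrow> b \<in> Basis \<Longrightarrow> \<bar>dir b f x\<bar> \<le> \<bar>dir b f p\<bar> + 1" "\<And>x. dist x p < d \<Longrightarrow> x \<in> S"
    unfolding eventually_nhds_metric by blast
  define C where "C = 1 + (\<Sum>b\<in>Basis. \<bar>dir b f p\<bar> + 1)"
  have C: "C > 0" unfolding C_def by (intro add_pos_nonneg sum_nonneg) auto
  have sub: "ball p d \<subseteq> S" using d(3) by (auto simp: dist_commute)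
  have bd: "\<bar>dir v f x\<bar> \<le> C * norm v" if "x \<in> ball p d" for x v
  proof -
    have "\<bar>dir v f x\<bar> = \<bar>\<Sum>b\<in>Basis. (v \<bullet> b) * dir b f x\<bar>"
      using dir_euclidean_expand[OF assms(3), of x v] sub that by auto
    also have "\<dots> \<le> (\<Sum>b\<in>Basis. \<bar>(v \<bullet> b) * dir b f x\<bar>)" by (rule sum_abs)
    also have "\<dots> \<le> (\<Sum>b\<in>Basis. norm v * (\<bar>dir b f p\<bar> + 1))"
      unfolding abs_mult using d(2) that
      by (intro sum_mono mult_mono) (auto simp: Basis_le_norm dist_commute)
    also have "\<dots> \<le> C * norm v" unfolding C_def sum_distrib_left[symmetric] by (simp add: algebra_simps)
    finally show ?thesis .
  qed
  have "\<bar>f y - f x\<bar> \<le> C * norm (y - x)" if "x \<in> ball p d" "y \<in> ball p d" for x y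
  proof -
    have "norm (f y - f x) \<le> C * norm (y - x)"
    proof (rule differentiable_bound[where S = "ball p d" and f' = "\<lambda>x v. dir v f x"])
      show "(f has_derivative (\<lambda>v. dir v f z)) (at z within ball p d)" if "z \<in> ball p d" for z
        using smooth_on_has_derivative[OF assms(3)] sub that has_derivative_at_withinI by blast
      show "onorm (\<lambda>v. dir v f z) \<le> C" if "z \<in> ball p d" for z
        using bd[OF that] by (intro onorm_le) auto
    qed (use that in auto)
    then show ?thesis by simp
  qed
  then show ?thesis using d(1) C sub bd by blast
qed

text \<open>One constant serves all base points of the ball, since
  \<open>nonneg_gradient_bound\<close> moves the base point. The gradient is Lipschitz because each
  of the finitely many basis derivatives is.\<close>

lemma smooth_on_local_taylor:
  fixes f :: "'a::euclidean_space \<Rightarrow> real"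
  assumes "open S" "p \<in> S" "smooth_on S f"
  shows "\<exists>\<delta>>0. \<exists>C>0. ball p \<delta> \<subseteq> S \<and>
    (\<forall>x\<in>ball p \<delta>. \<forall>y\<in>ball p \<delta>. \<bar>f y - f x - dir (y - x) f x\<bar> \<le> C * (norm (y - x))\<^sup>2)"
proof -
  have "\<exists>\<delta>. \<exists>C. \<delta> > 0 \<and> C > 0 \<and> ball p \<delta> \<subseteq> S \<and>
      (\<forall>x\<in>ball p \<delta>. \<forall>y\<in>ball p \<delta>. \<bar>dir b f y - dir b f x\<bar> \<le> C * norm (y - x))" for b
    using smooth_on_local_lipschitz[OF assms(1,2) smooth_on_dir[OF assms(3)], of b] by blast
  then obtain \<delta>b Cb where b: "\<delta>b b > 0" "Cb b > 0" "ball p (\<delta>b b) \<subseteq> S"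
      "\<And>x y. x \<in> ball p (\<delta>b b) \<Longrightarrow> y \<in> ball p (\<delta>b b) \<Longrightarrow>
        \<bar>dir b f y - dir b f x\<bar> \<le> Cb b * norm (y - x)" for b
    by metis
  define d where "d = Min (\<delta>b ` Basis)"
  define C where "C = (\<Sum>b\<in>Basis. Cb b)"
  have d: "d > 0" "\<And>b. b \<in> Basis \<Longrightarrow> ball p d \<subseteq> ball p (\<delta>b b)"
    unfolding d_def using b(1) by (auto simp: Min_gr_iff intro!: subset_ball)
  have C: "C > 0" unfolding C_def using b(2) by (intro sum_pos) auto
  have sub: "ball p d \<subseteq> S" using d(2) b(3) nonempty_Basis by blast
  have diff: "\<bar>dir v f y - dir v f x\<bar> \<le> C * norm v * norm (y - x)"
    if "x \<in> ball p d" "y \<in> ball p d" for x y v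
  proof -
    have xy: "x \<in> S" "y \<in> S" using sub that by auto
    have "dir v f y - dir v f x = (\<Sum>b\<in>Basis. (v \<bullet> b) * (dir b f y - dir b f x))"
      unfolding dir_euclidean_expand[OF assms(3) xy(1), of v] dir_euclidean_expand[OF assms(3) xy(2), of v]
      by (simp add: sum_subtractf right_diff_distrib)
    also have "\<bar>\<dots>\<bar> \<le> (\<Sum>b\<in>Basis. \<bar>(v \<bullet> b) * (dir b f y - dir b f x)\<bar>)" by (rule sum_abs)
    also have "\<dots> \<le> (\<Sum>b\<in>Basis. norm v * (Cb b * norm (y - x)))"
    proof (rule sum_mono)
      fix i :: 'a assume i: "i \<in> Basis"
      have "\<bar>dir i f y - dir i f x\<bar> \<le> Cb i * norm (y - x)" using b(4) d(2)[OF i] that by blast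
      then show "\<bar>(v \<bullet> i) * (dir i f y - dir i f x)\<bar> \<le> norm v * (Cb i * norm (y - x))"
        unfolding abs_mult using i by (intro mult_mono) (auto simp: Basis_le_norm)
    qed
    also have "\<dots> = C * norm v * norm (y - x)"
      unfolding C_def by (simp add: sum_distrib_left sum_distrib_right algebra_simps)
    finally show ?thesis .
  qed
  have "\<bar>f y - f x - dir (y - x) f x\<bar> \<le> C * (norm (y - x))\<^sup>2" if "x \<in> ball p d" "y \<in> ball p d" for x y
  proof -
    \<comment> \<open>Removing the linear part at \<open>x\<close> makes the derivative a difference
      of gradients, to which \<open>diff\<close> applies.\<close>
    let ?g = "\<lambda>t. f (x + t *\<^sub>R (y - x)) - t * dir (y - x) f x"
    have seg: "x + t *\<^sub>R (y - x) \<in> ball p d" if "0 \<le> t" "t \<le> 1" for t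
    proof -
      have "(1 - t) *\<^sub>R x + t *\<^sub>R y \<in> ball p d"
        by (rule convexD[OF convex_ball]) (use \<open>x \<in> ball p d\<close> \<open>y \<in> ball p d\<close> that in simp_all)
      then show ?thesis by (simp add: algebra_simps)
    qed
    have "(?g has_real_derivative dir (y - x) f (x + t *\<^sub>R (y - x)) - dir (y - x) f x) (at t)"
      if "0 \<le> t" "t \<le> 1" for t
      by (intro DERIV_diff smooth_on_line_derivative[OF assms(3)])
        (use sub seg[OF that] in \<open>auto intro!: derivative_eq_intros\<close>)
    from MVT2[OF zero_less_one this] obtain t where t: "0 < t" "t < 1"
      "?g 1 - ?g 0 = (1 - 0) * (dir (y - x) f (x + t *\<^sub>R (y - x)) - dir (y - x) f x)" by blast
    have "\<bar>f y - f x - dir (y - x) f x\<bar> = \<bar>dir (y - x) f (x + t *\<^sub>R (y - x)) - dir (y - x) f x\<bar>"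
      using t(3) by simp
    also have "\<dots> \<le> C * norm (y - x) * norm ((x + t *\<^sub>R (y - x)) - x)"
      by (rule diff) (use that seg t in auto)
    also have "\<dots> \<le> C * norm (y - x) * (1 * norm (y - x))"
    proof (rule mult_left_mono)
      show "norm ((x + t *\<^sub>R (y - x)) - x) \<le> 1 * norm (y - x)"
        using t by (simp add: mult_left_le_one_le)
    qed (use C in auto)
    finally show ?thesis by (simp add: power2_eq_square)
  qed
  then show ?thesis using d(1) C sub by blast
qed

text \<open>The quadratic upper Taylor bound of a nonnegative function along \<open>v\<close> cannot
  become negative; evaluating it at its minimum bounds the squared slope by a multiple of the
  value.\<close>

lemma nonneg_gradient_bound:
  fixes f :: "'a::euclidean_space \<Rightarrow> real"
  assumes "open S" "p \<in> S" "smooth_on S f" "\<And>x. x \<in> S \<Longrightarrow> 0 \<le> f x"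
  shows "\<exists>\<delta>>0. \<exists>C>0. ball p \<delta> \<subseteq> S \<and> (\<forall>x\<in>ball p \<delta>. \<forall>v. (dir v f x)\<^sup>2 \<le> C * (norm v)\<^sup>2 * f x)"
proof -
  obtain d1 M where 1: "d1 > 0" "M > 0" "ball p d1 \<subseteq> S"
    "\<And>x v. x \<in> ball p d1 \<Longrightarrow> \<bar>dir v f x\<bar> \<le> M * norm v"
    using smooth_on_local_lipschitz[OF assms(1-3)] by blast
  obtain d2 C where 2: "d2 > 0" "C > 0" "ball p d2 \<subseteq> S"
    "\<And>x y. x \<in> ball p d2 \<Longrightarrow> y \<in> ball p d2 \<Longrightarrow> \<bar>f y - f x - dir (y - x) f x\<bar> \<le> C * (norm (y - x))\<^sup>2"
    using smooth_on_local_taylor[OF assms(1-3)] by blast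
  define d where "d = min d1 d2 / 2"
  \<comment> \<open>Enlarging the Taylor constant \<open>C\<close> by \<open>M / d\<close> shortens
    the minimizing step to less than \<open>d\<close>, so that it does not leave the ball on which
    Taylor's bound holds.\<close>
  define K where "K = C + M / d"
  have d: "d > 0" "ball p d \<subseteq> ball p d1" "2 * d \<le> d2" using 1(1) 2(1) by (auto simp: d_def)
  have "M / d > 0" using 1(2) d(1) by simp
  then have K: "K \<ge> C" "M / d \<le> K" "K > 0" using 2(2) by (auto simp: K_def)
  have "M / K \<le> d" using K(2,3) d(1) by (simp add: field_simps)
  with K have K: "K \<ge> C" "M / K \<le> d" "K > 0" by auto
  have "(dir v f x)\<^sup>2 \<le> 4 * K * (norm v)\<^sup>2 * f x" if x: "x \<in> ball p d" for x v
  proof (cases "v = 0")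
    case True
    have "linear (\<lambda>v. dir v f x)" using linear_dir[OF assms(3)] 1(3) d(2) x by blast
    then show ?thesis using True by (simp add: linear_0)
  next
    case False
    then have n: "(norm v)\<^sup>2 > 0" by simp
    define D where "D = dir v f x"
    \<comment> \<open>The minimizer of the quadratic polynomial f x + t D + K t^2 |v|^2.\<close>
    define t where "t = - D / (2 * K * (norm v)\<^sup>2)"
    have lin: "linear (\<lambda>v. dir v f x)" using linear_dir[OF assms(3)] 1(3) d(2) x by blast
    have "norm (t *\<^sub>R v) = \<bar>D\<bar> / (2 * K * norm v)"
      using K(3) False by (simp add: t_def power2_eq_square abs_mult)
    also have "\<dots> \<le> M * norm v / (2 * K * norm v)"
      using 1(4)[of x v] x d(2) K(3) False unfolding D_def by (intro divide_right_mono) auto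
    also have "\<dots> = M / K / 2" using False by simp
    also have "\<dots> \<le> d / 2" using K(2) by (intro divide_right_mono) auto
    also have "\<dots> < d" using d(1) by simp
    finally have tn: "norm (t *\<^sub>R v) < d" .
    have "dist p (x + t *\<^sub>R v) \<le> dist p x + norm (t *\<^sub>R v)"
      using dist_triangle[of p "x + t *\<^sub>R v" x] by (simp add: dist_norm)
    then have y: "x + t *\<^sub>R v \<in> ball p d2" using x tn d(3) by simp
    have x2: "x \<in> ball p d2" using x d by auto
    have "0 \<le> f (x + t *\<^sub>R v)" using assms(4) 2(3) y by blast
    also have "\<dots> \<le> f x + t * D + C * (norm (t *\<^sub>R v))\<^sup>2"
      using 2(4)[OF x2 y] linear_cmul[OF lin, of t v] by (simp add: D_def abs_le_iff)
    also have "\<dots> \<le> f x + t * D + K * (norm (t *\<^sub>R v))\<^sup>2" using K(1) by (simp add: mult_right_mono)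
    also have "\<dots> = f x - D\<^sup>2 / (4 * K * (norm v)\<^sup>2)"
    proof -
      define m where "m = (norm v)\<^sup>2"
      have "K * (norm (t *\<^sub>R v))\<^sup>2 = K * (D / (2 * K * m))\<^sup>2 * m"
        unfolding norm_scaleR power_mult_distrib power2_abs t_def m_def by simp
      also have "\<dots> = D\<^sup>2 / (4 * K * m)"
        using K(3) n by (simp add: m_def[symmetric] power_divide power2_eq_square)
      finally have "K * (norm (t *\<^sub>R v))\<^sup>2 = D\<^sup>2 / (4 * K * (norm v)\<^sup>2)" by (simp add: m_def)
      moreover have "t * D = - (D\<^sup>2 / (2 * K * (norm v)\<^sup>2))" by (simp add: t_def power2_eq_square)
      ultimately show ?thesis using K(3) n by (simp add: field_simps)
    qed
    finally show ?thesis using K(3) n by (simp add: D_def field_simps)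
  qed
  moreover have "ball p d \<subseteq> S" using d(2) 1(3) by blast
  ultimately show ?thesis using d(1) K(3) by (intro exI[of _ d] conjI exI[of _ "4*K"]) auto
qed

subsection \<open>The Levi form\<close>

definition J :: "C2 \<Rightarrow> C2" where "J v = \<i> *s v"

lemma J_simps [simp]:
  "J (J v) = - v" "J (u + v) = J u + J v" "J (u - v) = J u - J v" "J (c *\<^sub>R v) = c *\<^sub>R J v"
  "J (- v) = - J v" "norm (J v) = norm v"
  by (auto simp: J_def vec_eq_iff norm_vec_def norm_mult algebra_simps scaleR_conv_of_real)

lemma bounded_linear_J: "bounded_linear J"
  by (rule bounded_linear_intro[where K = 1]) auto

lemma C2_expand:
  fixes v :: C2
  shows "v = Re (v $ 1) *\<^sub>R axis 1 1 + Im (v $ 1) *\<^sub>R axis 1 \<i> + Re (v $ 2) *\<^sub>R axis 2 1 + Im (v $ 2) *\<^sub>R axis 2 \<i>"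
    "J v = Re (v $ 1) *\<^sub>R axis 1 \<i> - Im (v $ 1) *\<^sub>R axis 1 1 + Re (v $ 2) *\<^sub>R axis 2 \<i> - Im (v $ 2) *\<^sub>R axis 2 1"
  by (auto simp: vec_eq_iff forall_2 axis_def complex_eq_iff J_def)

lemma dir_scaleR_inner:
  assumes "open S" "smooth_on S f" "z \<in> S"
  shows "dir u (dir (c *\<^sub>R v) f) z = c *\<^sub>R dir u (dir v f) z"
proof -
  have "dir u (dir (c *\<^sub>R v) f) z = dir u (\<lambda>x. c *\<^sub>R dir v f x) z"
    by (rule dir_cong[OF assms(1) _ assms(3)]) (rule dir_scaleR_vec[OF assms(2)])
  also have "\<dots> = c *\<^sub>R dir u (dir v f) z"
    by (rule dir_bounded_linear_comp[OF bounded_linear_scaleR_right smooth_on_dir[OF assms(2)] assms(3)])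
  finally show ?thesis .
qed

lemma dir_add_inner:
  assumes "open S" "smooth_on S f" "z \<in> S"
  shows "dir u (dir (v + w) f) z = dir u (dir v f) z + dir u (dir w f) z"
proof -
  have "dir u (dir (v + w) f) z = dir u (\<lambda>x. dir v f x + dir w f x) z"
    by (rule dir_cong[OF assms(1) _ assms(3)]) (rule dir_add_vec[OF assms(2)])
  also have "\<dots> = dir u (dir v f) z + dir u (dir w f) z"
    by (rule dir_add[OF smooth_on_dir[OF assms(2)] smooth_on_dir[OF assms(2)] assms(3)])
  finally show ?thesis .
qed

lemma linear_dir_inner:
  "open S \<Longrightarrow> smooth_on S f \<Longrightarrow> z \<in> S \<Longrightarrow> linear (\<lambda>v. dir u (dir v f) z)"
  using dir_add_inner dir_scaleR_inner by (intro linearI) blast+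

text \<open>The inner direction is frozen at \<open>z\<close> before the outer derivative is taken:
  this is the Hessian as a bilinear form, without derivatives of the fields.\<close>

lemma smooth_on_second_dir_field:
  fixes f :: "'a::euclidean_space \<Rightarrow> 'b::real_normed_vector"
  assumes "open S" "smooth_on S f" "smooth_on S U" "smooth_on S V"
  shows "smooth_on S (\<lambda>z. dir (U z) (dir (V z) f) z)"
proof -
  have "dir u (dir v f) z = (\<Sum>b\<in>Basis. (v \<bullet> b) *\<^sub>R dir u (dir b f) z)" if "z \<in> S" for u v z
  proof -
    interpret linear "\<lambda>v. dir u (dir v f) z" by (rule linear_dir_inner[OF assms(1,2) that])
    have "dir u (dir v f) z = dir u (dir (\<Sum>b\<in>Basis. (v \<bullet> b) *\<^sub>R b) f) z"
      by (simp only: euclidean_representation)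
    then show ?thesis by (simp only: sum scale)
  qed
  then have "smooth_on S (\<lambda>z. dir (U z) (dir (V z) f) z) \<longleftrightarrow>
      smooth_on S (\<lambda>z. \<Sum>b\<in>Basis. (V z \<bullet> b) *\<^sub>R dir (U z) (dir b f) z)"
    by (intro smooth_on_cong[OF assms(1)]) blast
  moreover have "smooth_on S (\<lambda>z. \<Sum>b\<in>Basis. (V z \<bullet> b) *\<^sub>R dir (U z) (dir b f) z)"
    by (intro smooth_on_sum smooth_on_scaleR smooth_on_inner smooth_on_const smooth_on_dir_field smooth_on_dir assms)
  ultimately show ?thesis by blast
qed

text \<open>This is 4 Re H_f(u,v): the sum over \<open>v\<close> and \<open>J v\<close> cancels the
  pure second derivatives of type (2,0). The imaginary part is recovered as -4 Im H_f(u,v) =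
  \<open>levi f (J u) v z\<close>.\<close>

definition levi :: "(C2 \<Rightarrow> real) \<Rightarrow> C2 \<Rightarrow> C2 \<Rightarrow> C2 \<Rightarrow> real" where
  "levi f u v z = dir u (dir v f) z + dir (J u) (dir (J v) f) z"

text \<open>Four times the real part of the product of \<partial>f(u) with the conjugate of
  \<partial>g(v): the first-order terms in the Leibniz rule for \<open>levi\<close>.\<close>

definition crossd :: "(C2 \<Rightarrow> real) \<Rightarrow> (C2 \<Rightarrow> real) \<Rightarrow> C2 \<Rightarrow> C2 \<Rightarrow> C2 \<Rightarrow> real" where
  "crossd f g u v z = dir u f z * dir v g z + dir (J u) f z * dir (J v) g z"

lemma smooth_on_levi:
  assumes "open S" "smooth_on S f" "smooth_on S U" "smooth_on S V"
  shows "smooth_on S (\<lambda>z. levi f (U z) (V z) z)"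
  unfolding levi_def
  by (intro smooth_on_add smooth_on_second_dir_field smooth_on_bounded_linear_comp[OF _ bounded_linear_J] assms)

context
  fixes S :: "C2 set" and f :: "C2 \<Rightarrow> real" and z :: C2
  assumes S: "open S" "smooth_on S f" "z \<in> S"
begin

lemma levi_commute: "levi f u v z = levi f v u z"
  unfolding levi_def using dir_commute[OF S] by metis

lemma levi_add_left: "levi f (u + u') v z = levi f u v z + levi f u' v z"
  unfolding levi_def by (simp add: dir_add_vec[OF smooth_on_dir[OF S(2)] S(3)])

lemma levi_scaleR_left: "levi f (c *\<^sub>R u) v z = c * levi f u v z"
  unfolding levi_def by (simp add: dir_scaleR_vec[OF smooth_on_dir[OF S(2)] S(3)] algebra_simps)

lemma levi_add_right: "levi f v (u + u') z = levi f v u z + levi f v u' z"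
  using levi_add_left levi_commute by metis

lemma levi_scaleR_right: "levi f v (c *\<^sub>R u) z = c * levi f v u z"
  using levi_scaleR_left levi_commute by metis

lemma levi_minus_right: "levi f u (- v) z = - levi f u v z"
  using levi_scaleR_right[of u "-1" v] by simp

lemma levi_J_J: "levi f (J u) (J v) z = levi f u v z"
proof -
  have "dir (- u) (dir (- v) f) z = dir u (dir v f) z"
    using dir_scaleR_vec[OF smooth_on_dir[OF S(2)] S(3), where c = "-1" and v = u and v1 = "- v"]
      dir_scaleR_inner[OF S, where u = u and v = v and c = "-1"] by simp
  then show ?thesis unfolding levi_def by simp
qed

lemma levi_J_right: "levi f u (J v) z = - levi f (J u) v z"
  using levi_J_J[of u "J v"] levi_minus_right[of "J u" v] by simp

lemma levi_J_self: "levi f (J u) u z = 0"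
  using levi_J_right[of u u] levi_commute[of u "J u"] by simp

text \<open>The expansion of the Hermitian form on \<alpha> A + \<beta> N with \<alpha> = a + ib and
  \<beta> = c + id; the two mixed coefficients are the real and imaginary parts of \<alpha> times
  the conjugate of \<beta>.\<close>

lemma levi_frame:
  "levi f (a *\<^sub>R A + b *\<^sub>R J A + c *\<^sub>R N + d *\<^sub>R J N) (a *\<^sub>R A + b *\<^sub>R J A + c *\<^sub>R N + d *\<^sub>R J N) z
    = (a\<^sup>2 + b\<^sup>2) * levi f A A z + (c\<^sup>2 + d\<^sup>2) * levi f N N z
      + 2 * ((a * c + b * d) * levi f A N z + (b * c - a * d) * levi f (J A) N z)"
proof -
  have "levi f (J N) A z = - levi f (J A) N z" "levi f A (J N) z = - levi f (J A) N z"
    "levi f N (J A) z = levi f (J A) N z" "levi f N A z = levi f A N z"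
    "levi f (J A) A z = 0" "levi f A (J A) z = 0" "levi f (J N) N z = 0" "levi f N (J N) z = 0"
    "levi f (J A) (J N) z = levi f A N z" "levi f (J N) (J A) z = levi f A N z"
    "levi f (J A) (J A) z = levi f A A z" "levi f (J N) (J N) z = levi f N N z"
    using levi_J_right[of A N] levi_commute[of A "J N"] levi_commute[of N A] levi_commute[of N "J A"]
      levi_J_self[of A] levi_commute[of A "J A"] levi_J_self[of N] levi_commute[of N "J N"] levi_J_J
    by simp_all
  then show ?thesis
    unfolding levi_add_left levi_add_right levi_scaleR_left levi_scaleR_right
    by (simp add: power2_eq_square algebra_simps)
qed

text \<open>Symmetry of the real second derivatives makes the value real. Both sides are compared as
  polynomials in the values of the real Hessian \<open>B\<close> on the four real coordinate
  directions.\<close>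

lemma complex_hessian_eq_levi: "complex_hessian f A A z = complex_of_real (levi f (A z) (A z) z / 4)"
proof -
  define B where "B u v = dir u (dir v f) z" for u v
  have zbar: "dzbar k (\<lambda>w. complex_of_real (f w)) w
      = (complex_of_real (dir (axis k 1) f w) + \<i> * complex_of_real (dir (axis k \<i>) f w)) / 2"
    if "w \<in> S" for k w
    unfolding dzbar_def using dir_bounded_linear_comp[OF bounded_linear_of_real S(2) that] by metis
  have d: "dir v (dzbar k (\<lambda>w. complex_of_real (f w))) z
      = (complex_of_real (B v (axis k 1)) + \<i> * complex_of_real (B v (axis k \<i>))) / 2" for k v
  proof -
    have "dir v (dzbar k (\<lambda>w. complex_of_real (f w))) z
        = dir v (\<lambda>w. (complex_of_real (dir (axis k 1) f w) + \<i> * complex_of_real (dir (axis k \<i>) f w)) / 2) z"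
      by (rule dir_cong[OF S(1) _ S(3)]) (rule zbar)
    also have "\<dots> = (complex_of_real (B v (axis k 1)) + \<i> * complex_of_real (B v (axis k \<i>))) / 2"
      unfolding B_def
      by (rule dir_eqI)
        (auto intro!: derivative_eq_intros has_derivative_of_real smooth_on_has_derivative[OF smooth_on_dir[OF S(2)] S(3)])
    finally show ?thesis .
  qed
  have lin: "B (u + u') v = B u v + B u' v" "B (u - u') v = B u v - B u' v" "B (c *\<^sub>R u) v = c * B u v"
    "B v (u + u') = B v u + B v u'" "B v (u - u') = B v u - B v u'" "B v (c *\<^sub>R u) = c * B v u" for u u' v c
  proof -
    have l: "linear (\<lambda>u. B u v)" "linear (B v)" for v
      unfolding B_def by (rule linear_dir[OF smooth_on_dir[OF S(2)] S(3)], rule linear_dir_inner[OF S])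
    show "B (u + u') v = B u v + B u' v" "B (u - u') v = B u v - B u' v" "B (c *\<^sub>R u) v = c * B u v"
      "B v (u + u') = B v u + B v u'" "B v (u - u') = B v u - B v u'" "B v (c *\<^sub>R u) = c * B v u"
      using linear_add[OF l(1)] linear_diff[OF l(1)] linear_cmul[OF l(1)]
        linear_add[OF l(2)] linear_diff[OF l(2)] linear_cmul[OF l(2)] by simp_all
  qed
  define x1 x2 y1 y2 :: C2 where
    "x1 = axis 1 1" and "x2 = axis 2 1" and "y1 = axis 1 \<i>" and "y2 = axis 2 \<i>"
  note xy = x1_def[symmetric] x2_def[symmetric] y1_def[symmetric] y2_def[symmetric]
  define a1 b1 a2 b2 where "a1 = Re (A z $ 1)" and "b1 = Im (A z $ 1)" and "a2 = Re (A z $ 2)" and "b2 = Im (A z $ 2)"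
  have Az: "A z = a1 *\<^sub>R x1 + b1 *\<^sub>R y1 + a2 *\<^sub>R x2 + b2 *\<^sub>R y2"
    "J (A z) = a1 *\<^sub>R y1 - b1 *\<^sub>R x1 + a2 *\<^sub>R y2 - b2 *\<^sub>R x2"
    unfolding a1_def a2_def b1_def b2_def x1_def x2_def y1_def y2_def by (rule C2_expand)+
  have A: "A z $ 1 = Complex a1 b1" "A z $ 2 = Complex a2 b2"
    unfolding a1_def a2_def b1_def b2_def by simp_all
  have sym: "B y1 x1 = B x1 y1" "B y2 x2 = B x2 y2" "B x2 x1 = B x1 x2" "B y2 y1 = B y1 y2"
    "B y1 x2 = B x2 y1" "B y2 x1 = B x1 y2"
    unfolding B_def using dir_commute[OF S] by metis+
  \<comment> \<open>The abbreviation shields the \<open>A z\<close> inside \<open>J (A z)\<close>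
    from being expanded by \<open>Az(1)\<close>.\<close>
  define V where "V = J (A z)"
  have eq: "levi f (A z) (A z) z = B (A z) (A z) + B V V" unfolding levi_def B_def V_def ..
  have V: "V = a1 *\<^sub>R y1 - b1 *\<^sub>R x1 + a2 *\<^sub>R y2 - b2 *\<^sub>R x2" unfolding V_def by (rule Az(2))
  show ?thesis
    unfolding complex_hessian_def dz_def d sum_2 A xy eq
    unfolding Az(1) V by (simp add: lin sym complex_eq_iff field_simps)
qed

end

lemma levi_add_fun:
  assumes "open S" "smooth_on S f" "smooth_on S g" "z \<in> S"
  shows "levi (\<lambda>x. f x + g x) u v z = levi f u v z + levi g u v z"
proof -
  have "dir u (dir v (\<lambda>x. f x + g x)) z = dir u (dir v f) z + dir u (dir v g) z" for u v
  proof -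
    have "dir u (dir v (\<lambda>x. f x + g x)) z = dir u (\<lambda>x. dir v f x + dir v g x) z"
      by (rule dir_cong[OF assms(1) _ assms(4)]) (rule dir_add[OF assms(2,3)])
    then show ?thesis using dir_add[OF smooth_on_dir[OF assms(2)] smooth_on_dir[OF assms(3)] assms(4)] by metis
  qed
  then show ?thesis unfolding levi_def by simp
qed

lemma levi_const_fun: "levi (\<lambda>x. c) u v z = 0"
  unfolding levi_def by simp

lemma levi_mult_fun:
  assumes "open S" "smooth_on S f" "smooth_on S g" "z \<in> S"
  shows "levi (\<lambda>x. f x * g x) u v z
    = f z * levi g u v z + g z * levi f u v z + crossd f g u v z + crossd f g v u z"
proof -
  note m = smooth_on_mult[OF assms(1)] and s = smooth_on_dir[OF assms(2)] smooth_on_dir[OF assms(3)]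
  have "dir u (dir v (\<lambda>x. f x * g x)) z
      = f z * dir u (dir v g) z + dir u f z * dir v g z + (dir v f z * dir u g z + dir u (dir v f) z * g z)" for u v
  proof -
    have "dir u (dir v (\<lambda>x. f x * g x)) z = dir u (\<lambda>x. f x * dir v g x + dir v f x * g x) z"
      by (rule dir_cong[OF assms(1) _ assms(4)]) (rule dir_mult[OF assms(2,3)])
    also have "\<dots> = dir u (\<lambda>x. f x * dir v g x) z + dir u (\<lambda>x. dir v f x * g x) z"
      by (rule dir_add[OF m m assms(4)]) (rule assms s)+
    finally show ?thesis
      by (simp add: dir_mult[OF assms(2) s(2) assms(4)] dir_mult[OF s(1) assms(3,4)])
  qed
  then show ?thesis unfolding levi_def crossd_def by (simp add: algebra_simps)
qed

text \<open>Only real linearity of the differential enters, so the formulas also hold for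
  complex-valued functions, such as those met after the first letter of a word.\<close>

lemma act_eq_dir:
  assumes "F differentiable (at z)"
  shows "act10 L F z = (dir (L z) F z - \<i> * dir (J (L z)) F z) / 2"
    "act01 L F z = (dir (L z) F z + \<i> * dir (J (L z)) F z) / 2"
proof -
  have lin: "linear (\<lambda>v. dir v F z)" using linear_frechet_derivative[OF assms] .
  define x1 x2 y1 y2 :: C2 where
    "x1 = axis 1 1" and "x2 = axis 2 1" and "y1 = axis 1 \<i>" and "y2 = axis 2 \<i>"
  note xy = x1_def[symmetric] x2_def[symmetric] y1_def[symmetric] y2_def[symmetric]
  define a1 b1 a2 b2 where "a1 = Re (L z $ 1)" and "b1 = Im (L z $ 1)" and "a2 = Re (L z $ 2)" and "b2 = Im (L z $ 2)"
  have Lz: "L z = a1 *\<^sub>R x1 + b1 *\<^sub>R y1 + a2 *\<^sub>R x2 + b2 *\<^sub>R y2"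
    "J (L z) = a1 *\<^sub>R y1 - b1 *\<^sub>R x1 + a2 *\<^sub>R y2 - b2 *\<^sub>R x2"
    unfolding a1_def a2_def b1_def b2_def x1_def x2_def y1_def y2_def by (rule C2_expand)+
  have L: "L z $ 1 = Complex a1 b1" "L z $ 2 = Complex a2 b2"
    unfolding a1_def a2_def b1_def b2_def by simp_all
  define V where "V = J (L z)"
  have V: "V = a1 *\<^sub>R y1 - b1 *\<^sub>R x1 + a2 *\<^sub>R y2 - b2 *\<^sub>R x2" unfolding V_def by (rule Lz(2))
  show "act10 L F z = (dir (L z) F z - \<i> * dir (J (L z)) F z) / 2"
    "act01 L F z = (dir (L z) F z + \<i> * dir (J (L z)) F z) / 2"
    unfolding act10_def act01_def dz_def dzbar_def sum_2 L xy V_def[symmetric]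
    unfolding Lz(1) V
    by (simp_all add: linear_add[OF lin] linear_diff[OF lin] linear_cmul[OF lin] complex_eq_iff field_simps)
qed

subsection \<open>Projection to the boundary\<close>

text \<open>A positive value would persist on a neighbourhood, yet every neighbourhood of a frontier
  point meets \<Omega>, where r is negative.\<close>

lemma defining_function_zero_on_frontier:
  fixes r :: "C2 \<Rightarrow> real"
  assumes "open \<Omega>" "open S" "continuous_on S r" "\<Omega> \<inter> S = {z \<in> S. r z < 0}" "z \<in> frontier \<Omega>" "z \<in> S"
  shows "r z = 0"
proof -
  have "z \<notin> \<Omega>" "z \<in> closure \<Omega>" using assms(1,5) by (auto simp: frontier_def interior_open)
  then have "r z \<ge> 0" using assms(4,6) by force
  moreover have "\<not> r z > 0"
  proof
    assume "r z > 0"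
    have "open {x \<in> S. 0 < r x}"
      using continuous_on_open_vimage[OF assms(2), THEN iffD1, OF assms(3), rule_format, OF open_greaterThan[of 0]]
      by (simp add: vimage_def Int_def conj_commute)
    moreover have "z \<in> {x \<in> S. 0 < r x}" using assms(6) \<open>r z > 0\<close> by simp
    ultimately obtain x where "x \<in> \<Omega>" "x \<in> S" "0 < r x"
      using \<open>z \<in> closure \<Omega>\<close> unfolding closure_iff_nhds_not_empty by blast
    then show False using assms(4) by force
  qed
  ultimately show ?thesis by simp
qed

lemma dist_add_scaleR_le: "dist p (z + s *\<^sub>R v) \<le> dist p z + \<bar>s\<bar> * norm (v::'a::real_normed_vector)"
  using dist_triangle[of p "z + s *\<^sub>R v" z] by (simp add: dist_norm)

lemma segment_in_ball:
  fixes z :: "'a::real_normed_vector"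
  assumes "z \<in> ball p \<epsilon>" "z + s *\<^sub>R v \<in> ball p \<epsilon>" "min 0 s \<le> t" "t \<le> max 0 s"
  shows "z + t *\<^sub>R v \<in> ball p \<epsilon>"
proof (cases "s = 0")
  case True
  then show ?thesis using assms by simp
next
  case False
  then have "0 \<le> t / s" "t / s \<le> 1" using assms(3,4)
    by (auto simp: min_def max_def field_simps split: if_splits)
  then have "(1 - t / s) *\<^sub>R z + (t / s) *\<^sub>R (z + s *\<^sub>R v) \<in> ball p \<epsilon>"
    by (intro convexD[OF convex_ball]) (use assms in simp_all)
  then show ?thesis using False by (simp add: algebra_simps)
qed

text \<open>The increment \<open>s\<close> is signed, because the boundary may lie on either side of
  a point.\<close>

lemma MVT_abs:
  fixes g g' :: "real \<Rightarrow> real"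
  assumes "\<And>t. min 0 s \<le> t \<Longrightarrow> t \<le> max 0 s \<Longrightarrow> (g has_real_derivative g' t) (at t)"
  shows "\<exists>t. min 0 s \<le> t \<and> t \<le> max 0 s \<and> g s - g 0 = s * g' t"
proof -
  have D: "(g has_real_derivative g' t) (at t)" if "0 \<le> t \<and> t \<le> s \<or> s \<le> t \<and> t \<le> 0" for t
    using that by (intro assms) auto
  show ?thesis
  proof (cases s "0::real" rule: linorder_cases)
    case greater
    obtain t where "0 < t" "t < s" "g s - g 0 = (s - 0) * g' t"
      using MVT2[OF greater, of g g'] D by metis
    then show ?thesis using greater by (intro exI[of _ t]) auto
  next
    case less
    obtain t where "s < t" "t < 0" "g 0 - g s = (0 - s) * g' t"
      using MVT2[OF less, of g g'] D by metis
    then show ?thesis using less by (intro exI[of _ t]) auto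
  qed auto
qed

text \<open>A direction \<open>N\<close> transversal on all of \<open>S\<close> lets all movements
  towards the boundary run along parallel lines. As \<open>p\<close> is a parameter, the chart can
  be instantiated again at any other frontier point of \<open>S\<close>.\<close>

locale boundary_chart =
  fixes \<Omega> S :: "C2 set" and r :: "C2 \<Rightarrow> real" and p N :: C2
  assumes open_\<Omega>: "open \<Omega>" and open_S: "open S" and p_in_S: "p \<in> S" and p_frontier: "p \<in> frontier \<Omega>"
    and smooth_r: "smooth_on S r" and sublevel: "\<Omega> \<inter> S = {z \<in> S. r z < 0}"
    and transversal: "\<And>z. z \<in> S \<Longrightarrow> 0 < dir N r z"
begin

lemma r_zero: "z \<in> frontier \<Omega> \<Longrightarrow> z \<in> S \<Longrightarrow> r z = 0"
  using defining_function_zero_on_frontier[OF open_\<Omega> open_S smooth_on_imp_continuous_on[OF smooth_r] sublevel] .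

lemma N_nonzero: "N \<noteq> 0"
  using transversal[OF p_in_S] linear_dir[OF smooth_r p_in_S] by (auto simp: linear_0)

text \<open>Moving by a small multiple of \<open>- N\<close> makes \<open>r\<close> negative, so
  \<Omega> comes arbitrarily close. This identifies the zeros found by \<open>projection\<close> as
  boundary points.\<close>

lemma zero_imp_frontier:
  assumes "z \<in> S" "r z = 0"
  shows "z \<in> frontier \<Omega>"
proof -
  have "((\<lambda>t. r (z + t *\<^sub>R N)) has_real_derivative dir N r (z + 0 *\<^sub>R N)) (at 0)"
    by (rule smooth_on_line_derivative[OF smooth_r]) (use assms in simp)
  then obtain d where d: "d > 0" "\<And>h. 0 < h \<Longrightarrow> h < d \<Longrightarrow> r (z + (0 - h) *\<^sub>R N) < r (z + 0 *\<^sub>R N)"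
    using DERIV_pos_inc_left transversal[OF assms(1)] by fastforce
  obtain e where e: "e > 0" "ball z e \<subseteq> S" using open_S assms(1) open_contains_ball by blast
  have "\<exists>y\<in>\<Omega>. dist y z < \<epsilon>" if "\<epsilon> > 0" for \<epsilon>
  proof -
    define q where "q = min e \<epsilon> / norm N"
    have "q > 0" using e(1) that N_nonzero by (simp add: q_def)
    define h where "h = min d q / 2"
    have h: "0 < h" "h < d" "h < q" using d(1) \<open>q > 0\<close> by (auto simp: h_def min_def)
    then have hN: "h * norm N < min e \<epsilon>" using N_nonzero by (simp add: field_simps q_def)
    then have "z + (0 - h) *\<^sub>R N \<in> S" using e(2) dist_add_scaleR_le[of z z "0 - h" N] h(1) by auto
    moreover have "r (z + (0 - h) *\<^sub>R N) < 0" using d(2)[OF h(1,2)] assms(2) by simp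
    ultimately have "z + (0 - h) *\<^sub>R N \<in> \<Omega>" using sublevel by blast
    moreover have "dist (z + (0 - h) *\<^sub>R N) z < \<epsilon>"
      using hN h(1) dist_add_scaleR_le[of z z "0 - h" N] by (simp add: dist_commute)
    ultimately show ?thesis by blast
  qed
  then have "z \<in> closure \<Omega>" unfolding closure_approachable by blast
  moreover have "z \<notin> \<Omega>" using sublevel assms by force
  ultimately show ?thesis using open_\<Omega> by (simp add: frontier_def interior_open)
qed

text \<open>Along \<open>N\<close> the function \<open>r\<close> grows at a rate of at least
  \<open>c\<close>, so the intermediate value theorem finds a zero within |r z| / c. The constant is
  fixed before \<epsilon>, so the target ball can be shrunk without losing control of
  \<open>s\<close>.\<close>

lemma projection:
  "\<exists>C>0. \<forall>\<epsilon>>0. \<exists>\<delta>>0. \<delta> \<le> \<epsilon> \<and>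
    (\<forall>z\<in>ball p \<delta>. \<exists>s. \<bar>s\<bar> \<le> C * \<bar>r z\<bar> \<and> z + s *\<^sub>R N \<in> frontier \<Omega> \<inter> ball p \<epsilon>)"
proof -
  define c where "c = dir N r p / 2"
  have c: "c > 0" using transversal[OF p_in_S] by (simp add: c_def)
  have "continuous (at p) (dir N r)" "continuous (at p) r"
    using open_S p_in_S smooth_on_imp_continuous_on[OF smooth_on_dir[OF smooth_r]]
      smooth_on_imp_continuous_on[OF smooth_r] by (auto simp: continuous_on_eq_continuous_at)
  note cont = this
  have "\<forall>\<^sub>F x in nhds p. dist (dir N r x) (dir N r p) < c"
    using continuous_at_eventually_nhds[OF cont(1) c] .
  moreover have "\<forall>\<^sub>F x in nhds p. x \<in> S" using open_S p_in_S eventually_nhds by blast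
  ultimately have "\<forall>\<^sub>F x in nhds p. c \<le> dir N r x \<and> x \<in> S"
    by eventually_elim (auto simp: dist_real_def c_def abs_if split: if_splits)
  then obtain d where d: "d > 0" "\<And>x. dist x p < d \<Longrightarrow> c \<le> dir N r x \<and> x \<in> S"
    unfolding eventually_nhds_metric by blast
  have "\<exists>\<delta>>0. \<delta> \<le> \<epsilon> \<and>
    (\<forall>z\<in>ball p \<delta>. \<exists>s. \<bar>s\<bar> \<le> (1 / c) * \<bar>r z\<bar> \<and> z + s *\<^sub>R N \<in> frontier \<Omega> \<inter> ball p \<epsilon>)"
    if "\<epsilon> > 0" for \<epsilon>
  proof -
    define \<epsilon>' where "\<epsilon>' = min \<epsilon> d"
    have \<epsilon>': "\<epsilon>' > 0" "\<epsilon>' \<le> \<epsilon>" "\<epsilon>' \<le> d" using that d(1) by (auto simp: \<epsilon>'_def)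
    have "c * \<epsilon>' / (2 * norm N) > 0" using c \<epsilon>'(1) N_nonzero by simp
    then obtain \<delta>0 where \<delta>0: "\<delta>0 > 0" "\<And>x. dist x p < \<delta>0 \<Longrightarrow> dist (r x) (r p) < c * \<epsilon>' / (2 * norm N)"
      using cont(2) unfolding continuous_at_eps_delta by metis
    define \<delta> where "\<delta> = min \<delta>0 (\<epsilon>' / 2)"
    have \<delta>: "\<delta> > 0" "\<delta> \<le> \<delta>0" "\<delta> \<le> \<epsilon>' / 2" using \<delta>0(1) \<epsilon>'(1) by (auto simp: \<delta>_def)
    have "\<exists>s. \<bar>s\<bar> \<le> (1 / c) * \<bar>r z\<bar> \<and> z + s *\<^sub>R N \<in> frontier \<Omega> \<inter> ball p \<epsilon>" if z: "z \<in> ball p \<delta>" for z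
    proof -
      \<comment> \<open>Over the length \<open>T\<close> the growth rate \<open>c\<close> exactly
        makes up for the size of \<open>r z\<close>, which forces a change of sign.\<close>
      define T where "T = \<bar>r z\<bar> / c"
      have T0: "T \<ge> 0" using c by (simp add: T_def)
      have "dist (r z) (r p) < c * \<epsilon>' / (2 * norm N)"
        by (rule \<delta>0(2)) (use z \<delta> in \<open>auto simp: dist_commute\<close>)
      then have "\<bar>r z\<bar> * norm N < c * (\<epsilon>' / 2)"
        using r_zero[OF p_frontier p_in_S] N_nonzero by (simp add: dist_real_def field_simps)
      then have TN: "T * norm N < \<epsilon>' / 2" using c by (simp add: T_def field_simps)
      have near: "z + t *\<^sub>R N \<in> ball p \<epsilon>'" if "\<bar>t\<bar> \<le> T" for t
      proof -
        have "\<bar>t\<bar> * norm N \<le> T * norm N" using that by (simp add: mult_right_mono)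
        then show ?thesis using dist_add_scaleR_le[of p z t N] TN z \<delta>(3) by auto
      qed
      define g where "g t = r (z + t *\<^sub>R N)" for t
      have g: "(g has_real_derivative dir N r (z + t *\<^sub>R N)) (at t)" "c \<le> dir N r (z + t *\<^sub>R N)" if "\<bar>t\<bar> \<le> T" for t
        unfolding g_def
        using d(2)[of "z + t *\<^sub>R N"] near[OF that] \<epsilon>'(3)
        by (auto intro!: smooth_on_line_derivative[OF smooth_r] simp: dist_commute)
      have growth: "\<exists>D\<ge>c. g s - g 0 = s * D" if "\<bar>s\<bar> = T" for s
      proof -
        have rng: "\<bar>t\<bar> \<le> T" if "min 0 s \<le> t" "t \<le> max 0 s" for t
          using that \<open>\<bar>s\<bar> = T\<close> by linarith
        show ?thesis using MVT_abs[of s g "\<lambda>t. dir N r (z + t *\<^sub>R N)"] g rng by blast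
      qed
      have up: "g T \<ge> g 0 + c * T"
      proof -
        obtain D where "D \<ge> c" "g T - g 0 = T * D" using growth[of T] T0 by auto
        then show ?thesis using mult_left_mono[of c D T] T0 by (simp add: mult.commute)
      qed
      have down: "g (- T) \<le> g 0 - c * T"
      proof -
        obtain D where "D \<ge> c" "g (- T) - g 0 = - T * D" using growth[of "- T"] T0 by auto
        then show ?thesis using mult_left_mono[of c D T] T0 by (simp add: mult.commute)
      qed
      have gc: "isCont g t" if "\<bar>t\<bar> \<le> T" for t using g(1)[OF that] by (rule DERIV_isCont)
      have g0: "g 0 = r z" "\<bar>g 0\<bar> = c * T" using c by (auto simp: g_def T_def)
      have "\<exists>s. \<bar>s\<bar> \<le> T \<and> g s = 0"
      proof (cases "g 0 \<le> 0")
        case True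
        then have "0 \<le> g T" using up g0(2) by linarith
        then obtain s where "0 \<le> s" "s \<le> T" "g s = 0" using IVT[of g 0 0 T] True T0 gc by force
        then show ?thesis by (intro exI[of _ s]) auto
      next
        case False
        then have "g (- T) \<le> 0" using down g0(2) by linarith
        then obtain s where "- T \<le> s" "s \<le> 0" "g s = 0" using IVT[of g "- T" 0 0] False T0 gc by force
        then show ?thesis by (intro exI[of _ s]) auto
      qed
      then obtain s where s: "\<bar>s\<bar> \<le> T" "g s = 0" by blast
      have "z + s *\<^sub>R N \<in> S" using near[OF s(1)] d(2)[of "z + s *\<^sub>R N"] \<epsilon>'(3) by (auto simp: dist_commute)
      then have "z + s *\<^sub>R N \<in> frontier \<Omega>" using zero_imp_frontier s(2) by (simp add: g_def)
      then show ?thesis using s(1) near[OF s(1)] \<epsilon>'(2) by (auto simp: T_def)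
    qed
    then show ?thesis using \<delta> \<epsilon>' by (intro exI[of _ \<delta>]) auto
  qed
  then show ?thesis using c by (intro exI[of _ "1 / c"]) auto
qed

text \<open>With a the quotient of the \<open>N\<close>-derivatives, l - r a has
  \<open>N\<close>-derivative -r (N a), of order |s| on the segment since \<open>r\<close> vanishes
  at its end. Integration over the segment gives O(s^2), with a evaluated at \<open>z\<close> and
  not at the projection.\<close>

lemma normal_taylor:
  assumes "smooth_on S l"
  shows "\<exists>\<epsilon>>0. \<exists>C>0. ball p \<epsilon> \<subseteq> S \<and> (\<forall>z s. z \<in> ball p \<epsilon> \<longrightarrow> z + s *\<^sub>R N \<in> frontier \<Omega> \<inter> ball p \<epsilon> \<longrightarrow>
    \<bar>l z - l (z + s *\<^sub>R N) - r z * (dir N l z / dir N r z)\<bar> \<le> C * s\<^sup>2)"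
proof -
  define a where "a z = dir N l z / dir N r z" for z
  have sa: "smooth_on S a" unfolding a_def
    by (intro smooth_on_divide smooth_on_dir assms smooth_r open_S) (use transversal in force)
  define g where "g z = l z - r z * a z" for z
  have sg: "smooth_on S g" unfolding g_def
    by (intro smooth_on_diff smooth_on_mult open_S assms smooth_r sa)
  obtain e1 M1 where 1: "e1 > 0" "M1 > 0" "ball p e1 \<subseteq> S"
    "\<And>x y. x \<in> ball p e1 \<Longrightarrow> y \<in> ball p e1 \<Longrightarrow> \<bar>r y - r x\<bar> \<le> M1 * norm (y - x)"
    using smooth_on_local_lipschitz[OF open_S p_in_S smooth_r] by blast
  obtain e2 M2 where 2: "e2 > 0" "M2 > 0" "ball p e2 \<subseteq> S" "\<And>x v. x \<in> ball p e2 \<Longrightarrow> \<bar>dir v a x\<bar> \<le> M2 * norm v"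
    using smooth_on_local_lipschitz[OF open_S p_in_S sa] by blast
  define e where "e = min e1 e2"
  have e: "e > 0" "ball p e \<subseteq> ball p e1" "ball p e \<subseteq> ball p e2" using 1(1) 2(1) by (auto simp: e_def)
  have "\<bar>l z - l (z + s *\<^sub>R N) - r z * a z\<bar> \<le> (M1 * M2 * (norm N)\<^sup>2) * s\<^sup>2"
    if z: "z \<in> ball p e" and w: "z + s *\<^sub>R N \<in> frontier \<Omega> \<inter> ball p e" for z s
  proof -
    have in_ball: "z + t *\<^sub>R N \<in> ball p e" if "min 0 s \<le> t" "t \<le> max 0 s" for t
      using segment_in_ball[OF z _ that] w by blast
    have in_S: "z + t *\<^sub>R N \<in> S" if "min 0 s \<le> t" "t \<le> max 0 s" for t
      using in_ball[OF that] e(2) 1(3) by blast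
    obtain t where t: "min 0 s \<le> t" "t \<le> max 0 s" "g (z + s *\<^sub>R N) - g (z + 0 *\<^sub>R N) = s * dir N g (z + t *\<^sub>R N)"
      using MVT_abs[of s "\<lambda>t. g (z + t *\<^sub>R N)" "\<lambda>t. dir N g (z + t *\<^sub>R N)"]
        smooth_on_line_derivative[OF sg in_S] by blast
    let ?y = "z + t *\<^sub>R N"
    note y = in_S[OF t(1,2)]
    have "dir N g ?y = dir N l ?y - (r ?y * dir N a ?y + dir N r ?y * a ?y)"
      unfolding g_def
      using dir_diff[OF assms smooth_on_mult[OF open_S smooth_r sa] y] dir_mult[OF smooth_r sa y] by simp
    also have "\<dots> = - (r ?y * dir N a ?y)" using transversal[OF y] by (simp add: a_def)
    finally have d: "\<bar>dir N g ?y\<bar> = \<bar>r ?y\<bar> * \<bar>dir N a ?y\<bar>" by (simp add: abs_mult)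
    have rw: "r (z + s *\<^sub>R N) = 0" using r_zero w 1(3) e(2) by blast
    have "\<bar>t - s\<bar> \<le> \<bar>s\<bar>" using t(1,2) by (auto simp: min_def max_def split: if_splits)
    have "\<bar>r ?y\<bar> = \<bar>r ?y - r (z + s *\<^sub>R N)\<bar>" using rw by simp
    also have "\<dots> \<le> M1 * norm (?y - (z + s *\<^sub>R N))"
      by (rule 1(4)) (use w in_ball[OF t(1,2)] e(2) in auto)
    also have "?y - (z + s *\<^sub>R N) = (t - s) *\<^sub>R N" by (simp add: algebra_simps)
    also have "M1 * norm ((t - s) *\<^sub>R N) \<le> M1 * (\<bar>s\<bar> * norm N)"
      using \<open>\<bar>t - s\<bar> \<le> \<bar>s\<bar>\<close> 1(2) by (auto intro!: mult_left_mono mult_right_mono)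
    finally have "\<bar>dir N g ?y\<bar> \<le> (M1 * (\<bar>s\<bar> * norm N)) * (M2 * norm N)"
      unfolding d using 2(4)[of ?y N] in_ball[OF t(1,2)] e(3) 1(2) by (intro mult_mono) auto
    then have "\<bar>s\<bar> * \<bar>dir N g ?y\<bar> \<le> \<bar>s\<bar> * ((M1 * (\<bar>s\<bar> * norm N)) * (M2 * norm N))"
      by (intro mult_left_mono) auto
    also have "\<dots> = (M1 * M2 * (norm N)\<^sup>2) * s\<^sup>2" by (simp add: power2_eq_square flip: abs_mult)
    finally have "\<bar>g (z + s *\<^sub>R N) - g z\<bar> \<le> (M1 * M2 * (norm N)\<^sup>2) * s\<^sup>2"
      using t(3) by (simp add: abs_mult)
    then show ?thesis using rw by (simp add: g_def abs_minus_commute)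
  qed
  moreover have "M1 * M2 * (norm N)\<^sup>2 > 0" using 1(2) 2(2) N_nonzero by simp
  ultimately show ?thesis using e 1(3) unfolding a_def by blast
qed

end

section \<open>Transfer between the boundary and its neighbourhood\<close>

lemma zero_if_small:
  fixes x K t0 :: real
  assumes "t0 > 0" "\<And>t. 0 < t \<Longrightarrow> t < t0 \<Longrightarrow> \<bar>x\<bar> \<le> K * t"
  shows "x = 0"
proof (rule ccontr)
  assume "x \<noteq> 0"
  define q where "q = \<bar>x\<bar> / (2 * (\<bar>K\<bar> + 1))"
  have "\<bar>K\<bar> + 1 > 0" by simp
  then have q: "q > 0" "(\<bar>K\<bar> + 1) * q = \<bar>x\<bar> / 2" using \<open>x \<noteq> 0\<close> by (simp_all add: q_def field_simps)
  define t where "t = min (t0 / 2) q"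
  have t: "0 < t" "t < t0" "t \<le> q" using assms(1) q(1) by (auto simp: t_def)
  have "\<bar>x\<bar> \<le> K * t" using assms(2) t by blast
  also have "\<dots> \<le> (\<bar>K\<bar> + 1) * q" using t by (intro mult_mono) auto
  finally show False using q(2) \<open>x \<noteq> 0\<close> by simp
qed

context boundary_chart
begin

text \<open>Between \<open>z\<close> and its projection w a smooth f changes by O(|r z|), and the
  majorant dominates both l w and (r z)^2; hence a bound of f^2 by l on the boundary extends inward
  and outward. \<open>C0\<close> is fixed before f, so that one majorant serves all
  functions.\<close>

lemma boundary_majorant:
  assumes l: "smooth_on S l" "\<And>w. w \<in> frontier \<Omega> \<inter> S \<Longrightarrow> 0 \<le> l w"
  obtains C0 \<delta> where "\<delta> > 0" "ball p \<delta> \<subseteq> S"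
    "\<And>z. z \<in> ball p \<delta> \<Longrightarrow> (r z)\<^sup>2 \<le> l z - r z * (dir N l z / dir N r z) + C0 * (r z)\<^sup>2"
    "\<And>f K \<epsilon>. smooth_on S f \<Longrightarrow> \<epsilon> > 0 \<Longrightarrow> (\<And>w. w \<in> frontier \<Omega> \<inter> ball p \<epsilon> \<Longrightarrow> (f w)\<^sup>2 \<le> K * l w) \<Longrightarrow>
      \<exists>C>0. \<exists>\<delta>>0. \<forall>z\<in>ball p \<delta>. (f z)\<^sup>2 \<le> C * (l z - r z * (dir N l z / dir N r z) + C0 * (r z)\<^sup>2)"
proof -
  obtain C where C: "C > 0" "\<And>\<epsilon>. \<epsilon> > 0 \<Longrightarrow> \<exists>\<delta>>0. \<delta> \<le> \<epsilon> \<and>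
    (\<forall>z\<in>ball p \<delta>. \<exists>s. \<bar>s\<bar> \<le> C * \<bar>r z\<bar> \<and> z + s *\<^sub>R N \<in> frontier \<Omega> \<inter> ball p \<epsilon>)"
    using projection by blast
  obtain e1 C1 where 1: "e1 > 0" "C1 > 0" "ball p e1 \<subseteq> S"
    "\<And>z s. z \<in> ball p e1 \<Longrightarrow> z + s *\<^sub>R N \<in> frontier \<Omega> \<inter> ball p e1 \<Longrightarrow>
    \<bar>l z - l (z + s *\<^sub>R N) - r z * (dir N l z / dir N r z)\<bar> \<le> C1 * s\<^sup>2"
    using normal_taylor[OF l(1)] by blast
  \<comment> \<open>The first summand absorbs the Taylor remainder \<open>C1 * s\<^sup>2\<close>;
    the summand 1 leaves a full (r z)^2 over.\<close>
  define C0 where "C0 = C1 * C\<^sup>2 + 1"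
  define \<Lambda> where "\<Lambda> z = l z - r z * (dir N l z / dir N r z) + C0 * (r z)\<^sup>2" for z
  have sq: "s\<^sup>2 \<le> C\<^sup>2 * (r z)\<^sup>2" if "\<bar>s\<bar> \<le> C * \<bar>r z\<bar>" for s z
    using power_mono[OF that, of 2] by (simp add: power_mult_distrib)
  have key: "l (z + s *\<^sub>R N) + (r z)\<^sup>2 \<le> \<Lambda> z"
    if "z \<in> ball p e1" "z + s *\<^sub>R N \<in> frontier \<Omega> \<inter> ball p e1" "\<bar>s\<bar> \<le> C * \<bar>r z\<bar>" for z s
  proof -
    have "C1 * s\<^sup>2 \<le> C1 * (C\<^sup>2 * (r z)\<^sup>2)" using sq[OF that(3)] 1(2) by simp
    then show ?thesis using 1(4)[OF that(1,2)] unfolding \<Lambda>_def C0_def by (simp add: abs_le_iff algebra_simps)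
  qed
  obtain d where d: "d > 0" "d \<le> e1"
    "\<And>z. z \<in> ball p d \<Longrightarrow> \<exists>s. \<bar>s\<bar> \<le> C * \<bar>r z\<bar> \<and> z + s *\<^sub>R N \<in> frontier \<Omega> \<inter> ball p e1"
    using C(2)[OF 1(1)] by blast
  show thesis
  proof (rule that[of d C0])
    show "d > 0" "ball p d \<subseteq> S" using d 1(3) by (auto simp: subset_iff)
    show "(r z)\<^sup>2 \<le> l z - r z * (dir N l z / dir N r z) + C0 * (r z)\<^sup>2" if z: "z \<in> ball p d" for z
    proof -
      obtain s where s: "\<bar>s\<bar> \<le> C * \<bar>r z\<bar>" "z + s *\<^sub>R N \<in> frontier \<Omega> \<inter> ball p e1" using d(3)[OF z] by blast
      then have "0 \<le> l (z + s *\<^sub>R N)" using l(2) 1(3) by blast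
      then show ?thesis using key[of z s] s z d(2) unfolding \<Lambda>_def by auto
    qed
    fix f K \<epsilon> assume f: "smooth_on S f" "\<epsilon> > 0" "\<And>w. w \<in> frontier \<Omega> \<inter> ball p \<epsilon> \<Longrightarrow> (f w)\<^sup>2 \<le> K * l w"
    obtain e2 M where 2: "e2 > 0" "M > 0" "ball p e2 \<subseteq> S"
      "\<And>x y. x \<in> ball p e2 \<Longrightarrow> y \<in> ball p e2 \<Longrightarrow> \<bar>f y - f x\<bar> \<le> M * norm (y - x)"
      using smooth_on_local_lipschitz[OF open_S p_in_S f(1)] by blast
    define e3 where "e3 = min \<epsilon> (min e1 e2)"
    have e3: "e3 > 0" "ball p e3 \<subseteq> ball p \<epsilon>" "ball p e3 \<subseteq> ball p e1" "ball p e3 \<subseteq> ball p e2"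
      using f(2) 1(1) 2(1) by (auto simp: e3_def)
    obtain d' where d': "d' > 0" "d' \<le> e3"
      "\<And>z. z \<in> ball p d' \<Longrightarrow> \<exists>s. \<bar>s\<bar> \<le> C * \<bar>r z\<bar> \<and> z + s *\<^sub>R N \<in> frontier \<Omega> \<inter> ball p e3"
      using C(2)[OF e3(1)] by blast
    \<comment> \<open>Twice the boundary constant, plus twice the squared Lipschitz displacement of
      \<open>f\<close> along \<open>N\<close>, plus 1 to be positive.\<close>
    define K' where "K' = 2 * \<bar>K\<bar> + 2 * M\<^sup>2 * (norm N)\<^sup>2 * C\<^sup>2 + 1"
    have K': "K' > 0" unfolding K'_def by (intro add_nonneg_pos add_nonneg_nonneg) auto
    have "(f z)\<^sup>2 \<le> K' * \<Lambda> z" if z: "z \<in> ball p d'" for z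
    proof -
      obtain s where s: "\<bar>s\<bar> \<le> C * \<bar>r z\<bar>" "z + s *\<^sub>R N \<in> frontier \<Omega> \<inter> ball p e3" using d'(3)[OF z] by blast
      let ?w = "z + s *\<^sub>R N"
      have z3: "z \<in> ball p e3" using z d'(2) by auto
      have lw: "0 \<le> l ?w" using l(2) 1(3) s(2) e3(3) by blast
      have \<Lambda>: "l ?w + (r z)\<^sup>2 \<le> \<Lambda> z" using key[of z s] z3 s e3(3) by blast
      have "\<bar>f ?w - f z\<bar> \<le> M * norm (?w - z)" using 2(4)[of z ?w] z3 s(2) e3(4) by blast
      then have "(f ?w - f z)\<^sup>2 \<le> (M * (\<bar>s\<bar> * norm N))\<^sup>2"
        by (intro abs_le_square_iff[THEN iffD1]) (use 2(2) in \<open>simp add: abs_mult\<close>)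
      also have "\<dots> = M\<^sup>2 * (norm N)\<^sup>2 * s\<^sup>2" by (simp add: power_mult_distrib)
      also have "\<dots> \<le> M\<^sup>2 * (norm N)\<^sup>2 * (C\<^sup>2 * (r z)\<^sup>2)" using sq[OF s(1)] by (intro mult_left_mono) auto
      finally have diff: "(f ?w - f z)\<^sup>2 \<le> M\<^sup>2 * (norm N)\<^sup>2 * C\<^sup>2 * (r z)\<^sup>2" by (simp add: mult.assoc)
      have "(f z)\<^sup>2 \<le> 2 * (f ?w)\<^sup>2 + 2 * (f ?w - f z)\<^sup>2"
        using zero_le_power2[of "2 * f ?w - f z"] by (simp add: power2_eq_square algebra_simps)
      also have "\<dots> \<le> 2 * (\<bar>K\<bar> * l ?w) + 2 * (M\<^sup>2 * (norm N)\<^sup>2 * C\<^sup>2 * (r z)\<^sup>2)"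
      proof -
        have "(f ?w)\<^sup>2 \<le> K * l ?w" using f(3) s(2) e3(2) by blast
        also have "\<dots> \<le> \<bar>K\<bar> * l ?w" using lw by (intro mult_right_mono) auto
        finally show ?thesis using diff by linarith
      qed
      also have "\<dots> \<le> K' * (l ?w + (r z)\<^sup>2)"
      proof -
        have "0 \<le> (2 * M\<^sup>2 * (norm N)\<^sup>2 * C\<^sup>2 + 1) * l ?w + (2 * \<bar>K\<bar> + 1) * (r z)\<^sup>2"
          using lw by (intro add_nonneg_nonneg mult_nonneg_nonneg) auto
        then show ?thesis unfolding K'_def by (simp add: algebra_simps)
      qed
      also have "\<dots> \<le> K' * \<Lambda> z" using \<Lambda> K' by simp
      finally show ?thesis .
    qed
    then show "\<exists>C>0. \<exists>\<delta>>0. \<forall>z\<in>ball p \<delta>. (f z)\<^sup>2 \<le> C * (l z - r z * (dir N l z / dir N r z) + C0 * (r z)\<^sup>2)"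
      using K' d'(1) unfolding \<Lambda>_def by blast
  qed
qed

text \<open>As \<open>l\<close> is nonnegative only on the boundary,
  \<open>nonneg_gradient_bound\<close> is applied to the majorant instead, which is nonnegative on a
  full ball and has the same values and the same tangential derivatives on the boundary.\<close>

lemma boundary_gradient_bound:
  assumes l: "smooth_on S l" "\<And>w. w \<in> frontier \<Omega> \<inter> S \<Longrightarrow> 0 \<le> l w"
  obtains C \<delta> where "\<delta> > 0" "C > 0" "ball p \<delta> \<subseteq> S"
    "\<And>w v. w \<in> frontier \<Omega> \<inter> ball p \<delta> \<Longrightarrow> dir v r w = 0 \<Longrightarrow> (dir v l w)\<^sup>2 \<le> C * (norm v)\<^sup>2 * l w"
proof -
  define a where "a z = dir N l z / dir N r z" for z
  have sa: "smooth_on S a" unfolding a_def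
    by (intro smooth_on_divide smooth_on_dir l(1) smooth_r open_S) (use transversal in force)
  obtain C0 d where d: "d > 0" "ball p d \<subseteq> S"
    "\<And>z. z \<in> ball p d \<Longrightarrow> (r z)\<^sup>2 \<le> l z - r z * (dir N l z / dir N r z) + C0 * (r z)\<^sup>2"
    using boundary_majorant[OF l] by metis
  define \<Lambda> where "\<Lambda> z = (l z - r z * a z) + (C0 * r z) * r z" for z
  note sm = smooth_on_add[OF open_S] smooth_on_diff[OF open_S] smooth_on_mult[OF open_S] smooth_on_const l(1) smooth_r sa
  have s\<Lambda>: "smooth_on S \<Lambda>" unfolding \<Lambda>_def by (intro sm)
  have "0 \<le> \<Lambda> z" if "z \<in> ball p d" for z
    using order_trans[OF zero_le_power2 d(3)[OF that]] by (simp add: \<Lambda>_def a_def power2_eq_square mult.assoc)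
  then obtain d2 C where 2: "d2 > 0" "C > 0" "ball p d2 \<subseteq> ball p d"
    "\<And>x v. x \<in> ball p d2 \<Longrightarrow> (dir v \<Lambda> x)\<^sup>2 \<le> C * (norm v)\<^sup>2 * \<Lambda> x"
    using nonneg_gradient_bound[of "ball p d" p \<Lambda>] smooth_on_subset[OF s\<Lambda> d(2)] d(1) by auto
  show thesis
  proof (rule that[OF 2(1,2)])
    show sub: "ball p d2 \<subseteq> S" using 2(3) d(2) by blast
    fix w v assume w: "w \<in> frontier \<Omega> \<inter> ball p d2" and v: "dir v r w = 0"
    then have wS: "w \<in> S" and r0: "r w = 0" using sub r_zero by blast+
    have "dir v \<Lambda> w = (dir v l w - (r w * dir v a w + dir v r w * a w)) + ((C0 * r w) * dir v r w + (C0 * dir v r w + 0 * r w) * r w)"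
      unfolding \<Lambda>_def
      using dir_add[OF sm(2)[OF l(1) sm(3)[OF smooth_r sa]] sm(3)[OF sm(3)[OF sm(4) smooth_r] smooth_r] wS]
        dir_diff[OF l(1) sm(3)[OF smooth_r sa] wS] dir_mult[OF smooth_r sa wS]
        dir_mult[OF sm(3)[OF sm(4) smooth_r] smooth_r wS] dir_mult[OF sm(4) smooth_r wS]
      by simp
    then have "dir v \<Lambda> w = dir v l w" using v r0 by simp
    moreover have "\<Lambda> w = l w" using r0 by (simp add: \<Lambda>_def)
    ultimately show "(dir v l w)\<^sup>2 \<le> C * (norm v)\<^sup>2 * l w" using 2(4)[of w v] w by auto
  qed
qed

text \<open>For a tangent vector \<open>u\<close>, r (p + t u) = O(t^2), so
  \<open>projection\<close> displaces the point by only O(t^2). This replaces a curve in the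
  boundary with velocity \<open>u\<close>.\<close>

lemma tangent_curve:
  assumes u: "dir u r p = 0" and "\<epsilon> > 0"
  obtains t0 K where "t0 > 0" "K > 0"
    "\<And>t. 0 < t \<Longrightarrow> t < t0 \<Longrightarrow> p + t *\<^sub>R u \<in> ball p \<epsilon>"
    "\<And>t. 0 < t \<Longrightarrow> t < t0 \<Longrightarrow> \<exists>s. \<bar>s\<bar> \<le> K * t\<^sup>2 \<and> (p + t *\<^sub>R u) + s *\<^sub>R N \<in> frontier \<Omega> \<inter> ball p \<epsilon>"
proof -
  obtain C where C: "C > 0" "\<And>\<epsilon>. \<epsilon> > 0 \<Longrightarrow> \<exists>\<delta>>0. \<delta> \<le> \<epsilon> \<and>
    (\<forall>z\<in>ball p \<delta>. \<exists>s. \<bar>s\<bar> \<le> C * \<bar>r z\<bar> \<and> z + s *\<^sub>R N \<in> frontier \<Omega> \<inter> ball p \<epsilon>)"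
    using projection by blast
  obtain d where d: "d > 0" "d \<le> \<epsilon>"
    "\<And>z. z \<in> ball p d \<Longrightarrow> \<exists>s. \<bar>s\<bar> \<le> C * \<bar>r z\<bar> \<and> z + s *\<^sub>R N \<in> frontier \<Omega> \<inter> ball p \<epsilon>"
    using C(2)[OF assms(2)] by blast
  obtain e C1 where 1: "e > 0" "C1 > 0" "ball p e \<subseteq> S"
    "\<And>x y. x \<in> ball p e \<Longrightarrow> y \<in> ball p e \<Longrightarrow> \<bar>r y - r x - dir (y - x) r x\<bar> \<le> C1 * (norm (y - x))\<^sup>2"
    using smooth_on_local_taylor[OF open_S p_in_S smooth_r] by blast
  define t0 where "t0 = min d e / (norm u + 1)"
  have n: "norm u + 1 > 0" by (simp add: add_nonneg_pos)
  have near: "p + t *\<^sub>R u \<in> ball p d \<inter> ball p e" if "0 < t" "t < t0" for t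
  proof -
    have "t * norm u \<le> t * (norm u + 1)" using that by simp
    also have "\<dots> < min d e" using that n by (simp add: t0_def field_simps)
    finally show ?thesis using dist_add_scaleR_le[of p p t u] that by auto
  qed
  show thesis
  proof (rule that)
    show "t0 > 0" using d(1) 1(1) n by (simp add: t0_def)
    show "C * (C1 * (norm u)\<^sup>2) + 1 > 0" using C(1) 1(2) by (simp add: add_nonneg_pos)
    fix t assume t: "0 < t" "t < t0"
    show "p + t *\<^sub>R u \<in> ball p \<epsilon>" using near[OF t] d(2) by auto
    obtain s where s: "\<bar>s\<bar> \<le> C * \<bar>r (p + t *\<^sub>R u)\<bar>" "(p + t *\<^sub>R u) + s *\<^sub>R N \<in> frontier \<Omega> \<inter> ball p \<epsilon>"
      using d(3) near[OF t] by blast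
    have "\<bar>r (p + t *\<^sub>R u)\<bar> \<le> C1 * (norm (t *\<^sub>R u))\<^sup>2"
      using 1(4)[of p "p + t *\<^sub>R u"] near[OF t] 1(1) r_zero[OF p_frontier p_in_S]
        dir_scaleR_vec[OF smooth_r p_in_S, of t u] u by auto
    then have "C * \<bar>r (p + t *\<^sub>R u)\<bar> \<le> C * (C1 * (norm (t *\<^sub>R u))\<^sup>2)" using C(1) by simp
    also have "\<dots> \<le> (C * (C1 * (norm u)\<^sup>2) + 1) * t\<^sup>2" by (simp add: power_mult_distrib algebra_simps)
    finally show "\<exists>s. \<bar>s\<bar> \<le> (C * (C1 * (norm u)\<^sup>2) + 1) * t\<^sup>2 \<and> (p + t *\<^sub>R u) + s *\<^sub>R N \<in> frontier \<Omega> \<inter> ball p \<epsilon>"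
      using s by (intro exI[of _ s]) linarith+
  qed
qed

text \<open>The point p + t u lies within O(t^2) of a zero of \<open>f\<close>, so t times the
  derivative is O(t^2).\<close>

lemma tangential_derivative_vanishes:
  fixes f :: "C2 \<Rightarrow> real"
  assumes S': "open S'" "p \<in> S'" "smooth_on S' f" "\<And>w. w \<in> frontier \<Omega> \<inter> S' \<Longrightarrow> f w = 0"
    and u: "dir u r p = 0"
  shows "dir u f p = 0"
proof -
  obtain e1 M where 1: "e1 > 0" "M > 0" "ball p e1 \<subseteq> S'"
    "\<And>x y. x \<in> ball p e1 \<Longrightarrow> y \<in> ball p e1 \<Longrightarrow> \<bar>f y - f x\<bar> \<le> M * norm (y - x)"
    using smooth_on_local_lipschitz[OF S'(1-3)] by blast
  obtain e2 C where 2: "e2 > 0" "C > 0" "ball p e2 \<subseteq> S'"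
    "\<And>x y. x \<in> ball p e2 \<Longrightarrow> y \<in> ball p e2 \<Longrightarrow> \<bar>f y - f x - dir (y - x) f x\<bar> \<le> C * (norm (y - x))\<^sup>2"
    using smooth_on_local_taylor[OF S'(1-3)] by blast
  have "min e1 e2 > 0" using 1(1) 2(1) by simp
  from tangent_curve[OF u this] obtain t0 K where t0: "t0 > 0" "K > 0"
    "\<And>t. 0 < t \<Longrightarrow> t < t0 \<Longrightarrow> p + t *\<^sub>R u \<in> ball p (min e1 e2)"
    "\<And>t. 0 < t \<Longrightarrow> t < t0 \<Longrightarrow> \<exists>s. \<bar>s\<bar> \<le> K * t\<^sup>2 \<and> (p + t *\<^sub>R u) + s *\<^sub>R N \<in> frontier \<Omega> \<inter> ball p (min e1 e2)"
    by metis
  have fp: "f p = 0" using S'(2,4) p_frontier by blast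
  have "\<bar>dir u f p\<bar> \<le> (C * (norm u)\<^sup>2 + M * (K * norm N)) * t" if t: "0 < t" "t < t0" for t
  proof -
    obtain s where s: "\<bar>s\<bar> \<le> K * t\<^sup>2" "(p + t *\<^sub>R u) + s *\<^sub>R N \<in> frontier \<Omega> \<inter> ball p (min e1 e2)"
      using t0(4)[OF t] by blast
    then have "f ((p + t *\<^sub>R u) + s *\<^sub>R N) = 0" using S'(4) 1(3) by auto
    then have "\<bar>f (p + t *\<^sub>R u)\<bar> \<le> M * (\<bar>s\<bar> * norm N)"
      using 1(4)[of "p + t *\<^sub>R u" "(p + t *\<^sub>R u) + s *\<^sub>R N"] t0(3)[OF t] s(2) by simp
    also have "\<dots> \<le> M * (K * t\<^sup>2 * norm N)" using s(1) 1(2) by (intro mult_left_mono mult_right_mono) auto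
    finally have a: "\<bar>f (p + t *\<^sub>R u)\<bar> \<le> M * (K * t\<^sup>2 * norm N)" .
    have "\<bar>f (p + t *\<^sub>R u) - t * dir u f p\<bar> \<le> C * (norm (t *\<^sub>R u))\<^sup>2"
      using 2(4)[of p "p + t *\<^sub>R u"] t0(3)[OF t] 2(1) fp dir_scaleR_vec[OF S'(3,2), of t u] by simp
    moreover have "t * \<bar>dir u f p\<bar> = \<bar>t * dir u f p\<bar>" using t by (simp add: abs_mult)
    ultimately have "t * \<bar>dir u f p\<bar> \<le> C * (norm (t *\<^sub>R u))\<^sup>2 + M * (K * t\<^sup>2 * norm N)"
      using a by linarith
    also have "\<dots> = t * ((C * (norm u)\<^sup>2 + M * (K * norm N)) * t)"
      by (simp add: power_mult_distrib power2_eq_square algebra_simps)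
    finally show ?thesis using t by simp
  qed
  then show ?thesis using zero_if_small[OF t0(1)] by blast
qed

text \<open>At a critical point the gradient is O(t) nearby, so the displacement of size O(t^2) to
  the boundary changes \<open>f\<close> by only O(t^3), which is less than a nonzero t^2 term.
  Without \<open>crit\<close> the curvature of the boundary would contribute.\<close>

lemma tangential_second_derivative_vanishes:
  fixes f :: "C2 \<Rightarrow> real"
  assumes S': "open S'" "p \<in> S'" "smooth_on S' f" "\<And>w. w \<in> frontier \<Omega> \<inter> S' \<Longrightarrow> f w = 0"
    and crit: "\<And>v. dir v f p = 0" and u: "dir u r p = 0"
  shows "dir u (dir u f) p = 0"
proof -
  note s1 = smooth_on_dir[OF S'(3)] and s2 = smooth_on_dir[OF smooth_on_dir[OF S'(3)]]
  obtain e1 M where 1: "e1 > 0" "M > 0" "ball p e1 \<subseteq> S'"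
    "\<And>x y. x \<in> ball p e1 \<Longrightarrow> y \<in> ball p e1 \<Longrightarrow> \<bar>dir N f y - dir N f x\<bar> \<le> M * norm (y - x)"
    using smooth_on_local_lipschitz[OF S'(1,2) s1[of N]] by blast
  obtain e2 M2 where 2: "e2 > 0" "M2 > 0" "ball p e2 \<subseteq> S'"
    "\<And>x y. x \<in> ball p e2 \<Longrightarrow> y \<in> ball p e2 \<Longrightarrow> \<bar>dir u (dir u f) y - dir u (dir u f) x\<bar> \<le> M2 * norm (y - x)"
    using smooth_on_local_lipschitz[OF S'(1,2) s2[of u u]] by blast
  define e where "e = min e1 e2"
  have e: "e > 0" "ball p e \<subseteq> ball p e1" "ball p e \<subseteq> ball p e2" using 1(1) 2(1) by (auto simp: e_def)
  obtain t0 K where t0: "t0 > 0" "K > 0"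
    "\<And>t. 0 < t \<Longrightarrow> t < t0 \<Longrightarrow> p + t *\<^sub>R u \<in> ball p e"
    "\<And>t. 0 < t \<Longrightarrow> t < t0 \<Longrightarrow> \<exists>s. \<bar>s\<bar> \<le> K * t\<^sup>2 \<and> (p + t *\<^sub>R u) + s *\<^sub>R N \<in> frontier \<Omega> \<inter> ball p e"
    using tangent_curve[OF u e(1)] by metis
  have fp: "f p = 0" using S'(2,4) p_frontier by blast
  define c where "c = norm u + K * norm N"
  have c: "c \<ge> 0" using t0(2) by (simp add: c_def)
  have cubic: "\<bar>f (p + t *\<^sub>R u)\<bar> \<le> (K * M * c) * t * t\<^sup>2" if t: "0 < t" "t < t0" "t \<le> 1" for t
  proof -
    let ?x = "p + t *\<^sub>R u"
    obtain s where s: "\<bar>s\<bar> \<le> K * t\<^sup>2" "?x + s *\<^sub>R N \<in> frontier \<Omega> \<inter> ball p e"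
      using t0(4)[OF t(1,2)] by blast
    then have f0: "f (?x + s *\<^sub>R N) = 0" using S'(4) 1(3) e(2) by blast
    have in_ball: "?x + q *\<^sub>R N \<in> ball p e" if "min 0 s \<le> q" "q \<le> max 0 s" for q
      using segment_in_ball[OF t0(3)[OF t(1,2)] _ that] s(2) by blast
    then have in_S: "?x + q *\<^sub>R N \<in> S'" if "min 0 s \<le> q" "q \<le> max 0 s" for q
      using that e(2) 1(3) by blast
    obtain q where q: "min 0 s \<le> q" "q \<le> max 0 s" "f (?x + s *\<^sub>R N) - f (?x + 0 *\<^sub>R N) = s * dir N f (?x + q *\<^sub>R N)"
      using MVT_abs[of s "\<lambda>q. f (?x + q *\<^sub>R N)" "\<lambda>q. dir N f (?x + q *\<^sub>R N)"]
        smooth_on_line_derivative[OF S'(3) in_S] by blast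
    have qs: "\<bar>q\<bar> \<le> \<bar>s\<bar>" using q(1,2) by linarith
    have "t\<^sup>2 \<le> t" using t by (simp add: power2_eq_square mult_left_le)
    then have "\<bar>q\<bar> \<le> K * t" using qs s(1) mult_left_mono[of "t\<^sup>2" t K] t0(2) by linarith
    then have "\<bar>q\<bar> * norm N \<le> K * t * norm N" by (intro mult_right_mono) auto
    then have "norm (?x + q *\<^sub>R N - p) \<le> c * t"
      using norm_triangle_ineq[of "t *\<^sub>R u" "q *\<^sub>R N"] t(1) by (simp add: c_def algebra_simps)
    then have "M * norm (?x + q *\<^sub>R N - p) \<le> M * (c * t)" using 1(2) by (intro mult_left_mono) auto
    then have "\<bar>dir N f (?x + q *\<^sub>R N)\<bar> \<le> M * (c * t)"
      using 1(4)[of p "?x + q *\<^sub>R N"] in_ball[OF q(1,2)] e(2) 1(1) crit by fastforce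
    then have "\<bar>s\<bar> * \<bar>dir N f (?x + q *\<^sub>R N)\<bar> \<le> (K * t\<^sup>2) * (M * (c * t))"
      using s(1) t0(2) by (intro mult_mono) auto
    moreover have "f ?x = - (s * dir N f (?x + q *\<^sub>R N))" using q(3) f0 by simp
    then have "\<bar>f ?x\<bar> = \<bar>s\<bar> * \<bar>dir N f (?x + q *\<^sub>R N)\<bar>" by (simp only: abs_minus_cancel abs_mult)
    ultimately show ?thesis by (simp add: mult_ac)
  qed
  have "\<bar>dir u (dir u f) p\<bar> \<le> (2 * (K * M * c) + M2 * norm u) * t" if t: "0 < t" "t < min t0 1" for t
  proof -
    have in_S: "p + q *\<^sub>R u \<in> ball p e" if "0 \<le> q" "q \<le> t" for q
      using t0(3)[of q] that t e(1) by (cases "q = 0") auto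
    define D where "D m = (if m = 0 then (\<lambda>q. f (p + q *\<^sub>R u)) else if m = Suc 0 then (\<lambda>q. dir u f (p + q *\<^sub>R u))
      else (\<lambda>q. dir u (dir u f) (p + q *\<^sub>R u)))" for m :: nat
    have "\<forall>m q. m < 2 \<and> 0 \<le> q \<and> q \<le> t \<longrightarrow> DERIV (D m) q :> D (Suc m) q"
    proof (intro allI impI)
      fix m :: nat and q assume a: "m < 2 \<and> 0 \<le> q \<and> q \<le> t"
      then have y: "p + q *\<^sub>R u \<in> S'" using in_S e(2) 1(3) by blast
      consider "m = 0" | "m = Suc 0" using a by linarith
      then show "DERIV (D m) q :> D (Suc m) q"
        using smooth_on_line_derivative[OF S'(3) y] smooth_on_line_derivative[OF s1 y]
        by cases (simp_all add: D_def)
    qed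
    then obtain q where q: "0 < q" "q < t"
      "f (p + t *\<^sub>R u) = (\<Sum>m<2. (D m 0 / fact m) * t ^ m) + (D 2 q / fact 2) * t ^ 2"
      using Maclaurin[of t 2 D "\<lambda>q. f (p + q *\<^sub>R u)"] t by (auto simp: D_def)
    have "f (p + t *\<^sub>R u) = dir u (dir u f) (p + q *\<^sub>R u) / 2 * t\<^sup>2"
      using q(3) fp crit by (simp add: D_def numeral_2_eq_2)
    then have "\<bar>f (p + t *\<^sub>R u)\<bar> = \<bar>dir u (dir u f) (p + q *\<^sub>R u)\<bar> / 2 * t\<^sup>2"
      by (simp only: abs_mult abs_divide) simp
    then have "\<bar>dir u (dir u f) (p + q *\<^sub>R u)\<bar> / 2 * t\<^sup>2 \<le> ((K * M * c) * t) * t\<^sup>2"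
      using cubic[of t] t by linarith
    then have "\<bar>dir u (dir u f) (p + q *\<^sub>R u)\<bar> / 2 \<le> (K * M * c) * t"
      by (rule mult_right_le_imp_le) (use t in simp)
    then have b: "\<bar>dir u (dir u f) (p + q *\<^sub>R u)\<bar> \<le> 2 * (K * M * c) * t" by simp
    have "\<bar>dir u (dir u f) (p + q *\<^sub>R u) - dir u (dir u f) p\<bar> \<le> M2 * norm (p + q *\<^sub>R u - p)"
      by (rule 2(4)) (use in_S[of q] q e 2(1) in auto)
    also have "\<dots> \<le> M2 * (t * norm u)" using q(1,2) 2(2) by (auto intro!: mult_left_mono mult_right_mono)
    finally show ?thesis using b by (simp add: algebra_simps)
  qed
  then show ?thesis using zero_if_small[of "min t0 1"] t0(1) by (metis min_less_iff_conj zero_less_one)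
qed

text \<open>Differentials of functions vanishing on the boundary are proportional at
  \<open>p\<close>. Subtracting the constant multiple c r from r' leaves a function that vanishes on
  the boundary and is critical at \<open>p\<close>, so its tangential second derivatives are
  zero.\<close>

lemma levi_transformation:
  assumes S': "open S'" "p \<in> S'" "smooth_on S' r'" "\<And>w. w \<in> frontier \<Omega> \<inter> S' \<Longrightarrow> r' w = 0"
  defines "c \<equiv> dir N r' p / dir N r p"
  shows "dir v r' p = c * dir v r p"
    and "dir u r p = 0 \<Longrightarrow> dir (J u) r p = 0 \<Longrightarrow> levi r' u u p = c * levi r u u p"
proof -
  have lin: "linear (\<lambda>v. dir v r p)" "linear (\<lambda>v. dir v r' p)"
    using linear_dir smooth_r p_in_S S' by blast+
  have N: "dir N r p > 0" using transversal p_in_S by blast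
  show d: "dir v r' p = c * dir v r p" for v
  proof -
    define k where "k = dir v r p / dir N r p"
    have "dir (v - k *\<^sub>R N) r p = 0"
      using N by (simp only: linear_diff[OF lin(1)] linear_cmul[OF lin(1)]) (simp add: k_def)
    then have "dir (v - k *\<^sub>R N) r' p = 0"
      using tangential_derivative_vanishes[OF S'] by blast
    then show ?thesis
      using N by (simp only: linear_diff[OF lin(2)] linear_cmul[OF lin(2)]) (simp add: k_def c_def)
  qed
  assume u: "dir u r p = 0" "dir (J u) r p = 0"
  define T where "T = S \<inter> S'"
  have T: "open T" "p \<in> T" using open_S S'(1,2) p_in_S by (auto simp: T_def)
  have s: "smooth_on T r" "smooth_on T r'" unfolding T_def
    by (rule smooth_on_subset[OF smooth_r] smooth_on_subset[OF S'(3)], blast)+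
  define f where "f z = r' z + (- c) * r z" for z
  have sc: "smooth_on T (\<lambda>z. (- c) * r z)" by (intro smooth_on_mult smooth_on_const T s)
  have sf: "smooth_on T f" unfolding f_def by (intro smooth_on_add sc T s)
  have f0: "f w = 0" if "w \<in> frontier \<Omega> \<inter> T" for w
    using that S'(4) r_zero by (auto simp: f_def T_def)
  have "dir v f p = dir v r' p + ((- c) * dir v r p + 0 * r p)" for v
    unfolding f_def using dir_add[OF s(2) sc T(2)] dir_mult[OF smooth_on_const[of T "- c"] s(1) T(2), of v] by simp
  then have crit: "dir v f p = 0" for v using d by simp
  note z = tangential_second_derivative_vanishes[OF T sf f0 crit]
  have "levi f u u p = 0" unfolding levi_def using z[OF _ u(1)] z[OF _ u(2)] by simp
  moreover have "levi f u u p = levi r' u u p + (- c) * levi r u u p"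
    unfolding f_def
    using levi_add_fun[OF T(1) s(2) sc T(2)] levi_mult_fun[OF T(1) smooth_on_const[of T "- c"] s(1) T(2), of u u]
    by (simp add: levi_const_fun crossd_def)
  ultimately show "levi r' u u p = c * levi r u u p" by simp
qed

end

subsection \<open>Pointwise estimates\<close>

text \<open>With \<alpha> = a + ib and \<beta> = c + id, the numbers m and n are the parts of
  \<alpha> times the conjugate of \<beta>, so m^2 + n^2 = P Q; Cauchy-Schwarz and the inequality of
  arithmetic and geometric means finish.\<close>

lemma nonneg_hermitian_form:
  fixes A B :: real
  assumes "0 \<le> A" "0 \<le> B" "b1\<^sup>2 + b2\<^sup>2 \<le> A * B"
  shows "0 \<le> (a\<^sup>2 + b\<^sup>2) * A + (c\<^sup>2 + d\<^sup>2) * B + 2 * ((a * c + b * d) * b1 + (b * c - a * d) * b2)"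
proof -
  define P Q where "P = a\<^sup>2 + b\<^sup>2" and "Q = c\<^sup>2 + d\<^sup>2"
  define m n where "m = a * c + b * d" and "n = b * c - a * d"
  have PQ: "0 \<le> P" "0 \<le> Q" by (auto simp: P_def Q_def)
  have mn: "m\<^sup>2 + n\<^sup>2 = P * Q" unfolding P_def Q_def m_def n_def by (simp add: power2_eq_square algebra_simps)
  have "(m * b1 + n * b2)\<^sup>2 \<le> (m\<^sup>2 + n\<^sup>2) * (b1\<^sup>2 + b2\<^sup>2)"
    using zero_le_power2[of "m * b2 - n * b1"] by (simp add: power2_eq_square algebra_simps)
  also have "\<dots> \<le> (P * Q) * (A * B)" unfolding mn using assms PQ by (intro mult_left_mono) auto
  also have "\<dots> \<le> ((P * A + Q * B) / 2)\<^sup>2"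
    using zero_le_power2[of "P * A - Q * B"] by (simp add: power2_eq_square field_simps)
  finally have "\<bar>m * b1 + n * b2\<bar> \<le> \<bar>(P * A + Q * B) / 2\<bar>" by (rule abs_le_square_iff[THEN iffD2])
  also have "\<dots> = (P * A + Q * B) / 2" using PQ assms by simp
  finally have "\<bar>m * b1 + n * b2\<bar> \<le> (P * A + Q * B) / 2" .
  moreover have "0 \<le> y + 2 * x" if "\<bar>x\<bar> \<le> y / 2" for x y :: real using that by linarith
  ultimately have "0 \<le> P * A + Q * B + 2 * (m * b1 + n * b2)" by blast
  then show ?thesis unfolding P_def Q_def m_def n_def .
qed

text \<open>The second factor is \<lambda> written through \<Lambda>, so that its r a cancels the
  following -r a. Of the full \<Lambda>, at most 1/4 is lost to the factor 1 + \<kappa>, 1/8 to the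
  product of \<phi> with r a, and 1/8 to the term with X. All remaining losses are at most 2 M r^2,
  against a gain of 4 M r^2.\<close>

lemma tangential_estimate:
  fixes B K M \<sigma> r X c a E C0 \<Lambda> q l :: real
  assumes B: "1 \<le> B" and K: "0 \<le> K" and M: "2 * K * B + 2 * B + 2 * B ^ 3 \<le> M"
    and \<sigma>: "0 < \<sigma>" "16 * \<sigma> * (B ^ 3 + K + M + 1) \<le> 1"
    and small: "\<bar>r\<bar> \<le> \<sigma>" "\<bar>X\<bar> \<le> \<sigma>" "0 \<le> q" "q \<le> \<sigma>"
    and bd: "\<bar>c\<bar> \<le> B" "\<bar>a\<bar> \<le> B" "\<bar>E\<bar> \<le> B" "\<bar>C0\<bar> \<le> B" "X\<^sup>2 \<le> B * \<Lambda>" "0 \<le> \<Lambda>" "1 \<le> l"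
  shows "\<Lambda> / 2 \<le> (1 + c * X\<^sup>2 + 2 * (r * (K + M * q))) * (\<Lambda> + r * a - C0 * r\<^sup>2)
      - r * a + r * (X * E) + 4 * M * r\<^sup>2 * l"
    and "\<bar>c * X\<^sup>2\<bar> \<le> 1 / 16" "\<bar>r * (K + M * q)\<bar> \<le> 1 / 16" "M * \<sigma> \<le> 1" "\<sigma> \<le> 1"
proof -
  have B3: "B \<le> B ^ 3" "1 \<le> B ^ 3" using B self_le_power[of B 3] one_le_power[of B 3] by auto
  have M0: "0 \<le> M" using M K B by (smt (verit) mult_nonneg_nonneg zero_le_power)
  have sB: "\<sigma> * B ^ 3 \<le> 1 / 16" and sKM: "\<sigma> * (K + M) \<le> 1 / 16" and s1: "\<sigma> \<le> 1 / 16" and Ms: "M * \<sigma> \<le> 1 / 16"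
  proof -
    have "0 \<le> \<sigma> * B ^ 3" "0 \<le> \<sigma> * K" "0 \<le> \<sigma> * M" using \<sigma>(1) B K M0 by auto
    then show "\<sigma> * B ^ 3 \<le> 1 / 16" "\<sigma> * (K + M) \<le> 1 / 16" "\<sigma> \<le> 1 / 16" "M * \<sigma> \<le> 1 / 16"
      using \<sigma> by (auto simp: algebra_simps)
  qed
  have sB1: "\<sigma> * B \<le> 1 / 16" using mult_left_mono[OF B3(1), of \<sigma>] \<sigma>(1) sB by linarith
  have X2: "X\<^sup>2 \<le> \<sigma>"
  proof -
    have "\<bar>X\<bar> * \<bar>X\<bar> \<le> \<sigma> * 1" using small(2) s1 by (intro mult_mono) auto
    then show ?thesis by (simp add: power2_eq_square)
  qed
  have cX: "\<bar>c * X\<^sup>2\<bar> \<le> B * X\<^sup>2" unfolding abs_mult using bd(1) by (simp add: mult_right_mono)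
  also have "\<dots> \<le> B * \<sigma>" using X2 B by simp
  finally show f1: "\<bar>c * X\<^sup>2\<bar> \<le> 1 / 16" using sB1 by (simp add: mult.commute)
  define g where "g = K + M * q"
  have "M * q \<le> M * \<sigma>" using small(4) M0 by (rule mult_left_mono)
  then have g: "0 \<le> g" "g \<le> K + M * \<sigma>" "g \<le> K + M"
    using K M0 small(3) mult_left_mono[OF order_trans[OF s1], of 1 M] unfolding g_def by auto
  have "\<bar>r * g\<bar> \<le> \<sigma> * (K + M)" unfolding abs_mult using small(1) g by (intro mult_mono) auto
  then show f2: "\<bar>r * (K + M * q)\<bar> \<le> 1 / 16" using sKM by (simp add: g_def)
  then have f2': "\<bar>r * g\<bar> \<le> 1 / 16" by (simp add: g_def)
  show "M * \<sigma> \<le> 1" "\<sigma> \<le> 1" using Ms s1 by auto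
  define \<kappa> where "\<kappa> = c * X\<^sup>2 + 2 * (r * g)"
  have \<kappa>: "\<bar>\<kappa>\<bar> \<le> 1 / 4" using f1 f2' unfolding \<kappa>_def by linarith
  have t1: "3 / 4 * \<Lambda> \<le> (1 + \<kappa>) * \<Lambda>" using \<kappa> bd(6) by (intro mult_right_mono) auto
  have t2: "\<bar>c * X\<^sup>2 * (r * a)\<bar> \<le> \<Lambda> / 8"
  proof -
    have "\<bar>c * X\<^sup>2 * (r * a)\<bar> \<le> (B * (B * \<Lambda>)) * (\<sigma> * B)"
      unfolding abs_mult[of "c * X\<^sup>2"] abs_mult[of r]
    proof (intro mult_mono)
      show "\<bar>c * X\<^sup>2\<bar> \<le> B * (B * \<Lambda>)" using cX mult_left_mono[OF bd(5), of B] B by linarith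
    qed (use small bd \<sigma> B in auto)
    also have "\<dots> = (\<sigma> * B ^ 3) * \<Lambda>" by (simp add: power3_eq_cube)
    also have "\<dots> \<le> 1 / 16 * \<Lambda>" using sB bd(6) by (intro mult_right_mono) auto
    finally show ?thesis using bd(6) by simp
  qed
  \<comment> \<open>\<open>M\<close> itself enters this loss through \<open>g\<close>, but only with
    the small factor \<sigma> B; otherwise the requirement on \<open>M\<close> would be
    circular.\<close>
  have t3: "\<bar>2 * (r * g) * (r * a)\<bar> \<le> (2 * K * B + M) * r\<^sup>2"
  proof -
    have "\<bar>2 * (r * g) * (r * a)\<bar> = (2 * g * \<bar>a\<bar>) * r\<^sup>2"
      using g(1) by (simp add: abs_mult power2_eq_square)
    also have "2 * g * \<bar>a\<bar> \<le> 2 * (K + M * \<sigma>) * B" using g bd(2) B by (intro mult_mono) auto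
    also have "\<dots> = 2 * K * B + 2 * M * (\<sigma> * B)" by (simp add: algebra_simps)
    also have "2 * M * (\<sigma> * B) \<le> 2 * M * (1 / 16)" using sB1 M0 by (intro mult_left_mono) auto
    also have "2 * M * (1 / 16) \<le> M" using M0 by simp
    finally show ?thesis by (simp add: mult_right_mono)
  qed
  have t4: "\<bar>(1 + \<kappa>) * (C0 * r\<^sup>2)\<bar> \<le> (2 * B) * r\<^sup>2"
  proof -
    have "\<bar>(1 + \<kappa>) * C0\<bar> \<le> 2 * B" unfolding abs_mult using \<kappa> bd(4) B by (intro mult_mono) auto
    then show ?thesis by (simp add: abs_mult mult_right_mono flip: mult.assoc)
  qed
  have t5: "\<bar>r * (X * E)\<bar> \<le> \<Lambda> / 8 + 2 * B ^ 3 * r\<^sup>2"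
  proof -
    have "\<bar>r * (X * E)\<bar> \<le> \<bar>r\<bar> * (\<bar>X\<bar> * B)" unfolding abs_mult using bd(3) by (intro mult_left_mono) auto
    \<comment> \<open>Young's inequality, with weight 8 B so that X^2 \<le> B \<Lambda> turns its
      first half into \<Lambda> / 8.\<close>
    also have "\<dots> \<le> X\<^sup>2 / (8 * B) + 2 * B ^ 3 * r\<^sup>2"
    proof -
      have "0 \<le> (\<bar>X\<bar> - 4 * B\<^sup>2 * \<bar>r\<bar>)\<^sup>2 / (8 * B)" using B by simp
      also have "\<dots> = X\<^sup>2 / (8 * B) + 2 * B ^ 3 * r\<^sup>2 - \<bar>r\<bar> * (\<bar>X\<bar> * B)"
      proof -
        have "(\<bar>X\<bar> - 4 * B\<^sup>2 * \<bar>r\<bar>)\<^sup>2 = X\<^sup>2 + 16 * B ^ 4 * r\<^sup>2 - 8 * B\<^sup>2 * \<bar>r\<bar> * \<bar>X\<bar>"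
          by (simp add: power2_diff power_mult_distrib)
        then show ?thesis using B by (simp add: field_simps power2_eq_square power3_eq_cube power4_eq_xxxx)
      qed
      finally show ?thesis by simp
    qed
    also have "X\<^sup>2 / (8 * B) \<le> \<Lambda> / 8" using bd(5) B by (simp add: field_simps)
    finally show ?thesis by simp
  qed
  have t6: "4 * (M * r\<^sup>2) \<le> 4 * M * r\<^sup>2 * l"
    using mult_left_mono[OF bd(7), of "4 * M * r\<^sup>2"] M0 by (simp add: mult.assoc)
  have t7: "(2 * K * B + 2 * B + 2 * B ^ 3) * r\<^sup>2 \<le> M * r\<^sup>2" using M by (intro mult_right_mono) auto
  have t8: "0 \<le> M * r\<^sup>2" using M0 by simp
  have sum_up: "L / 2 \<le> u1 + u2 + u3 - u4 + u5 + u6"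
    if "3 / 4 * L \<le> u1" "\<bar>u2\<bar> \<le> L / 8" "\<bar>u3\<bar> \<le> v3" "\<bar>u4\<bar> \<le> v4" "\<bar>u5\<bar> \<le> L / 8 + v5"
      "4 * m \<le> u6" "v3 + v4 + v5 \<le> 2 * m" "0 \<le> m" for L m u1 u2 u3 u4 u5 u6 v3 v4 v5 :: real
    using that by linarith
  have "(1 + c * X\<^sup>2 + 2 * (r * (K + M * q))) * (\<Lambda> + r * a - C0 * r\<^sup>2)
      - r * a + r * (X * E) + 4 * M * r\<^sup>2 * l
    = (1 + \<kappa>) * \<Lambda> + c * X\<^sup>2 * (r * a) + 2 * (r * g) * (r * a) - (1 + \<kappa>) * (C0 * r\<^sup>2) + r * (X * E) + 4 * M * r\<^sup>2 * l"
    unfolding \<kappa>_def g_def by (simp add: algebra_simps)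
  moreover have t9: "(2 * K * B + M) * r\<^sup>2 + 2 * B * r\<^sup>2 + 2 * B ^ 3 * r\<^sup>2 \<le> 2 * (M * r\<^sup>2)"
  proof -
    have "(2 * K * B + M) * r\<^sup>2 + 2 * B * r\<^sup>2 + 2 * B ^ 3 * r\<^sup>2
        = (2 * K * B + 2 * B + 2 * B ^ 3) * r\<^sup>2 + M * r\<^sup>2" by algebra
    also have "\<dots> \<le> M * r\<^sup>2 + M * r\<^sup>2" using t7 by (rule add_right_mono)
    finally show ?thesis by simp
  qed
  note sum_up[OF t1 t2 t3 t4 t5 t6 t9 t8]
  ultimately show "\<Lambda> / 2 \<le> (1 + c * X\<^sup>2 + 2 * (r * (K + M * q))) * (\<Lambda> + r * a - C0 * r\<^sup>2)
      - r * a + r * (X * E) + 4 * M * r\<^sup>2 * l"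
    by (simp only:)
qed

text \<open>Here \<open>T\<close> stands for sqrt \<Lambda>. Every summand has a factor
  \<open>r\<close>, \<open>b\<close> or \<open>X\<close>, each O(T), and each \<open>M\<close> is
  paired with a further small factor, so the bound is independent of \<open>M\<close>.\<close>

lemma mixed_estimate:
  fixes B M r g h T b X F1 F2 D1 D2 P1 P2 N1 N2 :: real
  assumes B: "1 \<le> B" and T: "\<bar>r\<bar> \<le> T" "\<bar>b\<bar> \<le> B * T" "\<bar>X\<bar> \<le> B * T"
    and small: "\<bar>r * g\<bar> \<le> 1" "\<bar>h\<bar> \<le> 2" "\<bar>r\<bar> * M \<le> 1" "0 \<le> M" "\<bar>D1\<bar> * M \<le> 1" "\<bar>D2\<bar> * M \<le> 1"
    and bd: "\<bar>P1\<bar> \<le> B" "\<bar>P2\<bar> \<le> B" "\<bar>F1\<bar> \<le> B" "\<bar>F2\<bar> \<le> B" "\<bar>N1\<bar> \<le> B" "\<bar>N2\<bar> \<le> B"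
  shows "\<bar>r * (P1 + (r * (M * P2) + g * b + M * (N1 * D1 + N2 * D2))) + h * b
      + (N1 * (X * F1 + r * (M * D1)) + N2 * (X * F2 + r * (M * D2)))\<bar> \<le> 13 * B ^ 3 * T"
proof -
  have T0: "0 \<le> T" using T(1) by linarith
  have B3: "B \<le> B ^ 3" "0 \<le> B" using B self_le_power[of B 3] one_le_power[of B 3] by auto
  have BT: "0 \<le> B * T" using B3 T0 by simp
  have B3T: "B * T \<le> B ^ 3 * T" using B3 T0 by (intro mult_right_mono)
  have pr: "\<bar>n\<bar> * \<bar>r\<bar> \<le> B * T" if "\<bar>n\<bar> \<le> B" for n
    by (rule mult_mono[OF that T(1) B3(2) abs_ge_zero])
  have le1: "x * y \<le> B * T" if "0 \<le> x" "x \<le> 1" "0 \<le> y" "y \<le> B * T" for x y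
    by (rule order_trans[OF mult_left_le_one_le[OF that(3,1,2)] that(4)])
  have i1: "\<bar>r * P1\<bar> \<le> B * T" using pr[OF bd(1)] by (simp add: abs_mult mult.commute)
  have absM: "\<bar>M\<bar> = M" using small(4) by simp
  have i2: "\<bar>r * (r * (M * P2))\<bar> \<le> B * T"
  proof -
    have "\<bar>r * (r * (M * P2))\<bar> = (\<bar>r\<bar> * M) * (\<bar>P2\<bar> * \<bar>r\<bar>)" unfolding abs_mult absM by (simp only: mult_ac)
    also have "\<dots> \<le> B * T" by (rule le1[OF _ small(3) _ pr[OF bd(2)]]) (simp_all add: small(4))
    finally show ?thesis .
  qed
  have i3: "\<bar>r * (g * b)\<bar> \<le> B * T"
  proof -
    have "\<bar>r * (g * b)\<bar> = \<bar>r * g\<bar> * \<bar>b\<bar>" by (simp only: abs_mult mult_ac)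
    also have "\<dots> \<le> B * T" by (rule le1[OF abs_ge_zero small(1) abs_ge_zero T(2)])
    finally show ?thesis .
  qed
  have j: "\<bar>r * (M * (n * D))\<bar> \<le> B * T" if "\<bar>n\<bar> \<le> B" "\<bar>D\<bar> * M \<le> 1" for n D
  proof -
    have "\<bar>r * (M * (n * D))\<bar> = (\<bar>D\<bar> * M) * (\<bar>n\<bar> * \<bar>r\<bar>)" unfolding abs_mult absM by (simp only: mult_ac)
    also have "\<dots> \<le> B * T" by (rule le1[OF _ that(2) _ pr[OF that(1)]]) (simp_all add: small(4))
    finally show ?thesis .
  qed
  have i4: "\<bar>h * b\<bar> \<le> 2 * (B * T)" unfolding abs_mult by (rule mult_mono[OF small(2) T(2)]) simp_all
  have k: "\<bar>n * (X * F)\<bar> \<le> B ^ 3 * T" if "\<bar>n\<bar> \<le> B" "\<bar>F\<bar> \<le> B" for n F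
  proof -
    have "\<bar>n * (X * F)\<bar> \<le> B * ((B * T) * B)" unfolding abs_mult
      by (intro mult_mono that T(3) B3(2) BT mult_nonneg_nonneg abs_ge_zero)
    also have "\<dots> = B ^ 3 * T" by (simp only: power3_eq_cube mult_ac)
    finally show ?thesis .
  qed
  have sum_up: "\<bar>x1 + x2 + x3 + x4 + x5 + x6 + x7 + x8 + x4 + x5\<bar> \<le> 13 * w"
    if "\<bar>x1\<bar> \<le> v" "\<bar>x2\<bar> \<le> v" "\<bar>x3\<bar> \<le> v" "\<bar>x4\<bar> \<le> v" "\<bar>x5\<bar> \<le> v" "\<bar>x6\<bar> \<le> 2 * v"
      "\<bar>x7\<bar> \<le> w" "\<bar>x8\<bar> \<le> w" "v \<le> w" "0 \<le> v" for x1 x2 x3 x4 x5 x6 x7 x8 v w :: real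
    using that unfolding abs_le_iff by linarith
  have "r * (P1 + (r * (M * P2) + g * b + M * (N1 * D1 + N2 * D2))) + h * b
      + (N1 * (X * F1 + r * (M * D1)) + N2 * (X * F2 + r * (M * D2)))
    = r * P1 + r * (r * (M * P2)) + r * (g * b) + r * (M * (N1 * D1)) + r * (M * (N2 * D2)) + h * b
      + N1 * (X * F1) + N2 * (X * F2) + r * (M * (N1 * D1)) + r * (M * (N2 * D2))"
    by algebra
  moreover note sum_up[OF i1 i2 i3 j[OF bd(5) small(5)] j[OF bd(6) small(6)] i4
      k[OF bd(5) bd(3)] k[OF bd(6) bd(4)] B3T BT]
  ultimately show ?thesis by (simp only: mult.assoc)
qed

text \<open>The only large term is \<open>g * G\<close>, bounded below by
  \<open>K * \<gamma>\<close>. The terms with \<open>M\<close> carry a factor \<open>r\<close>, so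
  the loss depends on \<open>B\<close> alone and \<open>K\<close> can be fixed before
  \<open>M\<close>.\<close>

lemma normal_estimate:
  fixes B M K r g h \<gamma> G P1 P2 P3 C1 C2 :: real
  assumes B: "1 \<le> B"
    and small: "\<bar>r * g\<bar> \<le> 1" "\<bar>h\<bar> \<le> 2" "\<bar>r\<bar> * M \<le> 1" "0 \<le> M" "\<bar>r\<bar> \<le> 1"
    and bd: "\<bar>P1\<bar> \<le> B" "\<bar>P2\<bar> \<le> B" "\<bar>P3\<bar> \<le> B" "\<bar>C1\<bar> \<le> B" "\<bar>C2\<bar> \<le> B"
    and G: "K \<le> g" "0 \<le> K" "0 \<le> \<gamma>" "\<gamma> \<le> G"
  shows "2 * K * \<gamma> - 13 * B \<le> r * (P1 + (r * (M * P2) + g * P3 + 2 * (M * C1))) + h * P3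
      + 2 * (C2 + r * (M * C1) + g * G)"
proof -
  have le1: "x * y \<le> B" if "0 \<le> x" "x \<le> 1" "0 \<le> y" "y \<le> B" for x y
    by (rule order_trans[OF mult_left_le_one_le[OF that(3,1,2)] that(4)])
  have absM: "\<bar>M\<bar> = M" using small(4) by simp
  have a: "\<bar>r * P1\<bar> \<le> B" unfolding abs_mult by (rule le1[OF abs_ge_zero small(5) abs_ge_zero bd(1)])
  have rM: "\<bar>r * (M * x)\<bar> \<le> B" if "\<bar>x\<bar> \<le> B" for x
  proof -
    have "\<bar>r * (M * x)\<bar> = (\<bar>r\<bar> * M) * \<bar>x\<bar>" unfolding abs_mult absM by (simp only: mult_ac)
    also have "\<dots> \<le> B" by (rule le1[OF _ small(3) abs_ge_zero that]) (simp add: small(4))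
    finally show ?thesis .
  qed
  have b: "\<bar>r * (r * (M * P2))\<bar> \<le> B"
    unfolding abs_mult[of r "r * (M * P2)"] by (rule le1[OF abs_ge_zero small(5) abs_ge_zero rM[OF bd(2)]])
  have c: "\<bar>(r * g) * P3\<bar> \<le> B" unfolding abs_mult[of "r * g"]
    by (rule le1[OF abs_ge_zero small(1) abs_ge_zero bd(3)])
  have d: "\<bar>h * P3\<bar> \<le> 2 * B" unfolding abs_mult by (rule mult_mono[OF small(2) bd(3)]) simp_all
  have e: "K * \<gamma> \<le> g * G" by (rule mult_mono[OF G(1,4) order_trans[OF G(2,1)] G(3)])
  have sum_up: "2 * y - 13 * B \<le> x1 + x2 + x3 + 4 * x4 + x5 + 2 * x6 + 2 * x7"
    if "\<bar>x1\<bar> \<le> B" "\<bar>x2\<bar> \<le> B" "\<bar>x3\<bar> \<le> B" "\<bar>x4\<bar> \<le> B" "\<bar>x5\<bar> \<le> 2 * B" "\<bar>x6\<bar> \<le> B" "y \<le> x7"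
    for x1 x2 x3 x4 x5 x6 x7 y :: real
    using that B unfolding abs_le_iff by linarith
  have "r * (P1 + (r * (M * P2) + g * P3 + 2 * (M * C1))) + h * P3 + 2 * (C2 + r * (M * C1) + g * G)
    = r * P1 + r * (r * (M * P2)) + (r * g) * P3 + 4 * (r * (M * C1)) + h * P3 + 2 * C2 + 2 * (g * G)"
    by algebra
  moreover note sum_up[OF a b c rM[OF bd(4)] d bd(5) e]
  ultimately show ?thesis by (simp only: mult.assoc)
qed

section \<open>Uniform bounds near the base point\<close>

lemma eventually_bounded_family:
  fixes F :: "('a::real_normed_vector \<Rightarrow> real) set"
  assumes "finite F" "open S" "p \<in> S" "\<And>f. f \<in> F \<Longrightarrow> smooth_on S f"
  obtains B where "1 \<le> B" "\<forall>\<^sub>F z in nhds p. \<forall>f\<in>F. \<bar>f z\<bar> \<le> B"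
proof -
  define B where "B = 1 + (\<Sum>f\<in>F. \<bar>f p\<bar> + 1)"
  have "\<forall>\<^sub>F z in nhds p. \<bar>f z\<bar> \<le> B" if "f \<in> F" for f
  proof -
    have "\<bar>f p\<bar> + 1 \<le> (\<Sum>f\<in>F. \<bar>f p\<bar> + 1)" using that assms(1) by (intro member_le_sum) auto
    moreover have "continuous (at p) f"
      using smooth_on_imp_continuous_on[OF assms(4)[OF that]] assms(2,3)
      by (auto simp: continuous_on_eq_continuous_at)
    then have "\<forall>\<^sub>F z in nhds p. dist (f z) (f p) < 1" by (rule continuous_at_eventually_nhds) simp
    ultimately show ?thesis by (elim eventually_mono) (auto simp: dist_real_def B_def)
  qed
  then have "\<forall>\<^sub>F z in nhds p. \<forall>f\<in>F. \<bar>f z\<bar> \<le> B" by (intro eventually_ball_finite assms(1)) auto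
  moreover have "1 \<le> B" unfolding B_def by (simp add: sum_nonneg)
  ultimately show thesis using that by blast
qed

lemma eventually_small_family:
  fixes F :: "('a::real_normed_vector \<Rightarrow> real) set"
  assumes "finite F" "open S" "p \<in> S" "\<And>f. f \<in> F \<Longrightarrow> smooth_on S f \<and> f p = 0" "\<sigma> > 0"
  shows "\<forall>\<^sub>F z in nhds p. \<forall>f\<in>F. \<bar>f z\<bar> \<le> \<sigma>"
proof (intro eventually_ball_finite assms(1) ballI)
  fix f assume f: "f \<in> F"
  then have "continuous (at p) f"
    using smooth_on_imp_continuous_on[of S f] assms by (auto simp: continuous_on_eq_continuous_at)
  then have "\<forall>\<^sub>F z in nhds p. dist (f z) (f p) < \<sigma>" using assms(5) by (rule continuous_at_eventually_nhds)
  then show "\<forall>\<^sub>F z in nhds p. \<bar>f z\<bar> \<le> \<sigma>"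
    by (rule eventually_mono) (use assms(4)[OF f] in \<open>auto simp: dist_real_def\<close>)
qed

subsection \<open>The modified defining function\<close>

text \<open>The constant field \<open>e\<close>, corrected by a complex multiple of \<open>N\<close> so as to be annihilated by
  $\partial r$.\<close>

definition tangent_field :: "(C2 \<Rightarrow> real) \<Rightarrow> C2 \<Rightarrow> C2 \<Rightarrow> C2 \<Rightarrow> C2" where
  "tangent_field r N e z =
    (let n = (dir N r z)\<^sup>2 + (dir (J N) r z)\<^sup>2 in
      e - ((dir e r z * dir N r z + dir (J e) r z * dir (J N) r z) / n) *\<^sub>R N
        - ((dir e r z * dir (J N) r z - dir (J e) r z * dir N r z) / n) *\<^sub>R J N)"

text \<open>\<open>unit\<close> says that \<open>e\<close> has distance at least 1 from the complex
  line of \<open>N\<close>. Hence \<open>L\<close> has norm at least 1 whatever multiple of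
  \<open>N\<close> is subtracted, and the gain 4 M r^2 |L|^2 is uniform.\<close>

locale framed_boundary_chart = boundary_chart +
  fixes e :: C2
  assumes frame: "\<exists>a b c d. v = a *\<^sub>R e + b *\<^sub>R J e + c *\<^sub>R N + d *\<^sub>R J N"
    and unit: "1 \<le> norm (e - s *\<^sub>R N - t *\<^sub>R J N)"
begin

abbreviation L :: "C2 \<Rightarrow> C2" where "L \<equiv> tangent_field r N e"

lemma norm_sq_pos: "z \<in> S \<Longrightarrow> 0 < (dir N r z)\<^sup>2 + (dir (J N) r z)\<^sup>2"
  using transversal[of z] by (simp add: add_pos_nonneg)

lemma L_cases:
  assumes "z \<in> S"
  obtains s t where "L z = e - s *\<^sub>R N - t *\<^sub>R J N"
    "dir e r z = s * dir N r z + t * dir (J N) r z" "dir (J e) r z = s * dir (J N) r z - t * dir N r z"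
proof -
  define n where "n = (dir N r z)\<^sup>2 + (dir (J N) r z)\<^sup>2"
  have n: "n > 0" using norm_sq_pos[OF assms] by (simp add: n_def)
  let ?s = "(dir e r z * dir N r z + dir (J e) r z * dir (J N) r z) / n"
  let ?t = "(dir e r z * dir (J N) r z - dir (J e) r z * dir N r z) / n"
  show thesis
  proof (rule that)
    show "L z = e - ?s *\<^sub>R N - ?t *\<^sub>R J N" by (simp add: tangent_field_def Let_def n_def)
    have "n * dir e r z = n * (?s * dir N r z + ?t * dir (J N) r z)"
      using n by (simp add: distrib_left) (simp add: n_def power2_eq_square algebra_simps)
    then show "dir e r z = ?s * dir N r z + ?t * dir (J N) r z" using n by simp
    have "n * dir (J e) r z = n * (?s * dir (J N) r z - ?t * dir N r z)"
      using n by (simp add: right_diff_distrib) (simp add: n_def power2_eq_square algebra_simps)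
    then show "dir (J e) r z = ?s * dir (J N) r z - ?t * dir N r z" using n by simp
  qed
qed

lemma smooth_L: "smooth_on S L"
  unfolding tangent_field_def Let_def
  by (intro smooth_on_diff smooth_on_const smooth_on_scaleR smooth_on_divide smooth_on_add smooth_on_mult
      smooth_on_power2 smooth_on_dir open_S smooth_r) (use norm_sq_pos in force)+

lemma smooth_JL: "smooth_on S (\<lambda>z. J (L z))"
  by (rule smooth_on_bounded_linear_comp[OF open_S bounded_linear_J smooth_L])

lemma L_tangential:
  assumes "z \<in> S" shows "dir (L z) r z = 0" "dir (J (L z)) r z = 0" "dir (J (J (L z))) r z = 0"
proof -
  note lin = linear_dir[OF smooth_r assms]
  obtain s t where st: "L z = e - s *\<^sub>R N - t *\<^sub>R J N"
    "dir e r z = s * dir N r z + t * dir (J N) r z" "dir (J e) r z = s * dir (J N) r z - t * dir N r z"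
    using L_cases[OF assms] .
  show z: "dir (L z) r z = 0" "dir (J (L z)) r z = 0"
    unfolding st(1) by (simp_all add: linear_diff[OF lin] linear_add[OF lin] linear_cmul[OF lin] linear_neg[OF lin] st(2,3))
  then show "dir (J (J (L z))) r z = 0" by (simp add: linear_neg[OF lin])
qed

lemma norm_L: "z \<in> S \<Longrightarrow> 1 \<le> norm (L z)"
  using L_cases[of z] unit by metis

lemma L_frame:
  assumes "z \<in> S"
  obtains a b c d where "v = a *\<^sub>R L z + b *\<^sub>R J (L z) + c *\<^sub>R N + d *\<^sub>R J N"
proof -
  obtain s t where st: "L z = e - s *\<^sub>R N - t *\<^sub>R J N" using L_cases[OF assms] by metis
  obtain a b c d where "v = a *\<^sub>R e + b *\<^sub>R J e + c *\<^sub>R N + d *\<^sub>R J N" using frame by blast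
  then have "v = a *\<^sub>R L z + b *\<^sub>R J (L z) + (c + a * s - b * t) *\<^sub>R N + (d + a * t + b * s) *\<^sub>R J N"
    unfolding st by (simp add: algebra_simps)
  then show thesis by (rule that)
qed

text \<open>The components along \<open>N\<close> and \<open>J N\<close> solve a homogeneous 2 by 2
  system whose determinant vanishes nowhere. The norm bound holds because \<open>L z\<close> and
  \<open>J (L z)\<close> are orthogonal of equal length at least 1.\<close>

lemma tangent_vector_cases:
  assumes "z \<in> S" "dir u r z = 0" "dir (J u) r z = 0"
  obtains a b where "u = a *\<^sub>R L z + b *\<^sub>R J (L z)" "a\<^sup>2 + b\<^sup>2 \<le> (norm u)\<^sup>2"
proof -
  note lin = linear_dir[OF smooth_r assms(1)]
  obtain a b c d where u: "u = a *\<^sub>R L z + b *\<^sub>R J (L z) + c *\<^sub>R N + d *\<^sub>R J N"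
    using L_frame[OF assms(1)] .
  have 1: "c * dir N r z + d * dir (J N) r z = 0"
    using assms(2) L_tangential[OF assms(1)] unfolding u
    by (simp add: linear_add[OF lin] linear_cmul[OF lin])
  have 2: "c * dir (J N) r z - d * dir N r z = 0"
    using assms(3) L_tangential[OF assms(1)] unfolding u
    by (simp add: linear_add[OF lin] linear_diff[OF lin] linear_cmul[OF lin] linear_neg[OF lin])
  have "(c\<^sup>2 + d\<^sup>2) * ((dir N r z)\<^sup>2 + (dir (J N) r z)\<^sup>2)
      = (c * dir N r z + d * dir (J N) r z)\<^sup>2 + (c * dir (J N) r z - d * dir N r z)\<^sup>2" by algebra
  also have "\<dots> = 0" using 1 2 by simp
  finally have "c\<^sup>2 + d\<^sup>2 = 0" using norm_sq_pos[OF assms(1)] by auto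
  then have cd: "c = 0" "d = 0" by (auto simp: sum_power2_eq_zero_iff)
  have orth: "v \<bullet> J v = 0" for v
    by (simp add: inner_vec_def sum_2 J_def inner_complex_def)
  have "(norm u)\<^sup>2 = (a\<^sup>2 + b\<^sup>2) * (norm (L z))\<^sup>2"
    unfolding u cd power2_norm_eq_inner
    using orth[of "L z"] power2_norm_eq_inner[of "J (L z)"] power2_norm_eq_inner[of "L z"]
    by (simp add: inner_add_left inner_add_right inner_commute[of "J (L z)" "L z"] power2_eq_square algebra_simps)
  moreover have "(a\<^sup>2 + b\<^sup>2) * 1 \<le> (a\<^sup>2 + b\<^sup>2) * (norm (L z))\<^sup>2"
    using norm_L[OF assms(1)] by (intro mult_left_mono) (auto simp: one_le_power)
  ultimately show thesis using that[of a b] u cd by simp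
qed

end

text \<open>Finite type enters only through the properties of \<open>X\<close>. Its nondegeneracy is
  demanded on all of \<open>S\<close>, so that the quotient defining \<open>coeff\<close> is smooth
  there.\<close>

locale psh_boundary_chart = framed_boundary_chart +
  fixes X :: "C2 \<Rightarrow> real" and \<epsilon>X KX :: real
  assumes psh: "\<And>w v. w \<in> frontier \<Omega> \<inter> S \<Longrightarrow> 0 \<le> levi r v v w"
    and smooth_X: "smooth_on S X" and X_p: "X p = 0"
    and X_nondegenerate: "\<And>z. z \<in> S \<Longrightarrow> 0 < (dir (tangent_field r N e z) X z)\<^sup>2 + (dir (J (tangent_field r N e z)) X z)\<^sup>2"
    and \<epsilon>X: "0 < \<epsilon>X"
    and X_bound: "\<And>w. w \<in> frontier \<Omega> \<inter> ball p \<epsilon>X \<Longrightarrow> (X w)\<^sup>2 \<le> KX * levi r (tangent_field r N e w) (tangent_field r N e w) w"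
begin

definition lam :: "C2 \<Rightarrow> real" where "lam z = levi r (L z) (L z) z"
definition slope :: "C2 \<Rightarrow> real" where "slope z = dir N lam z / dir N r z"
definition coeff :: "C2 \<Rightarrow> real" where
  "coeff z = - slope z / (2 * ((dir (L z) X z)\<^sup>2 + (dir (J (L z)) X z)\<^sup>2))"
definition \<phi> :: "C2 \<Rightarrow> real" where "\<phi> z = coeff z * (X z * X z)"
definition q :: "C2 \<Rightarrow> real" where "q z = (z - p) \<bullet> (z - p)"
definition g :: "real \<Rightarrow> real \<Rightarrow> C2 \<Rightarrow> real" where "g K M z = K + M * q z"
definition h :: "real \<Rightarrow> real \<Rightarrow> C2 \<Rightarrow> real" where "h K M z = (1 + \<phi> z) + r z * g K M z"
definition \<rho> :: "real \<Rightarrow> real \<Rightarrow> C2 \<Rightarrow> real" where "\<rho> K M z = r z * h K M z"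
text \<open>What multiplies \<open>X\<close> in the tangential Levi form of \<open>\<phi>\<close>
  once the square of the gradient of \<open>X\<close> is split off.\<close>

definition rest :: "C2 \<Rightarrow> real" where
  "rest z = 2 * coeff z * levi X (L z) (L z) z + X z * levi coeff (L z) (L z) z + 4 * crossd coeff X (L z) (L z) z"
text \<open>The gradient of \<open>\<phi>\<close> with its factor \<open>X\<close> removed; this
  factor is what keeps the mixed entries of size sqrt \<Lambda>.\<close>

definition dphi :: "C2 \<Rightarrow> C2 \<Rightarrow> real" where
  "dphi v z = 2 * coeff z * dir v X z + X z * dir v coeff z"

lemmas smooth_intros = smooth_on_add[OF open_S] smooth_on_mult[OF open_S] smooth_on_diff[OF open_S]
  smooth_on_const smooth_on_power2[OF open_S] smooth_on_minus[OF open_S] smooth_r smooth_X smooth_L smooth_JL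
  smooth_on_levi[OF open_S] smooth_on_dir_field[OF open_S]

lemma smooth_lam: "smooth_on S lam"
  unfolding lam_def by (intro smooth_intros)

lemma smooth_slope: "smooth_on S slope"
  unfolding slope_def
  by (intro smooth_on_divide open_S smooth_on_dir smooth_lam smooth_r) (use transversal in force)

lemma smooth_coeff: "smooth_on S coeff"
  unfolding coeff_def
  by (intro smooth_on_divide open_S smooth_intros smooth_slope) (use X_nondegenerate in force)

lemma smooth_q: "smooth_on S q"
  unfolding q_def by (intro smooth_on_inner open_S smooth_intros smooth_on_ident)

lemma smooth_g: "smooth_on S (g K M)"
  unfolding g_def by (intro smooth_intros smooth_q)

lemma smooth_phi: "smooth_on S \<phi>"
  unfolding \<phi>_def by (intro smooth_intros smooth_coeff)

lemma smooth_h: "smooth_on S (h K M)"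
  unfolding h_def by (intro smooth_intros smooth_phi smooth_g)

lemma smooth_rho: "smooth_on S (\<rho> K M)"
  unfolding \<rho>_def by (intro smooth_intros smooth_h)

lemma dir_q: "dir v q = (\<lambda>z. 2 * ((z - p) \<bullet> v))"
proof
  fix z
  have "(q has_derivative (\<lambda>v. (z - p) \<bullet> v + v \<bullet> (z - p))) (at z)"
    unfolding q_def by (auto intro!: derivative_eq_intros)
  then show "dir v q z = 2 * ((z - p) \<bullet> v)" using dir_eqI by (fastforce simp: inner_commute)
qed

lemma levi_q: "levi q u u z = 4 * (norm u)\<^sup>2"
proof -
  have "dir u (dir v q) z = 2 * (u \<bullet> v)" for u v
    unfolding dir_q by (rule dir_eqI) (auto intro!: derivative_eq_intros)
  then show ?thesis by (simp add: levi_def flip: power2_norm_eq_inner)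
qed

context
  fixes z assumes z: "z \<in> S"
begin

lemma dir_phi: "dir v \<phi> z = X z * dphi v z"
  unfolding \<phi>_def dphi_def
  using dir_mult[OF smooth_coeff smooth_on_mult[OF open_S smooth_X smooth_X] z] dir_mult[OF smooth_X smooth_X z]
  by (simp add: algebra_simps)

lemma dir_g: "dir v (g K M) z = M * dir v q z"
proof -
  have s: "smooth_on S (\<lambda>x. M * q x)" by (intro smooth_intros smooth_q)
  show ?thesis unfolding g_def dir_add[OF smooth_on_const s z] dir_mult[OF smooth_on_const smooth_q z] by simp
qed

lemma levi_g: "levi (g K M) u v z = M * levi q u v z"
proof -
  have s: "smooth_on S (\<lambda>x. M * q x)" by (intro smooth_intros smooth_q)
  show ?thesis unfolding g_def levi_add_fun[OF open_S smooth_on_const s z]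
      levi_mult_fun[OF open_S smooth_on_const smooth_q z] by (simp add: levi_const_fun crossd_def)
qed

lemma dir_h: "dir v (h K M) z = X z * dphi v z + (r z * (M * dir v q z) + dir v r z * g K M z)"
proof -
  have s1: "smooth_on S (\<lambda>x. 1 + \<phi> x)" and s2: "smooth_on S (\<lambda>x. r x * g K M x)"
    by (intro smooth_intros smooth_phi smooth_g)+
  show ?thesis unfolding h_def dir_add[OF s1 s2 z] dir_add[OF smooth_on_const smooth_phi z]
      dir_mult[OF smooth_r smooth_g z] dir_phi dir_g by simp
qed

lemma levi_h: "levi (h K M) u v z = levi \<phi> u v z
    + (r z * (M * levi q u v z) + g K M z * levi r u v z + M * crossd r q u v z + M * crossd r q v u z)"
proof -
  have s1: "smooth_on S (\<lambda>x. 1 + \<phi> x)" and s2: "smooth_on S (\<lambda>x. r x * g K M x)"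
    by (intro smooth_intros smooth_phi smooth_g)+
  have "crossd r (g K M) u v z = M * crossd r q u v z" for u v
    unfolding crossd_def by (simp add: dir_g algebra_simps)
  then show ?thesis unfolding h_def levi_add_fun[OF open_S s1 s2 z]
      levi_add_fun[OF open_S smooth_on_const smooth_phi z] levi_mult_fun[OF open_S smooth_r smooth_g z] levi_g
    by (simp add: levi_const_fun)
qed

lemma levi_rho: "levi (\<rho> K M) u v z = r z * levi (h K M) u v z + h K M z * levi r u v z
    + crossd r (h K M) u v z + crossd r (h K M) v u z"
  unfolding \<rho>_def by (rule levi_mult_fun[OF open_S smooth_r smooth_h z])

text \<open>The coefficient of \<open>\<phi>\<close> is chosen so that the tangential Levi form of \<open>\<phi>\<close> cancels the
  normal derivative of \<open>lam\<close> up to a multiple of \<open>X\<close>.\<close>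

lemma levi_phi: "levi \<phi> (L z) (L z) z = - slope z + X z * rest z"
proof -
  have "levi \<phi> (L z) (L z) z = coeff z * (2 * (X z * levi X (L z) (L z) z) + 2 * crossd X X (L z) (L z) z)
      + X z * X z * levi coeff (L z) (L z) z + 2 * crossd coeff (\<lambda>x. X x * X x) (L z) (L z) z"
    unfolding \<phi>_def
    using levi_mult_fun[OF open_S smooth_coeff smooth_on_mult[OF open_S smooth_X smooth_X] z]
      levi_mult_fun[OF open_S smooth_X smooth_X z] by simp
  moreover have "crossd coeff (\<lambda>x. X x * X x) (L z) (L z) z = 2 * X z * crossd coeff X (L z) (L z) z"
    unfolding crossd_def by (simp add: dir_mult[OF smooth_X smooth_X z] algebra_simps)
  moreover have "coeff z * (2 * crossd X X (L z) (L z) z) = - slope z"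
    using X_nondegenerate[OF z] by (simp add: coeff_def crossd_def power2_eq_square)
  ultimately show ?thesis unfolding rest_def by (simp add: algebra_simps)
qed

text \<open>All cross terms drop out, because \<open>L\<close> and \<open>J L\<close> annihilate
  \<open>r\<close> off the boundary too. Hence \<open>K\<close> appears only in front of
  \<open>lam\<close>, and the positive r^2 term comes from the Hessian of \<open>q\<close>.\<close>

lemma levi_rho_tangential:
  "levi (\<rho> K M) (L z) (L z) z = (1 + coeff z * (X z)\<^sup>2 + 2 * (r z * (K + M * q z))) * lam z
    - r z * slope z + r z * (X z * rest z) + 4 * M * (r z)\<^sup>2 * (norm (L z))\<^sup>2"
proof -
  have "crossd r f (L z) (L z) z = 0" for f unfolding crossd_def by (simp add: L_tangential[OF z])
  then have "levi (\<rho> K M) (L z) (L z) z = r z * (- slope z + X z * rest z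
      + (r z * (M * (4 * (norm (L z))\<^sup>2)) + g K M z * lam z)) + h K M z * lam z"
    unfolding levi_rho levi_h levi_phi by (simp add: lam_def levi_q)
  also have "\<dots> = (1 + coeff z * (X z)\<^sup>2 + 2 * (r z * (K + M * q z))) * lam z
    - r z * slope z + r z * (X z * rest z) + 4 * M * (r z)\<^sup>2 * (norm (L z))\<^sup>2"
    unfolding h_def g_def \<phi>_def by algebra
  finally show ?thesis .
qed

lemma levi_rho_mixed:
  assumes "dir u r z = 0" "dir (J u) r z = 0"
  shows "levi (\<rho> K M) u N z =
    r z * (levi \<phi> u N z + (r z * (M * levi q u N z) + g K M z * levi r u N z
        + M * (dir N r z * dir u q z + dir (J N) r z * dir (J u) q z)))
    + h K M z * levi r u N z
    + (dir N r z * (X z * dphi u z + r z * (M * dir u q z)) + dir (J N) r z * (X z * dphi (J u) z + r z * (M * dir (J u) q z)))"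
  unfolding levi_rho levi_h crossd_def dir_h using assms by (simp add: algebra_simps)

text \<open>The last product, with \<open>g\<close> at least \<open>K\<close>, comes from the square
  of the normal derivative of \<open>r\<close> in the Hessian of g r^2.\<close>

lemma levi_rho_normal:
  "levi (\<rho> K M) N N z =
    r z * (levi \<phi> N N z + (r z * (M * levi q N N z) + g K M z * levi r N N z + 2 * (M * crossd r q N N z)))
    + h K M z * levi r N N z
    + 2 * (crossd r \<phi> N N z + r z * (M * crossd r q N N z) + g K M z * ((dir N r z)\<^sup>2 + (dir (J N) r z)\<^sup>2))"
  unfolding levi_rho levi_h crossd_def dir_h dir_phi by (simp add: algebra_simps power2_eq_square)

end

text \<open>Cauchy-Schwarz for the nonnegative form at a boundary point, read off from the
  polynomial x \<mapsto> \<open>levi r\<close> at u + x N.\<close>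

lemma mixed_levi_bound:
  assumes w: "w \<in> frontier \<Omega> \<inter> S"
  shows "(levi r u N w)\<^sup>2 \<le> levi r u u w * levi r N N w"
proof -
  have wS: "w \<in> S" using w by blast
  let ?A = "levi r u u w" and ?B = "levi r N N w" and ?b = "levi r u N w"
  have poly: "0 \<le> ?A + 2 * x * ?b + x\<^sup>2 * ?B" for x
  proof -
    have "levi r (u + x *\<^sub>R N) (u + x *\<^sub>R N) w = ?A + 2 * x * ?b + x\<^sup>2 * ?B"
      using levi_commute[OF open_S smooth_r wS, of N u]
      by (simp add: levi_add_left[OF open_S smooth_r wS] levi_add_right[OF open_S smooth_r wS]
          levi_scaleR_left[OF open_S smooth_r wS] levi_scaleR_right[OF open_S smooth_r wS] power2_eq_square algebra_simps)
    then show ?thesis using psh[OF w] by metis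
  qed
  show ?thesis
  proof (cases "?B = 0")
    case True
    have "?b = 0"
    proof (rule ccontr)
      assume "?b \<noteq> 0"
      \<comment> \<open>Without quadratic term the polynomial is affine in x; this x gives it the
        value -1.\<close>
      then have "0 \<le> ?A + 2 * (- (?A + 1) / (2 * ?b)) * ?b" using poly[of "- (?A + 1) / (2 * ?b)"] True by simp
      also have "\<dots> = -1" using \<open>?b \<noteq> 0\<close> by (simp add: field_simps)
      finally show False by simp
    qed
    then show ?thesis using True by simp
  next
    case False
    then have B: "?B > 0" using psh[OF w, of N] by simp
    have "0 \<le> ?A + 2 * (- ?b / ?B) * ?b + (- ?b / ?B)\<^sup>2 * ?B" by (rule poly)
    also have "\<dots> = ?A - ?b\<^sup>2 / ?B" using B by (simp add: field_simps power2_eq_square)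
    finally show ?thesis using B by (simp add: field_simps)
  qed
qed

end

lemma abs_le_mult_sqrt:
  assumes "x\<^sup>2 \<le> B * \<Lambda>" "1 \<le> B" "0 \<le> \<Lambda>"
  shows "\<bar>x\<bar> \<le> B * sqrt \<Lambda>"
proof -
  have "B * \<Lambda> \<le> B\<^sup>2 * \<Lambda>" using assms by (intro mult_right_mono) (auto simp: power2_eq_square)
  then have "sqrt (x\<^sup>2) \<le> sqrt (B\<^sup>2 * \<Lambda>)" using assms(1) by (intro real_sqrt_le_mono) simp
  then show ?thesis using assms(2) by (simp add: real_sqrt_mult)
qed

context psh_boundary_chart
begin

text \<open>\<open>K\<close> makes the normal entry at least 2 K \<gamma> - 13 B = 676 B^6. The two
  mixed entries have squares at most 169 B^6 \<Lambda> each, and their sum equals \<Lambda>/2 times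
  676 B^6. \<open>M\<close> is the least value that \<open>tangential_estimate\<close>
  admits.\<close>

lemma levi_rho_nonneg:
  assumes z: "z \<in> S" and B: "1 \<le> B" and \<gamma>: "0 < \<gamma>" "\<gamma> \<le> (dir N r z)\<^sup>2 + (dir (J N) r z)\<^sup>2"
  defines "K \<equiv> (13 * B + 676 * B ^ 6) / (2 * \<gamma>)"
  defines "M \<equiv> 2 * K * B + 2 * B + 2 * B ^ 3"
  assumes \<sigma>: "0 < \<sigma>" "16 * \<sigma> * (B ^ 3 + K + M + 1) \<le> 1"
    and small: "\<forall>f\<in>{r, X, q, \<lambda>z. dir (L z) q z, \<lambda>z. dir (J (L z)) q z, \<lambda>z. dir (J (J (L z))) q z}. \<bar>f z\<bar> \<le> \<sigma>"
    and bd: "\<forall>f\<in>{coeff, slope, rest, \<lambda>z. C0, dir N r, dir (J N) r, \<lambda>z. levi \<phi> N N z, \<lambda>z. levi q N N z,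
        \<lambda>z. levi r N N z, \<lambda>z. crossd r q N N z, \<lambda>z. crossd r \<phi> N N z,
        \<lambda>z. levi \<phi> (L z) N z, \<lambda>z. levi \<phi> (J (L z)) N z, \<lambda>z. levi q (L z) N z, \<lambda>z. levi q (J (L z)) N z,
        \<lambda>z. dphi (L z) z, \<lambda>z. dphi (J (L z)) z, \<lambda>z. dphi (J (J (L z))) z}. \<bar>f z\<bar> \<le> B"
    and \<Lambda>: "\<Lambda> = lam z - r z * slope z + C0 * (r z)\<^sup>2" "(r z)\<^sup>2 \<le> \<Lambda>"
    and dom: "(X z)\<^sup>2 \<le> B * \<Lambda>" "(levi r (L z) N z)\<^sup>2 \<le> B * \<Lambda>" "(levi r (J (L z)) N z)\<^sup>2 \<le> B * \<Lambda>"
  shows "0 \<le> levi (\<rho> K M) v v z" and "0 < h K M z"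
proof -
  have \<Lambda>0: "0 \<le> \<Lambda>" using order_trans[OF zero_le_power2 \<Lambda>(2)] .
  have K: "0 \<le> K" unfolding K_def using B \<gamma> by simp
  have M: "0 \<le> M" unfolding M_def using K B by simp
  have q0: "0 \<le> q z" by (simp add: q_def)
  have sm: "\<bar>r z\<bar> \<le> \<sigma>" "\<bar>X z\<bar> \<le> \<sigma>" "\<bar>q z\<bar> \<le> \<sigma>" "\<bar>dir (L z) q z\<bar> \<le> \<sigma>" "\<bar>dir (J (L z)) q z\<bar> \<le> \<sigma>" "\<bar>dir (J (J (L z))) q z\<bar> \<le> \<sigma>"
    using small by simp_all
  have q\<sigma>: "q z \<le> \<sigma>" using sm(3) by linarith
  have b1: "\<bar>coeff z\<bar> \<le> B" "\<bar>slope z\<bar> \<le> B" "\<bar>rest z\<bar> \<le> B" "\<bar>C0\<bar> \<le> B" "\<bar>dir N r z\<bar> \<le> B" "\<bar>dir (J N) r z\<bar> \<le> B"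
    "\<bar>levi \<phi> N N z\<bar> \<le> B" "\<bar>levi q N N z\<bar> \<le> B" "\<bar>levi r N N z\<bar> \<le> B" "\<bar>crossd r q N N z\<bar> \<le> B" "\<bar>crossd r \<phi> N N z\<bar> \<le> B"
    and b2: "\<bar>levi \<phi> (L z) N z\<bar> \<le> B" "\<bar>levi \<phi> (J (L z)) N z\<bar> \<le> B" "\<bar>levi q (L z) N z\<bar> \<le> B"
      "\<bar>levi q (J (L z)) N z\<bar> \<le> B" "\<bar>dphi (L z) z\<bar> \<le> B" "\<bar>dphi (J (L z)) z\<bar> \<le> B" "\<bar>dphi (J (J (L z))) z\<bar> \<le> B"
    using bd by simp_all
  have l: "1 \<le> (norm (L z))\<^sup>2" using norm_L[OF z] by (rule one_le_power)
  note tang = tangential_estimate[OF B K eq_refl[OF M_def[THEN meta_eq_to_obj_eq, symmetric]] \<sigma> sm(1,2) q0 q\<sigma>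
      b1(1-4) dom(1) \<Lambda>0 l]
  have lam: "\<Lambda> + r z * slope z - C0 * (r z)\<^sup>2 = lam z" using \<Lambda>(1) by simp
  have LL: "\<Lambda> / 2 \<le> levi (\<rho> K M) (L z) (L z) z"
    unfolding levi_rho_tangential[OF z] using tang(1) unfolding lam .
  have hz: "h K M z = 1 + coeff z * (X z)\<^sup>2 + r z * (K + M * q z)"
    unfolding h_def \<phi>_def g_def by (simp add: power2_eq_square)
  have "\<bar>h K M z - 1\<bar> \<le> 1 / 8"
    unfolding hz using abs_triangle_ineq[of "coeff z * (X z)\<^sup>2" "r z * (K + M * q z)"] tang(2,3) by simp
  then have h: "0 < h K M z" "\<bar>h K M z\<bar> \<le> 2" by linarith+
  show "0 < h K M z" by (rule h)
  have rg: "\<bar>r z * g K M z\<bar> \<le> 1" using tang(3) unfolding g_def by linarith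
  have D: "\<bar>x\<bar> * M \<le> 1" if "\<bar>x\<bar> \<le> \<sigma>" for x
    using mult_right_mono[OF that M] tang(4) by (simp add: mult.commute)
  have r1: "\<bar>r z\<bar> \<le> 1" using sm(1) tang(5) by linarith
  have T: "\<bar>r z\<bar> \<le> sqrt \<Lambda>" using real_sqrt_le_mono[OF \<Lambda>(2)] by simp
  note T' = abs_le_mult_sqrt[OF _ B \<Lambda>0]
  have mix: "\<bar>levi (\<rho> K M) u N z\<bar> \<le> 13 * B ^ 3 * sqrt \<Lambda>"
    if u: "dir u r z = 0" "dir (J u) r z = 0" "(levi r u N z)\<^sup>2 \<le> B * \<Lambda>" "\<bar>dir u q z\<bar> \<le> \<sigma>" "\<bar>dir (J u) q z\<bar> \<le> \<sigma>"
      "\<bar>levi \<phi> u N z\<bar> \<le> B" "\<bar>levi q u N z\<bar> \<le> B" "\<bar>dphi u z\<bar> \<le> B" "\<bar>dphi (J u) z\<bar> \<le> B" for u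
    unfolding levi_rho_mixed[OF z u(1,2)]
    by (rule mixed_estimate[OF B T T'[OF u(3)] T'[OF dom(1)] rg h(2) D[OF sm(1)] M D[OF u(4)] D[OF u(5)] u(6-9) b1(5,6)])
  note mixL = mix[OF L_tangential(1,2)[OF z] dom(2) sm(4,5) b2(1,3,5,6)]
  \<comment> \<open>For u = J L the vector J u is J (J L), which explains the doubly rotated field
    in the lists of bounded and small functions.\<close>
  note mixJL = mix[OF L_tangential(2,3)[OF z] dom(3) sm(5,6) b2(2,4,6,7)]
  have "2 * K * \<gamma> - 13 * B \<le> levi (\<rho> K M) N N z"
    unfolding levi_rho_normal[OF z]
    by (rule normal_estimate[OF B rg h(2) D[OF sm(1)] M r1 b1(7,8,9,10,11) _ K _ \<gamma>(2)])
      (use \<gamma>(1) M q0 in \<open>auto simp: g_def\<close>)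
  moreover have "2 * K * \<gamma> - 13 * B = 676 * B ^ 6" unfolding K_def using \<gamma>(1) by (simp add: field_simps)
  ultimately have NN: "676 * B ^ 6 \<le> levi (\<rho> K M) N N z" by simp
  have sq: "x\<^sup>2 \<le> 169 * B ^ 6 * \<Lambda>" if "\<bar>x\<bar> \<le> 13 * B ^ 3 * sqrt \<Lambda>" for x
  proof -
    have "x\<^sup>2 \<le> (13 * B ^ 3 * sqrt \<Lambda>)\<^sup>2" using power_mono[OF that abs_ge_zero, of 2] by simp
    also have "\<dots> = 169 * B ^ 6 * \<Lambda>" using \<Lambda>0 by (simp add: power_mult_distrib flip: power_mult)
    finally show ?thesis .
  qed
  obtain a b c d where v: "v = a *\<^sub>R L z + b *\<^sub>R J (L z) + c *\<^sub>R N + d *\<^sub>R J N" using L_frame[OF z] .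
  show "0 \<le> levi (\<rho> K M) v v z"
    unfolding v levi_frame[OF open_S smooth_rho z]
  proof (rule nonneg_hermitian_form)
    show "0 \<le> levi (\<rho> K M) (L z) (L z) z" using LL \<Lambda>0 by linarith
    show "0 \<le> levi (\<rho> K M) N N z" using NN B by (smt (verit) zero_le_power)
    have "(levi (\<rho> K M) (L z) N z)\<^sup>2 + (levi (\<rho> K M) (J (L z)) N z)\<^sup>2 \<le> 169 * B ^ 6 * \<Lambda> + 169 * B ^ 6 * \<Lambda>"
      by (rule add_mono[OF sq[OF mixL] sq[OF mixJL]])
    also have "\<dots> = (\<Lambda> / 2) * (676 * B ^ 6)" by simp
    also have "\<dots> \<le> levi (\<rho> K M) (L z) (L z) z * levi (\<rho> K M) N N z"
      using LL NN \<Lambda>0 B by (intro mult_mono) auto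
    finally show "(levi (\<rho> K M) (L z) N z)\<^sup>2 + (levi (\<rho> K M) (J (L z)) N z)\<^sup>2
        \<le> levi (\<rho> K M) (L z) (L z) z * levi (\<rho> K M) N N z" .
  qed
qed

text \<open>The constants are chosen in the order \<open>C0\<close>, the domination constants,
  \<open>B\<close>, \<gamma>, \<open>K\<close>, \<open>M\<close>, \<sigma>, and the radius last;
  each depends only on earlier ones.\<close>

lemma plurisubharmonic_modification:
  obtains U \<rho>' where "local_defining_function \<Omega> p U \<rho>'" "\<And>z v. z \<in> U \<Longrightarrow> 0 \<le> levi \<rho>' v v z" "U \<subseteq> S"
proof -
  have lam_nonneg: "0 \<le> lam w" if "w \<in> frontier \<Omega> \<inter> S" for w
    using psh[OF that] by (simp add: lam_def)
  obtain C0 d1 where maj: "d1 > 0" "ball p d1 \<subseteq> S"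
    "\<And>z. z \<in> ball p d1 \<Longrightarrow> (r z)\<^sup>2 \<le> lam z - r z * (dir N lam z / dir N r z) + C0 * (r z)\<^sup>2"
    "\<And>f K \<epsilon>. smooth_on S f \<Longrightarrow> \<epsilon> > 0 \<Longrightarrow> (\<And>w. w \<in> frontier \<Omega> \<inter> ball p \<epsilon> \<Longrightarrow> (f w)\<^sup>2 \<le> K * lam w) \<Longrightarrow>
      \<exists>C>0. \<exists>\<delta>>0. \<forall>z\<in>ball p \<delta>. (f z)\<^sup>2 \<le> C * (lam z - r z * (dir N lam z / dir N r z) + C0 * (r z)\<^sup>2)"
    using boundary_majorant[OF smooth_lam lam_nonneg] by metis
  define \<Lambda> where "\<Lambda> z = lam z - r z * slope z + C0 * (r z)\<^sup>2" for z
  have maj1: "(r z)\<^sup>2 \<le> \<Lambda> z" if "z \<in> ball p d1" for z using maj(3)[OF that] by (simp add: \<Lambda>_def slope_def)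
  have maj2: "\<exists>C>0. \<forall>\<^sub>F z in nhds p. (f z)\<^sup>2 \<le> C * \<Lambda> z"
    if f: "smooth_on S f" "\<epsilon> > 0" "\<And>w. w \<in> frontier \<Omega> \<inter> ball p \<epsilon> \<Longrightarrow> (f w)\<^sup>2 \<le> K * lam w" for f K \<epsilon>
  proof -
    obtain C \<delta> where "C > 0" "\<delta> > 0" "\<forall>z\<in>ball p \<delta>. (f z)\<^sup>2 \<le> C * \<Lambda> z"
      using maj(4)[OF f] unfolding \<Lambda>_def slope_def by blast
    then show ?thesis unfolding eventually_nhds_metric by (intro exI[of _ C]) (auto simp: dist_commute)
  qed
  obtain CX where CX: "\<forall>\<^sub>F z in nhds p. (X z)\<^sup>2 \<le> CX * \<Lambda> z"
    using maj2[OF smooth_X \<epsilon>X, of KX] X_bound unfolding lam_def by blast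
  have mixed: "\<exists>C>0. \<forall>\<^sub>F z in nhds p. (levi r (V z) N z)\<^sup>2 \<le> C * \<Lambda> z"
    if V: "smooth_on S V" "\<And>z. z \<in> S \<Longrightarrow> levi r (V z) (V z) z = lam z" for V
  proof -
    have sN: "smooth_on S (\<lambda>z. levi r N N z)" by (intro smooth_intros)
    obtain B where B: "1 \<le> B" "\<forall>\<^sub>F z in nhds p. \<forall>f\<in>{\<lambda>z. levi r N N z}. \<bar>f z\<bar> \<le> B"
      using eventually_bounded_family[of "{\<lambda>z. levi r N N z}" S p] open_S p_in_S sN by blast
    then obtain e where e: "e > 0" "\<And>z. dist z p < e \<Longrightarrow> \<bar>levi r N N z\<bar> \<le> B"
      unfolding eventually_nhds_metric by auto
    have "(levi r (V w) N w)\<^sup>2 \<le> B * lam w" if w: "w \<in> frontier \<Omega> \<inter> ball p (min e d1)" for w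
    proof -
      have wS: "w \<in> frontier \<Omega> \<inter> S" using w maj(2) by auto
      have "(levi r (V w) N w)\<^sup>2 \<le> lam w * levi r N N w"
        using mixed_levi_bound[OF wS, of "V w"] V(2) wS by simp
      also have "\<dots> \<le> lam w * B"
        using e(2)[of w] w lam_nonneg[OF wS] by (intro mult_left_mono) (auto simp: dist_commute)
      finally show ?thesis by (simp add: mult.commute)
    qed
    moreover have "smooth_on S (\<lambda>z. levi r (V z) N z)" by (intro smooth_intros V)
    ultimately show ?thesis using maj2[of "\<lambda>z. levi r (V z) N z" "min e d1" B] e(1) maj(1) by simp
  qed
  obtain C1 where C1: "\<forall>\<^sub>F z in nhds p. (levi r (L z) N z)\<^sup>2 \<le> C1 * \<Lambda> z"
    using mixed[OF smooth_L] by (auto simp: lam_def)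
  obtain C2 where C2: "\<forall>\<^sub>F z in nhds p. (levi r (J (L z)) N z)\<^sup>2 \<le> C2 * \<Lambda> z"
    using mixed[OF smooth_JL] levi_J_J[OF open_S smooth_r] by (auto simp: lam_def)
  \<comment> \<open>No member involves \<open>K\<close> or \<open>M\<close>, so their common bound
    can precede both.\<close>
  define F where "F = {coeff, slope, rest, \<lambda>z. C0, dir N r, dir (J N) r, \<lambda>z. levi \<phi> N N z, \<lambda>z. levi q N N z,
        \<lambda>z. levi r N N z, \<lambda>z. crossd r q N N z, \<lambda>z. crossd r \<phi> N N z,
        \<lambda>z. levi \<phi> (L z) N z, \<lambda>z. levi \<phi> (J (L z)) N z, \<lambda>z. levi q (L z) N z, \<lambda>z. levi q (J (L z)) N z,
        \<lambda>z. dphi (L z) z, \<lambda>z. dphi (J (L z)) z, \<lambda>z. dphi (J (J (L z))) z}"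
  have smooth_JJL: "smooth_on S (\<lambda>z. J (J (L z)))"
    by (rule smooth_on_bounded_linear_comp[OF open_S bounded_linear_J smooth_JL])
  note si = smooth_intros smooth_JJL smooth_coeff smooth_slope smooth_phi smooth_q smooth_on_dir
  have "smooth_on S f" if "f \<in> F" for f
    using that unfolding F_def rest_def[abs_def] crossd_def dphi_def
    by (elim insertE emptyE) (hypsubst, (intro si | simp only: rest_def[abs_def] crossd_def, intro si))+
  then obtain B0 where B0: "1 \<le> B0" "\<forall>\<^sub>F z in nhds p. \<forall>f\<in>F. \<bar>f z\<bar> \<le> B0"
    using eventually_bounded_family[of F S p] open_S p_in_S unfolding F_def by blast
  define B where "B = B0 + \<bar>CX\<bar> + \<bar>C1\<bar> + \<bar>C2\<bar>"
  have B: "1 \<le> B" "B0 \<le> B" "CX \<le> B" "C1 \<le> B" "C2 \<le> B" using B0(1) by (auto simp: B_def)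
  define \<gamma> where "\<gamma> = (dir N r p / 2)\<^sup>2"
  have \<gamma>: "0 < \<gamma>" using transversal[OF p_in_S] by (simp add: \<gamma>_def)
  define K where "K = (13 * B + 676 * B ^ 6) / (2 * \<gamma>)"
  define M where "M = 2 * K * B + 2 * B + 2 * B ^ 3"
  define \<sigma> where "\<sigma> = 1 / (16 * (B ^ 3 + K + M + 1))"
  have KM: "0 \<le> K" "0 \<le> M" using B(1) \<gamma> by (auto simp: K_def M_def)
  have "0 < B ^ 3 + K + M + 1" using B(1) KM by (smt (verit) zero_le_power)
  then have \<sigma>: "0 < \<sigma>" "16 * \<sigma> * (B ^ 3 + K + M + 1) \<le> 1" by (auto simp: \<sigma>_def)
  define G where "G = {r, X, q, \<lambda>z. dir (L z) q z, \<lambda>z. dir (J (L z)) q z, \<lambda>z. dir (J (J (L z))) q z}"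
  have "smooth_on S f \<and> f p = 0" if "f \<in> G" for f
  proof
    show "smooth_on S f" using that unfolding G_def by (elim insertE emptyE) (hypsubst, intro si)+
    show "f p = 0" using that r_zero[OF p_frontier p_in_S] X_p unfolding G_def
      by (auto simp: dir_q[THEN fun_cong] q_def simp del: J_simps)
  qed
  then have E1: "\<forall>\<^sub>F z in nhds p. \<forall>f\<in>G. \<bar>f z\<bar> \<le> \<sigma>"
    using eventually_small_family[of G S p \<sigma>] open_S p_in_S \<sigma>(1) unfolding G_def by blast
  have E2: "\<forall>\<^sub>F z in nhds p. \<gamma> \<le> (dir N r z)\<^sup>2 + (dir (J N) r z)\<^sup>2"
  proof -
    have "continuous (at p) (dir N r)"
      using open_S p_in_S smooth_on_imp_continuous_on[OF smooth_on_dir[OF smooth_r]]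
      by (auto simp: continuous_on_eq_continuous_at)
    then have "\<forall>\<^sub>F z in nhds p. dist (dir N r z) (dir N r p) < dir N r p / 2"
      by (rule continuous_at_eventually_nhds) (use transversal[OF p_in_S] in simp)
    then show ?thesis
    proof eventually_elim
      case (elim z)
      then have "dir N r p / 2 \<le> dir N r z" unfolding dist_real_def by (smt (verit) field_sum_of_halves)
      then have "\<gamma> \<le> (dir N r z)\<^sup>2" unfolding \<gamma>_def using transversal[OF p_in_S] by (intro power_mono) auto
      then show ?case by (simp add: add_increasing2)
    qed
  qed
  have E3: "\<forall>\<^sub>F z in nhds p. z \<in> ball p d1"
    using maj(1) eventually_nhds[of _ p] by (metis centre_in_ball open_ball)
  have "\<forall>\<^sub>F z in nhds p. z \<in> S \<and> (\<forall>v. 0 \<le> levi (\<rho> K M) v v z) \<and> 0 < h K M z"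
    using CX C1 C2 B0(2) E1 E2 E3
  proof eventually_elim
    case (elim z)
    have z: "z \<in> S" using elim(7) maj(2) by blast
    have L0: "0 \<le> \<Lambda> z" using order_trans[OF zero_le_power2 maj1[OF elim(7)]] .
    have up: "x \<le> B * \<Lambda> z" if "x \<le> C * \<Lambda> z" "C \<le> B" for x C
      using that(1) mult_right_mono[OF that(2) L0] by linarith
    have G': "\<forall>f\<in>G. \<bar>f z\<bar> \<le> \<sigma>" using elim(5) .
    have F': "\<forall>f\<in>F. \<bar>f z\<bar> \<le> B" using elim(4) B(2) order_trans by blast
    note * = levi_rho_nonneg[OF z B(1) \<gamma> elim(6) \<sigma>(1) \<sigma>(2)[unfolded K_def M_def] G'[unfolded G_def]
      F'[unfolded F_def] \<Lambda>_def[of z] maj1[OF elim(7)] up[OF elim(1) B(3)] up[OF elim(2) B(4)] up[OF elim(3) B(5)]]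
    show ?case using z * unfolding K_def M_def by blast
  qed
  then obtain d where d: "d > 0" "\<And>z. dist z p < d \<Longrightarrow> z \<in> S \<and> (\<forall>v. 0 \<le> levi (\<rho> K M) v v z) \<and> 0 < h K M z"
    unfolding eventually_nhds_metric by blast
  have sub: "ball p d \<subseteq> S" and pos: "\<And>z. z \<in> ball p d \<Longrightarrow> 0 < h K M z" using d(2) by (auto simp: dist_commute)
  show thesis
  proof (rule that[of "ball p d" "\<rho> K M"])
    show "ball p d \<subseteq> S" by (rule sub)
    show "0 \<le> levi (\<rho> K M) v v z" if "z \<in> ball p d" for z v using d(2) that by (auto simp: dist_commute)
    \<comment> \<open>The factor \<open>h\<close> is positive, so \<open>r\<close> and its multiple
      have the same sublevel set.\<close>
    have sgn: "\<rho> K M z < 0 \<longleftrightarrow> r z < 0" if "z \<in> ball p d" for z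
      using pos[OF that] by (auto simp: \<rho>_def mult_less_0_iff)
    have "\<Omega> \<inter> ball p d = {z \<in> ball p d. \<rho> K M z < 0}"
      using sublevel sgn sub by blast
    moreover have "frechet_derivative (\<rho> K M) (at z) \<noteq> (\<lambda>v. 0)" if "z \<in> frontier \<Omega> \<inter> ball p d" for z
    proof
      assume a: "frechet_derivative (\<rho> K M) (at z) = (\<lambda>v. 0)"
      have zS: "z \<in> S" using that sub by blast
      have "dir N (\<rho> K M) z = r z * dir N (h K M) z + dir N r z * h K M z"
        unfolding \<rho>_def by (rule dir_mult[OF smooth_r smooth_h zS])
      also have "r z = 0" using r_zero that zS by blast
      finally show False using a transversal[OF zS] pos[of z] that by simp
    qed
    ultimately show "local_defining_function \<Omega> p (ball p d) (\<rho> K M)"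
      unfolding local_defining_function_def using d(1) smooth_on_subset[OF smooth_rho sub] by auto
  qed
qed

end

subsection \<open>Functions from the type condition\<close>

text \<open>Subtracting complex multiples of an axis vector in slot \<open>j\<close> leaves the slot
  \<open>k\<close> equal to 1, which gives the lower bound on the norm.\<close>

lemma axis_frame:
  fixes j k :: 2 and \<nu> :: complex
  assumes "j \<noteq> k" "\<nu> \<noteq> 0"
  shows "\<exists>a b c d. v = a *\<^sub>R axis k 1 + b *\<^sub>R J (axis k 1) + c *\<^sub>R axis j \<nu> + d *\<^sub>R J (axis j \<nu>)"
    and "1 \<le> norm (axis k 1 - s *\<^sub>R axis j \<nu> - t *\<^sub>R J (axis j \<nu>))"
proof -
  have jk: "i = j \<or> i = k" for i using assms(1) exhaust_2 by metis
  define \<mu> where "\<mu> = v $ j / \<nu>"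
  have \<mu>: "v $ j = \<mu> * \<nu>" using assms(2) by (simp add: \<mu>_def)
  have "v = Re (v $ k) *\<^sub>R axis k 1 + Im (v $ k) *\<^sub>R J (axis k 1) + Re \<mu> *\<^sub>R axis j \<nu> + Im \<mu> *\<^sub>R J (axis j \<nu>)"
  proof (rule vec_eq_iff[THEN iffD2], rule allI)
    fix i
    show "v $ i = (Re (v $ k) *\<^sub>R axis k 1 + Im (v $ k) *\<^sub>R J (axis k 1) + Re \<mu> *\<^sub>R axis j \<nu> + Im \<mu> *\<^sub>R J (axis j \<nu>)) $ i"
      using jk[of i] assms(1) \<mu> by (auto simp: axis_def J_def complex_eq_iff)
  qed
  then show "\<exists>a b c d. v = a *\<^sub>R axis k 1 + b *\<^sub>R J (axis k 1) + c *\<^sub>R axis j \<nu> + d *\<^sub>R J (axis j \<nu>)" by blast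
  have "norm ((axis k 1 - s *\<^sub>R axis j \<nu> - t *\<^sub>R J (axis j \<nu>)) $ k) = 1"
    using assms(1) by (simp add: axis_def J_def)
  then show "1 \<le> norm (axis k 1 - s *\<^sub>R axis j \<nu> - t *\<^sub>R J (axis j \<nu>))"
    using Finite_Cartesian_Product.norm_nth_le[of "axis k 1 - s *\<^sub>R axis j \<nu> - t *\<^sub>R J (axis j \<nu>)" k] by simp
qed

text \<open>In a slot where the gradient (a, b) of \<open>r\<close> is nonzero, \<nu> = a + ib
  points along this gradient and gives the derivative a^2 + b^2.\<close>

lemma transversal_axis:
  fixes r :: "C2 \<Rightarrow> real"
  assumes "smooth_on U r" "p \<in> U" "frechet_derivative r (at p) \<noteq> (\<lambda>v. 0)"
  obtains j :: 2 and \<nu> where "\<nu> \<noteq> 0" "0 < dir (axis j \<nu>) r p"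
proof -
  note lin = linear_dir[OF assms(1,2)]
  obtain v where "dir v r p \<noteq> 0" using assms(3) by auto
  moreover have "dir v r p = Re (v $ 1) * dir (axis 1 1) r p + Im (v $ 1) * dir (axis 1 \<i>) r p
      + Re (v $ 2) * dir (axis 2 1) r p + Im (v $ 2) * dir (axis 2 \<i>) r p"
    by (subst C2_expand(1)[of v]) (simp add: linear_add[OF lin] linear_cmul[OF lin])
  ultimately obtain j :: 2 where j: "dir (axis j 1) r p \<noteq> 0 \<or> dir (axis j \<i>) r p \<noteq> 0" by force
  define a b where "a = dir (axis j 1) r p" and "b = dir (axis j \<i>) r p"
  have "axis j (Complex a b) = a *\<^sub>R axis j 1 + b *\<^sub>R axis j \<i>"
    by (auto simp: vec_eq_iff axis_def complex_eq_iff)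
  then have "dir (axis j (Complex a b)) r p = a\<^sup>2 + b\<^sup>2"
    by (simp add: linear_add[OF lin] linear_cmul[OF lin] a_def b_def power2_eq_square)
  moreover have "a\<^sup>2 + b\<^sup>2 > 0" using j unfolding a_def b_def by (simp add: sum_power2_gt_zero_iff)
  moreover have "Complex a b \<noteq> 0" using j by (auto simp: a_def b_def complex_eq_iff)
  ultimately show thesis using that[of "Complex a b" j] by simp
qed

lemma tangential_imp_dir_zero:
  assumes "smooth_on U r" "z \<in> U" "act10 L (\<lambda>w. complex_of_real (r w)) z = 0"
  shows "dir (L z) r z = 0" "dir (J (L z)) r z = 0"
proof -
  have D: "dir v (\<lambda>w. complex_of_real (r w)) z = complex_of_real (dir v r z)" for v
    by (rule dir_bounded_linear_comp[OF bounded_linear_of_real assms(1,2)])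
  have "(\<lambda>w. complex_of_real (r w)) differentiable (at z)"
    using bounded_linear.has_derivative[OF bounded_linear_of_real smooth_on_has_derivative[OF assms(1,2)]]
    by (rule differentiableI)
  then have "complex_of_real (dir (L z) r z) - \<i> * complex_of_real (dir (J (L z)) r z) = 0"
    using assms(3) by (simp add: act_eq_dir D)
  then show "dir (L z) r z = 0" "dir (J (L z)) r z = 0" by (auto simp: complex_eq_iff)
qed

lemma dir_complex_combination:
  assumes "smooth_on U f" "smooth_on U g" "z \<in> U"
  shows "dir v (\<lambda>w. complex_of_real (f w) + c * complex_of_real (g w)) z
      = complex_of_real (dir v f z) + c * complex_of_real (dir v g z)"
    and "(\<lambda>w. complex_of_real (f w) + c * complex_of_real (g w)) differentiable (at z)"
proof -
  have D: "((\<lambda>w. complex_of_real (f w) + c * complex_of_real (g w)) has_derivative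
      (\<lambda>v. complex_of_real (dir v f z) + c * complex_of_real (dir v g z))) (at z)"
    by (auto intro!: derivative_eq_intros has_derivative_of_real smooth_on_has_derivative assms)
  show "dir v (\<lambda>w. complex_of_real (f w) + c * complex_of_real (g w)) z
      = complex_of_real (dir v f z) + c * complex_of_real (dir v g z)" by (rule dir_eqI[OF D])
  show "(\<lambda>w. complex_of_real (f w) + c * complex_of_real (g w)) differentiable (at z)"
    by (rule differentiableI[OF D])
qed

text \<open>As \<open>l\<close> is real, one letter yields half of (X1 - i X2) or (X1 + i X2) with
  X1, X2 real. Both vanish at \<open>p\<close> because no word of length 1 survives, and a second
  letter can only be nonzero if X1 or X2 has a nonzero derivative along L or J L. A real function is
  extracted because \<phi> needs its square.\<close>

lemma nonzero_word_two:
  assumes U: "open U" "p \<in> U" "smooth_on U l" "smooth_on U L"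
    and lam: "\<And>z. z \<in> U \<Longrightarrow> lam z = complex_of_real (l z)"
    and w1: "\<not> nonzero_word L lam p 1" and w2: "nonzero_word L lam p 2"
  obtains X where "X = (\<lambda>z. dir (L z) l z) \<or> X = (\<lambda>z. dir (J (L z)) l z)" "X p = 0"
    "dir (L p) X p \<noteq> 0 \<or> dir (J (L p)) X p \<noteq> 0"
proof -
  define X1 X2 where "X1 z = dir (L z) l z" and "X2 z = dir (J (L z)) l z" for z
  have sX: "smooth_on U X1" "smooth_on U X2" unfolding X1_def X2_def
    by (intro smooth_on_dir_field U smooth_on_bounded_linear_comp[OF _ bounded_linear_J])+
  have act: "act10 L lam z = complex_of_real (X1 z / 2) + (- \<i>) * complex_of_real (X2 z / 2)"
    "act01 L lam z = complex_of_real (X1 z / 2) + \<i> * complex_of_real (X2 z / 2)" if z: "z \<in> U" for z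
  proof -
    have "lam differentiable (at z) \<longleftrightarrow> (\<lambda>z. complex_of_real (l z)) differentiable (at z)"
      by (rule differentiable_cong_open[OF U(1) _ z]) (rule lam)
    moreover have "(\<lambda>z. complex_of_real (l z)) differentiable (at z)"
      by (rule differentiableI[OF bounded_linear.has_derivative[OF bounded_linear_of_real smooth_on_has_derivative[OF U(3) z]]])
    ultimately have diff: "lam differentiable (at z)" by blast
    have "dir v lam z = complex_of_real (dir v l z)" for v
    proof -
      have "dir v lam z = dir v (\<lambda>z. complex_of_real (l z)) z"
        by (rule dir_cong[OF U(1) _ z]) (rule lam)
      also have "\<dots> = complex_of_real (dir v l z)"
        by (rule dir_bounded_linear_comp[OF bounded_linear_of_real U(3) z])
      finally show ?thesis .
    qed
    then show "act10 L lam z = complex_of_real (X1 z / 2) + (- \<i>) * complex_of_real (X2 z / 2)"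
      "act01 L lam z = complex_of_real (X1 z / 2) + \<i> * complex_of_real (X2 z / 2)"
      using act_eq_dir[OF diff, of L] by (simp_all add: X1_def X2_def field_simps)
  qed
  have "act10 L lam p = 0"
  proof (rule ccontr)
    assume "act10 L lam p \<noteq> 0"
    then have "nonzero_word L lam p 1"
      unfolding nonzero_word_def by (intro exI[of _ "[act10 L]"]) simp
    then show False using w1 by blast
  qed
  then have X0: "X1 p = 0" "X2 p = 0" using act(1)[OF U(2)] by (auto simp: complex_eq_iff)
  obtain A B where AB: "A \<in> {act10 L, act01 L}" "B \<in> {act10 L, act01 L}" "B (A lam) p \<noteq> 0"
  proof -
    obtain Ls where Ls: "length Ls = 2" "set Ls \<subseteq> {act10 L, act01 L}" "fold (\<lambda>X f. X f) Ls lam p \<noteq> 0"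
      using w2 unfolding nonzero_word_def by blast
    then obtain A B where "Ls = [A, B]" by (auto simp: numeral_2_eq_2 length_Suc_conv)
    then show thesis using Ls that[of A B] by simp
  qed
  obtain c where c: "\<And>z. z \<in> U \<Longrightarrow> A lam z = complex_of_real (X1 z / 2) + c * complex_of_real (X2 z / 2)"
    using AB(1) act that[of "- \<i>"] that[of "\<i>"] by blast
  define F where "F z = complex_of_real (X1 z / 2) + c * complex_of_real (X2 z / 2)" for z
  have s2: "smooth_on U (\<lambda>z. X1 z / 2)" "smooth_on U (\<lambda>z. X2 z / 2)"
    by (intro smooth_on_divide U sX smooth_on_const; simp)+
  have d2: "dir v (\<lambda>z. X1 z / 2) p = dir v X1 p / 2" "dir v (\<lambda>z. X2 z / 2) p = dir v X2 p / 2" for v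
    using dir_bounded_linear_comp[OF bounded_linear_divide sX(1) U(2)]
      dir_bounded_linear_comp[OF bounded_linear_divide sX(2) U(2)] by simp_all
  have dF: "dir v (A lam) p = complex_of_real (dir v X1 p / 2) + c * complex_of_real (dir v X2 p / 2)" for v
  proof -
    have "dir v (A lam) p = dir v F p"
      by (rule dir_cong[OF U(1) _ U(2)]) (use c in \<open>simp add: F_def\<close>)
    then show ?thesis unfolding F_def dir_complex_combination(1)[OF s2 U(2)] d2 .
  qed
  have "A lam differentiable (at p) \<longleftrightarrow> F differentiable (at p)"
    by (rule differentiable_cong_open[OF U(1) _ U(2)]) (use c in \<open>simp add: F_def\<close>)
  then have "A lam differentiable (at p)"
    unfolding F_def using dir_complex_combination(2)[OF s2 U(2)] by blast
  from act_eq_dir[OF this, of L] have "dir (L p) (A lam) p \<noteq> 0 \<or> dir (J (L p)) (A lam) p \<noteq> 0"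
    using AB(2,3) by auto
  then have "(dir (L p) X1 p \<noteq> 0 \<or> dir (J (L p)) X1 p \<noteq> 0) \<or> (dir (L p) X2 p \<noteq> 0 \<or> dir (J (L p)) X2 p \<noteq> 0)"
    unfolding dF by auto
  then show thesis using that[of X1] that[of X2] X0 unfolding X1_def[abs_def] X2_def[abs_def] by blast
qed

context framed_boundary_chart
begin

text \<open>The chart is instantiated again with base point \<open>w\<close>. As the differential of
  \<open>r'\<close> is nonzero, so is the factor of proportionality, and vectors tangential for
  \<open>r'\<close> are tangential for \<open>r\<close>, hence complex multiples of
  \<open>L w\<close>.\<close>

lemma levi_comparison:
  assumes r': "open S'" "S \<subseteq> S'" "smooth_on S' r'" "\<And>w. w \<in> frontier \<Omega> \<inter> S' \<Longrightarrow> r' w = 0"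
    and w: "w \<in> frontier \<Omega> \<inter> S" and nz: "frechet_derivative r' (at w) \<noteq> (\<lambda>v. 0)"
    and u: "dir u r' w = 0" "dir (J u) r' w = 0"
  obtains a b where "dir u r w = 0" "dir (J u) r w = 0" "u = a *\<^sub>R L w + b *\<^sub>R J (L w)"
    "a\<^sup>2 + b\<^sup>2 \<le> (norm u)\<^sup>2" "levi r' u u w = (dir N r' w / dir N r w) * ((a\<^sup>2 + b\<^sup>2) * levi r (L w) (L w) w)"
proof -
  have wS: "w \<in> S" "w \<in> S'" using w r'(2) by auto
  interpret w: boundary_chart \<Omega> S r w N
    by unfold_locales (use open_\<Omega> open_S w smooth_r sublevel transversal in auto)
  define c where "c = dir N r' w / dir N r w"
  have d: "dir v r' w = c * dir v r w" for v
    unfolding c_def by (rule w.levi_transformation(1)[OF r'(1) wS(2) r'(3,4)])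
  have "c \<noteq> 0"
  proof
    assume "c = 0"
    then have "frechet_derivative r' (at w) = (\<lambda>v. 0)" using d by (intro ext) simp
    then show False using nz by blast
  qed
  then have u': "dir u r w = 0" "dir (J u) r w = 0" using u d by auto
  obtain a b where ab: "u = a *\<^sub>R L w + b *\<^sub>R J (L w)" "a\<^sup>2 + b\<^sup>2 \<le> (norm u)\<^sup>2"
    using tangent_vector_cases[OF wS(1) u'] by metis
  have "levi r u u w = (a\<^sup>2 + b\<^sup>2) * levi r (L w) (L w) w"
    using levi_frame[OF open_S smooth_r wS(1), of a "L w" b 0 N 0] unfolding ab(1) by simp
  then have "levi r' u u w = c * ((a\<^sup>2 + b\<^sup>2) * levi r (L w) (L w) w)"
    using w.levi_transformation(2)[OF r'(1) wS(2) r'(3,4) u'] unfolding c_def by simp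
  then show thesis using that u' ab unfolding c_def by blast
qed

end

theorem theorem6p19:
  fixes \<Omega> :: "(complex ^ 2) set" and p0 :: "complex ^ 2"
  assumes "open \<Omega>" and "connected \<Omega>"
    and "smoothly_bounded \<Omega>"
    and "pseudoconvex \<Omega>"
    and "p0 \<in> frontier \<Omega>"
    and "boundary_type \<Omega> p0 4"
    and "\<exists>U r. local_defining_function \<Omega> p0 U r \<and> plurisubharmonic_on_boundary_near \<Omega> p0 U r"
  shows "\<exists>U r. local_defining_function \<Omega> p0 U r \<and> plurisubharmonic_on U r"
proof -
  obtain U r where ldf: "local_defining_function \<Omega> p0 U r" and psh_near: "plurisubharmonic_on_boundary_near \<Omega> p0 U r"
    using assms(7) by blast
  have r: "open U" "p0 \<in> U" "smooth_on U r" "\<Omega> \<inter> U = {z \<in> U. r z < 0}"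
    "\<And>z. z \<in> frontier \<Omega> \<inter> U \<Longrightarrow> frechet_derivative r (at z) \<noteq> (\<lambda>v. 0)"
    using ldf unfolding local_defining_function_def by blast+
  obtain U' where U': "open U'" "p0 \<in> U'" "U' \<subseteq> U"
    "\<And>V z. smooth_on U' V \<Longrightarrow> z \<in> frontier \<Omega> \<inter> U' \<Longrightarrow> 0 \<le> Re (complex_hessian r V V z)"
    using psh_near unfolding plurisubharmonic_on_boundary_near_def by blast
  \<comment> \<open>The type comes with its own defining function and field, in general unrelated to
    \<open>r\<close>.\<close>
  obtain U1 r1 L1 where ldf1: "local_defining_function \<Omega> p0 U1 r1" and L1: "smooth_on U1 L1" "tangential \<Omega> U1 r1 L1"
    and words: "nonzero_word L1 (complex_hessian r1 L1 L1) p0 (4 - 2)"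
      "\<And>m. 2 \<le> m \<Longrightarrow> m < 4 \<Longrightarrow> \<not> nonzero_word L1 (complex_hessian r1 L1 L1) p0 (m - 2)"
    using assms(6) unfolding boundary_type_def by blast
  have r1: "open U1" "p0 \<in> U1" "smooth_on U1 r1" "\<Omega> \<inter> U1 = {z \<in> U1. r1 z < 0}"
    "\<And>z. z \<in> frontier \<Omega> \<inter> U1 \<Longrightarrow> frechet_derivative r1 (at z) \<noteq> (\<lambda>v. 0)"
    using ldf1 unfolding local_defining_function_def by blast+
  have r1_zero: "r1 w = 0" if "w \<in> frontier \<Omega> \<inter> U1" for w
    using defining_function_zero_on_frontier[OF assms(1) r1(1) smooth_on_imp_continuous_on[OF r1(3)] r1(4)] that by blast
  obtain j :: 2 and \<nu> where j: "\<nu> \<noteq> 0" "0 < dir (axis j \<nu>) r p0"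
    using transversal_axis[OF r(3,2)] r(5) assms(5) r(2) by blast
  define N where "N = axis j \<nu>"
  \<comment> \<open>In the index type \<open>2\<close>, \<open>j + 1\<close> is the other
    index.\<close>
  define e :: C2 where "e = axis (j + 1) 1"
  have jk: "j \<noteq> j + 1" by simp
  define S where "S = {z \<in> U' \<inter> U1. 0 < dir N r z}"
  have S: "S \<subseteq> U'" "S \<subseteq> U1" "S \<subseteq> U" using U'(3) by (auto simp: S_def)
  have "continuous_on (U' \<inter> U1) (dir N r)"
    using smooth_on_imp_continuous_on[OF smooth_on_dir[OF r(3)]] U'(3) by (meson Int_lower1 continuous_on_subset)
  then have "open (dir N r -` {0<..} \<inter> (U' \<inter> U1))"
    using continuous_on_open_vimage[OF open_Int[OF U'(1) r1(1)]] open_greaterThan by blast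
  moreover have "dir N r -` {0<..} \<inter> (U' \<inter> U1) = S" by (auto simp: S_def)
  ultimately have openS: "open S" by simp
  have pS: "p0 \<in> S" using U'(2) r1(2) j(2) by (auto simp: S_def N_def)
  have sub: "\<Omega> \<inter> S = {z \<in> S. r z < 0}" using r(4) S(3) by blast
  interpret framed_boundary_chart \<Omega> S r p0 N e
  proof unfold_locales
    show "smooth_on S r" using smooth_on_subset[OF r(3) S(3)] .
    show "0 < dir N r z" if "z \<in> S" for z using that by (simp add: S_def)
    show "\<exists>a b c d. v = a *\<^sub>R e + b *\<^sub>R J e + c *\<^sub>R N + d *\<^sub>R J N" for v
      unfolding e_def N_def by (rule axis_frame[OF jk j(1)])
    show "1 \<le> norm (e - s *\<^sub>R N - t *\<^sub>R J N)" for s t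
      unfolding e_def N_def by (rule axis_frame[OF jk j(1)])
  qed (use assms(1,5) openS pS sub in auto)
  have psh: "0 \<le> levi r v v w" if w: "w \<in> frontier \<Omega> \<inter> S" for w v
  proof -
    \<comment> \<open>Constant fields turn the hypothesis on vector fields into one on
      vectors.\<close>
    have "0 \<le> Re (complex_hessian r (\<lambda>z. v) (\<lambda>z. v) w)"
      by (rule U'(4)) (use w S(1) in \<open>auto simp: smooth_on_const\<close>)
    moreover have "w \<in> U" using w S(3) by blast
    ultimately show ?thesis by (simp add: complex_hessian_eq_levi[OF r(1,3)])
  qed
  define l where "l z = levi r1 (L1 z) (L1 z) z" for z
  have hess: "complex_hessian r1 L1 L1 z = complex_of_real (l z / 4)" if "z \<in> U1" for z
    using complex_hessian_eq_levi[OF r1(1,3) that] by (simp add: l_def)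
  have sl1: "smooth_on U1 l" unfolding l_def by (intro smooth_on_levi r1 L1)
  have sl: "smooth_on S l" by (rule smooth_on_subset[OF sl1 S(2)])
  have l_nonneg: "0 \<le> l w" if w: "w \<in> frontier \<Omega> \<inter> S" for w
  proof -
    \<comment> \<open>Pseudoconvexity supplies the sign of the Levi form of \<open>r1\<close>, so
      that the gradient bound applies to it.\<close>
    have "0 \<le> Re (complex_hessian r1 L1 L1 w)"
      using assms(4,5) ldf1 L1 w S(2) unfolding pseudoconvex_def by blast
    moreover have "w \<in> U1" using w S(2) by blast
    ultimately show ?thesis by (simp add: hess)
  qed
  have sl4: "smooth_on U1 (\<lambda>z. l z / 4)" by (intro smooth_on_divide r1 sl1 smooth_on_const) simp
  \<comment> \<open>Words for type m have length m - 2: type 4 gives a nonzero word of length 2, and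
    the excluded m = 3 says that those of length 1 vanish at \<open>p0\<close>.\<close>
  obtain Y where Y: "Y = (\<lambda>z. dir (L1 z) (\<lambda>z. l z / 4) z) \<or> Y = (\<lambda>z. dir (J (L1 z)) (\<lambda>z. l z / 4) z)" "Y p0 = 0"
    "dir (L1 p0) Y p0 \<noteq> 0 \<or> dir (J (L1 p0)) Y p0 \<noteq> 0"
    using nonzero_word_two[OF r1(1,2) sl4 L1(1) hess] words(1) words(2)[of 3] by auto
  have sY: "smooth_on S Y"
    using Y(1) smooth_on_dir_field[OF r1(1) sl4] L1(1) smooth_on_bounded_linear_comp[OF r1(1) bounded_linear_J L1(1)]
      smooth_on_subset[OF _ S(2)] by blast
  have tang: "dir (L1 w) r1 w = 0" "dir (J (L1 w)) r1 w = 0" if "w \<in> frontier \<Omega> \<inter> U1" for w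
    using tangential_imp_dir_zero[OF r1(3), of w L1] L1(2) that unfolding tangential_def by blast+
  have cmp: "\<exists>a b. dir (L1 w) r w = 0 \<and> dir (J (L1 w)) r w = 0 \<and> L1 w = a *\<^sub>R L w + b *\<^sub>R J (L w) \<and>
      a\<^sup>2 + b\<^sup>2 \<le> (norm (L1 w))\<^sup>2 \<and> l w = (dir N r1 w / dir N r w) * ((a\<^sup>2 + b\<^sup>2) * levi r (L w) (L w) w)"
    if w: "w \<in> frontier \<Omega> \<inter> S" for w
  proof -
    have w1: "w \<in> frontier \<Omega> \<inter> U1" using w S(2) by blast
    show ?thesis using levi_comparison[OF r1(1) S(2) r1(3) r1_zero w r1(5)[OF w1] tang[OF w1]] unfolding l_def by metis
  qed
  \<comment> \<open>\<open>L1 p0\<close> is a complex multiple of \<open>L p0\<close>, so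
    derivatives of \<open>Y\<close> along \<open>L p0\<close> cannot all vanish if those along
    \<open>L1 p0\<close> do not.\<close>
  have nondeg: "0 < (dir (L p0) Y p0)\<^sup>2 + (dir (J (L p0)) Y p0)\<^sup>2"
  proof -
    note lin = linear_dir[OF sY pS]
    obtain a b where "L1 p0 = a *\<^sub>R L p0 + b *\<^sub>R J (L p0)" using cmp[of p0] assms(5) pS by blast
    then have "dir (L1 p0) Y p0 = a * dir (L p0) Y p0 + b * dir (J (L p0)) Y p0"
      "dir (J (L1 p0)) Y p0 = a * dir (J (L p0)) Y p0 - b * dir (L p0) Y p0"
      by (simp_all add: linear_add[OF lin] linear_diff[OF lin] linear_cmul[OF lin] linear_neg[OF lin])
    then have "dir (L p0) Y p0 \<noteq> 0 \<or> dir (J (L p0)) Y p0 \<noteq> 0" using Y(3) by auto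
    then show ?thesis by (simp add: sum_power2_gt_zero_iff)
  qed
  define Q where "Q z = (dir (L z) Y z)\<^sup>2 + (dir (J (L z)) Y z)\<^sup>2" for z
  have sQ: "smooth_on S Q" unfolding Q_def
    by (intro smooth_on_add smooth_on_power2 smooth_on_dir_field smooth_L smooth_JL sY openS)
  \<comment> \<open>The chart is shrunk once more so that the denominator of \<open>coeff\<close>
    stays positive.\<close>
  define S' where "S' = {z \<in> S. 0 < Q z}"
  have "open (Q -` {0<..} \<inter> S)"
    using continuous_on_open_vimage[OF openS] smooth_on_imp_continuous_on[OF sQ] open_greaterThan by blast
  moreover have "Q -` {0<..} \<inter> S = S'" by (auto simp: S'_def)
  ultimately have openS': "open S'" by simp
  have S': "S' \<subseteq> S" "p0 \<in> S'" using nondeg pS by (auto simp: S'_def Q_def)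
  obtain C \<delta> where C: "\<delta> > 0" "C > 0" "ball p0 \<delta> \<subseteq> S"
    "\<And>w v. w \<in> frontier \<Omega> \<inter> ball p0 \<delta> \<Longrightarrow> dir v r w = 0 \<Longrightarrow> (dir v l w)\<^sup>2 \<le> C * (norm v)\<^sup>2 * l w"
    using boundary_gradient_bound[OF sl l_nonneg] by metis
  define c where "c z = dir N r1 z / dir N r z" for z
  define n where "n z = L1 z \<bullet> L1 z" for z
  have sL1: "smooth_on S L1" by (rule smooth_on_subset[OF L1(1) S(2)])
  have "smooth_on S c" unfolding c_def
    by (intro smooth_on_divide openS smooth_on_dir smooth_r smooth_on_subset[OF r1(3) S(2)]) (use transversal in force)
  moreover have "smooth_on S n" unfolding n_def by (intro smooth_on_inner openS sL1)
  ultimately obtain B where B: "1 \<le> B" "\<forall>\<^sub>F z in nhds p0. \<forall>f\<in>{c, n}. \<bar>f z\<bar> \<le> B"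
    using eventually_bounded_family[of "{c, n}" S p0] openS pS by blast
  then obtain \<delta>' where \<delta>': "\<delta>' > 0" "\<And>z. dist z p0 < \<delta>' \<Longrightarrow> \<bar>c z\<bar> \<le> B \<and> \<bar>n z\<bar> \<le> B"
    unfolding eventually_nhds_metric by auto
  \<comment> \<open>The factor \<open>C * B\<close> comes from the gradient bound with |L1|^2 \<le>
    B. The other two factors \<open>B\<close> bound the ratio of the normal derivatives and the
    squared size of \<open>L1\<close> relative to \<open>L\<close>, which convert the Levi form of
    \<open>r1\<close> into that of \<open>r\<close>.\<close>
  have Y_bound: "(Y w)\<^sup>2 \<le> (C * B * (B * B)) * levi r (L w) (L w) w"
    if w: "w \<in> frontier \<Omega> \<inter> ball p0 (min \<delta> \<delta>')" for w
  proof -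
    have wS: "w \<in> frontier \<Omega> \<inter> S" using w C(3) by auto
    obtain a b where ab: "dir (L1 w) r w = 0" "dir (J (L1 w)) r w = 0"
      "a\<^sup>2 + b\<^sup>2 \<le> (norm (L1 w))\<^sup>2" "l w = c w * ((a\<^sup>2 + b\<^sup>2) * levi r (L w) (L w) w)"
      using cmp[OF wS] unfolding c_def by blast
    have cn: "\<bar>c w\<bar> \<le> B" "(norm (L1 w))\<^sup>2 \<le> B"
      using \<delta>'(2)[of w] w by (auto simp: dist_commute n_def power2_norm_eq_inner)
    have lam0: "0 \<le> levi r (L w) (L w) w" by (rule psh[OF wS])
    have "dir v (\<lambda>z. l z / 4) w = dir v l w / 4" for v
      using dir_bounded_linear_comp[OF bounded_linear_divide sl] wS by blast
    then obtain v where v: "Y w = dir v l w / 4" "dir v r w = 0" "norm v = norm (L1 w)"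
      using Y(1) ab(1,2) by auto
    have "(Y w)\<^sup>2 \<le> (dir v l w)\<^sup>2" by (simp add: v(1) power_divide)
    also have "\<dots> \<le> C * (norm (L1 w))\<^sup>2 * l w" using C(4)[of w v] w v(2,3) by simp
    also have "\<dots> \<le> C * B * l w" using C(2) cn(2) l_nonneg[OF wS] by (intro mult_right_mono mult_left_mono) auto
    also have "l w \<le> B * (B * levi r (L w) (L w) w)"
      unfolding ab(4)
    proof -
      have "(a\<^sup>2 + b\<^sup>2) * levi r (L w) (L w) w \<le> B * levi r (L w) (L w) w"
        using ab(3) cn(2) lam0 by (intro mult_right_mono) auto
      then show "c w * ((a\<^sup>2 + b\<^sup>2) * levi r (L w) (L w) w) \<le> B * (B * levi r (L w) (L w) w)"
        by (intro mult_mono[OF abs_le_D1[OF cn(1)]] mult_nonneg_nonneg lam0) (use B(1) in simp_all)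
    qed
    then have "C * B * l w \<le> C * B * (B * (B * levi r (L w) (L w) w))"
      using C(2) B(1) by (intro mult_left_mono) auto
    finally show ?thesis by (simp add: mult.assoc)
  qed
  interpret P: psh_boundary_chart \<Omega> S' r p0 N e Y "min \<delta> \<delta>'" "C * B * (B * B)"
  proof unfold_locales
    show "smooth_on S' r" "smooth_on S' Y" using smooth_on_subset smooth_r sY S'(1) by blast+
    show "\<Omega> \<inter> S' = {z \<in> S'. r z < 0}" using sublevel S'(1) by blast
    show "0 < (dir (L z) Y z)\<^sup>2 + (dir (J (L z)) Y z)\<^sup>2" if "z \<in> S'" for z
      using that by (simp add: S'_def Q_def)
    show "(Y w)\<^sup>2 \<le> C * B * (B * B) * levi r (L w) (L w) w" if "w \<in> frontier \<Omega> \<inter> ball p0 (min \<delta> \<delta>')" for w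
      by (rule Y_bound[OF that])
  qed (use open_\<Omega> p_frontier frame unit openS' S' transversal psh Y(2) C(1) \<delta>'(1) in auto)
  obtain W \<rho>' where W: "local_defining_function \<Omega> p0 W \<rho>'" "\<And>z v. z \<in> W \<Longrightarrow> 0 \<le> levi \<rho>' v v z"
    using P.plurisubharmonic_modification by metis
  have "open W" "smooth_on W \<rho>'" using W(1) unfolding local_defining_function_def by blast+
  then have "plurisubharmonic_on W \<rho>'"
    unfolding plurisubharmonic_on_def by (simp add: complex_hessian_eq_levi[of W] W(2) del: of_real_divide)
  then show ?thesis using W(1) by blast
qed

end
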